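(* Let $n\ge2$ and $\varphi\in\operatorname{Aut}(\mathfrak{A}_n)$. The crossed product $\mathcal{O}_n\times_\varphi\mathbb{Z}$ is isomorphic to $\mathfrak{B}/\mathfrak{J}$, where $\mathfrak{B}=C^*(\mathrm{id}^{(\infty)}(\mathcal{E}_n),\,U_\varphi\otimes M_z)$, acting on $\ell^2(\mathbb{F}_n^+)\otimes L^2(\mathbb{T})$, and $\mathfrak{J}$ is the ideal of $\mathfrak{B}$ generated by $\mathrm{id}^{(\infty)}(\mathfrak{K})$, with $\mathfrak{K}=\mathcal{K}(\ell^2(\mathbb{F}_n^+))$ the compact operators.
   Context: Let $\mathbb{F}_n^+$ be the free unital semigroup on generators $1,\dots,n$, let $\ell^2(\mathbb{F}_n^+)$ have orthonormal basis $\{\xi_w\}$, and let $L_i\xi_w=\xi_{iw}$. $\mathfrak{A}_n$ is the norm-closed unital operator algebra generated by $L_1,\dots,L_n$; $\mathcal{E}_n=C^*(L_1,\dots,L_n)$ is the Cuntz--Toeplitz algebra, which contains the compact operators $\mathcal{K}(\ell^2(\mathbb{F}_n^+))$, and $\mathcal{O}_n=\mathcal{E}_n/\mathcal{K}(\ell^2(\mathbb{F}_n^+))$ is the Cuntz algebra. $\operatorname{Aut}(\mathfrak{A}_n)$ is the group of completely isometric automorphisms of $\mathfrak{A}_n$. For each such $\varphi$ there is (Voiculescu) a unitary $U_\varphi$ on $\ell^2(\mathbb{F}_n^+)$, unique up to a scalar of modulus one, with $U_\varphi^*AU_\varphi=\varphi(A)$ for $A\in\mathfrak{A}_n$; conjugation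 $A\mapsto U_\varphi^*AU_\varphi$ is an automorphism of $\mathcal{E}_n$ and induces an automorphism of $\mathcal{O}_n$, also denoted $\varphi$. $\mathcal{O}_n\times_\varphi\mathbb{Z}$ is the C*-crossed product, generated by $\mathcal{O}_n$ and a unitary $u$ with $Au=u\varphi(A)$ for $A\in\mathcal{O}_n$. For $A\in\mathcal{E}_n$, $\mathrm{id}^{(\infty)}(A)=A\otimes I$ on $\ell^2(\mathbb{F}_n^+)\otimes L^2(\mathbb{T})$, and $M_z$ is multiplication by $z$ on $L^2(\mathbb{T})$. *)

theory Defs
  imports "HOL-Analysis.Analysis" "HOL-Probability.Probability" "HOL-Algebra.QuotRing"
begin

section \<open>Complex Hilbert spaces\<close>

class complex_inner = real_inner +
  fixes scaleC :: "complex \<Rightarrow> 'a \<Rightarrow> 'a"  (infixr \<open>*\<^sub>C\<close> 75)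
    and cinner :: "'a \<Rightarrow> 'a \<Rightarrow> complex"
  assumes scaleC_add_right: "a *\<^sub>C (x + y) = a *\<^sub>C x + a *\<^sub>C y"
    and scaleC_add_left: "(a + b) *\<^sub>C x = a *\<^sub>C x + b *\<^sub>C x"
    and scaleC_scaleC: "a *\<^sub>C b *\<^sub>C x = (a * b) *\<^sub>C x"
    and scaleC_of_real: "complex_of_real r *\<^sub>C x = r *\<^sub>R x"
    and cinner_commute: "cinner x y = cnj (cinner y x)"
    and cinner_add_left: "cinner (x + y) z = cinner x z + cinner y z"
    and cinner_scaleC_left: "cinner (a *\<^sub>C x) y = a * cinner x y"
    and inner_eq_Re_cinner: "inner x y = Re (cinner x y)"

class chilbert_space = complex_inner + complete_space

lemma cinner_add_right: "cinner z (x + y) = cinner z x + cinner z y"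
  for x y z :: "'a::complex_inner"
  by (metis cinner_add_left cinner_commute complex_cnj_add)

lemma cinner_scaleC_right: "cinner x (a *\<^sub>C y) = cnj a * cinner x y"
  for x y :: "'a::complex_inner"
  by (metis cinner_commute cinner_scaleC_left complex_cnj_mult)

lemma cinner_self: "cinner x x = complex_of_real ((norm x)\<^sup>2)"
  for x :: "'a::complex_inner"
proof -
  have "Im (cinner x x) = 0"
    using cinner_commute[of x x] by (metis complex_cnj_cancel_iff Reals_cnj_iff complex_is_Real_iff)
  then show ?thesis
    by (simp add: complex_eq_iff inner_eq_Re_cinner[symmetric] power2_norm_eq_inner)
qed

lemma norm_scaleC: "norm (a *\<^sub>C x) = cmod a * norm x"
  for x :: "'a::complex_inner"
proof -
  have "complex_of_real ((norm (a *\<^sub>C x))\<^sup>2) = complex_of_real ((cmod a * norm x)\<^sup>2)"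
    unfolding cinner_self[symmetric] cinner_scaleC_left cinner_scaleC_right
    by (simp add: cinner_self power_mult_distrib complex_norm_square mult_ac del: of_real_power)
  then show ?thesis
    by (metis abs_norm_cancel mult_nonneg_nonneg norm_ge_zero of_real_eq_iff power2_eq_iff_nonneg)
qed

lemma norm_cinner_le: "cmod (cinner x y) \<le> norm x * norm y"
  for x y :: "'a::complex_inner"
proof -
  define c where "c = cnj (sgn (cinner x y))"
  have "cmod (cinner x y) = Re (c * cinner x y)"
  proof (cases "cinner x y = 0")
    case False
    have "c * cinner x y = complex_of_real (cmod (cinner x y))"
      using False complex_norm_square[of "cinner x y"]
      by (simp add: c_def sgn_eq divide_simps power2_eq_square mult.commute)
    then show ?thesis by simp
  qed auto
  also have "\<dots> = inner (c *\<^sub>C x) y"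
    by (simp add: inner_eq_Re_cinner cinner_scaleC_left)
  also have "\<dots> \<le> norm (c *\<^sub>C x) * norm y"
    by (rule norm_cauchy_schwarz)
  also have "\<dots> \<le> norm x * norm y"
    by (intro mult_right_mono) (auto simp: norm_scaleC c_def norm_sgn)
  finally show ?thesis .
qed

instantiation complex :: chilbert_space
begin
definition scaleC_complex :: "complex \<Rightarrow> complex \<Rightarrow> complex"
  where "scaleC_complex = (*)"
definition cinner_complex :: "complex \<Rightarrow> complex \<Rightarrow> complex"
  where "cinner_complex x y = x * cnj y"
instance
  by standard (auto simp: scaleC_complex_def cinner_complex_def inner_complex_def
      algebra_simps scaleR_conv_of_real)
end


section \<open>The spaces of square-summable families\<close>

typedef (overloaded) ('a, 'b::chilbert_space) ell2 =
  "{f :: 'a \<Rightarrow> 'b. (\<lambda>x. (norm (f x))\<^sup>2) summable_on UNIV}"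
  morphisms ell2_fun Abs_ell2
  by (rule exI[of _ "\<lambda>_. 0"]) auto

setup_lifting type_definition_ell2

lemma square_summable_add:
  fixes f g :: "'a \<Rightarrow> 'b::real_normed_vector"
  assumes "(\<lambda>x. (norm (f x))\<^sup>2) summable_on A" "(\<lambda>x. (norm (g x))\<^sup>2) summable_on A"
  shows "(\<lambda>x. (norm (f x + g x))\<^sup>2) summable_on A"
proof (rule summable_on_comparison_test)
  show "(\<lambda>x. 2 * ((norm (f x))\<^sup>2 + (norm (g x))\<^sup>2)) summable_on A"
    by (intro summable_on_cmult_right summable_on_add assms)
  fix x
  have "(norm (f x + g x))\<^sup>2 \<le> (norm (f x) + norm (g x))\<^sup>2"
    by (intro power_mono norm_triangle_ineq) auto
  also have "\<dots> \<le> 2 * ((norm (f x))\<^sup>2 + (norm (g x))\<^sup>2)"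
    using sum_squares_bound[of "norm (f x)" "norm (g x)"] by (simp add: power2_sum)
  finally show "(norm (f x + g x))\<^sup>2 \<le> 2 * ((norm (f x))\<^sup>2 + (norm (g x))\<^sup>2)" .
qed auto

lemma square_summable_product:
  fixes f g :: "'a \<Rightarrow> 'b::real_normed_vector" and h :: "'a \<Rightarrow> 'c::banach"
  assumes "(\<lambda>x. (norm (f x))\<^sup>2) summable_on A" "(\<lambda>x. (norm (g x))\<^sup>2) summable_on A"
    and "\<And>x. norm (h x) \<le> norm (f x) * norm (g x)"
  shows "h summable_on A"
proof (rule abs_summable_summable, rule summable_on_comparison_test)
  show "(\<lambda>x. (norm (f x))\<^sup>2 + (norm (g x))\<^sup>2) summable_on A"
    using assms(1,2) by (rule summable_on_add)
  show "norm (h x) \<le> (norm (f x))\<^sup>2 + (norm (g x))\<^sup>2" for x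
  proof -
    have "0 \<le> norm (f x) * norm (g x)" by simp
    then show ?thesis
      using assms(3)[of x] sum_squares_bound[of "norm (f x)" "norm (g x)"] by linarith
  qed
qed auto

lemma cinner_summable:
  fixes f g :: "'a \<Rightarrow> 'b::complex_inner"
  assumes "(\<lambda>x. (norm (f x))\<^sup>2) summable_on UNIV" "(\<lambda>x. (norm (g x))\<^sup>2) summable_on UNIV"
  shows "(\<lambda>x. cinner (f x) (g x)) summable_on UNIV"
  using assms by (rule square_summable_product[where h = "\<lambda>x. cinner (f x) (g x)"]) (rule norm_cinner_le)

instantiation ell2 :: (type, chilbert_space) complex_inner
begin

lift_definition zero_ell2 :: "('a, 'b) ell2" is "\<lambda>_. 0" by simp
lift_definition plus_ell2 :: "('a, 'b) ell2 \<Rightarrow> ('a, 'b) ell2 \<Rightarrow> ('a, 'b) ell2"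
  is "\<lambda>f g x. f x + g x" by (rule square_summable_add)
lift_definition uminus_ell2 :: "('a, 'b) ell2 \<Rightarrow> ('a, 'b) ell2" is "\<lambda>f x. - f x" by simp
lift_definition minus_ell2 :: "('a, 'b) ell2 \<Rightarrow> ('a, 'b) ell2 \<Rightarrow> ('a, 'b) ell2"
  is "\<lambda>f g x. f x - g x" proof -
  fix f g :: "'a \<Rightarrow> 'b"
  assume "(\<lambda>x. (norm (f x))\<^sup>2) summable_on UNIV" "(\<lambda>x. (norm (g x))\<^sup>2) summable_on UNIV"
  then show "(\<lambda>x. (norm (f x - g x))\<^sup>2) summable_on UNIV"
    using square_summable_add[of f UNIV "\<lambda>x. - g x"] by simp
qed
lift_definition scaleR_ell2 :: "real \<Rightarrow> ('a, 'b) ell2 \<Rightarrow> ('a, 'b) ell2" is "\<lambda>r f x. r *\<^sub>R f x"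
  by (simp add: power_mult_distrib summable_on_cmult_right)
lift_definition scaleC_ell2 :: "complex \<Rightarrow> ('a, 'b) ell2 \<Rightarrow> ('a, 'b) ell2" is "\<lambda>r f x. r *\<^sub>C f x"
  by (simp add: norm_scaleC power_mult_distrib summable_on_cmult_right)
lift_definition cinner_ell2 :: "('a, 'b) ell2 \<Rightarrow> ('a, 'b) ell2 \<Rightarrow> complex"
  is "\<lambda>f g. \<Sum>\<^sub>\<infinity>x. cinner (f x) (g x)" .

definition inner_ell2 :: "('a, 'b) ell2 \<Rightarrow> ('a, 'b) ell2 \<Rightarrow> real"
  where "inner_ell2 f g = Re (cinner f g)"
definition norm_ell2 :: "('a, 'b) ell2 \<Rightarrow> real"
  where "norm_ell2 f = sqrt (inner f f)"
definition sgn_ell2 :: "('a, 'b) ell2 \<Rightarrow> ('a, 'b) ell2"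
  where "sgn_ell2 f = scaleR (inverse (sqrt (inner f f))) f"
definition dist_ell2 :: "('a, 'b) ell2 \<Rightarrow> ('a, 'b) ell2 \<Rightarrow> real"
  where "dist_ell2 f g = norm (f - g)"
definition uniformity_ell2 :: "(('a, 'b) ell2 \<times> ('a, 'b) ell2) filter"
  where "uniformity_ell2 = (INF e\<in>{0<..}. principal {(x, y). dist x (y :: ('a, 'b) ell2) < e})"
definition open_ell2 :: "('a, 'b) ell2 set \<Rightarrow> bool"
  where "open_ell2 U = (\<forall>x\<in>U. eventually (\<lambda>(x', y). x' = x \<longrightarrow> y \<in> U) uniformity)"

lemma ell2_cinner_self: "cinner f f = complex_of_real (\<Sum>\<^sub>\<infinity>x. (norm (ell2_fun f x))\<^sup>2)"
  for f :: "('a, 'b) ell2"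
  by transfer (simp add: cinner_self has_sum_of_real infsumI del: of_real_power)

instance
proof
  fix a b :: complex and r s :: real and x y z :: "('a, 'b) ell2"
  show "x + y + z = x + (y + z)" by transfer (simp add: add.assoc)
  show "x + y = y + x" by transfer (simp add: add.commute)
  show "0 + x = x" by transfer simp
  show "- x + x = 0" by transfer simp
  show "x - y = x + - y" by transfer simp
  show "r *\<^sub>R (x + y) = r *\<^sub>R x + r *\<^sub>R y" by transfer (simp add: scaleR_add_right)
  show "(r + s) *\<^sub>R x = r *\<^sub>R x + s *\<^sub>R x" by transfer (simp add: scaleR_add_left)
  show "r *\<^sub>R s *\<^sub>R x = (r * s) *\<^sub>R x" by transfer simp
  show "1 *\<^sub>R x = x" by transfer simp
  show "sgn x = scaleR (inverse (norm x)) x" by (simp add: sgn_ell2_def norm_ell2_def)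
  show "dist x y = norm (x - y)" by (simp add: dist_ell2_def)
  show "uniformity = (INF e\<in>{0<..}. principal {(x, y). dist x (y :: ('a, 'b) ell2) < e})"
    by (simp add: uniformity_ell2_def)
  show "open U = (\<forall>x\<in>U. eventually (\<lambda>(x', y). x' = x \<longrightarrow> y \<in> U) uniformity)"
    for U :: "('a, 'b) ell2 set" by (simp add: open_ell2_def)
  show C: "cinner x y = cnj (cinner y x)" for x y :: "('a, 'b) ell2"
    by transfer (simp only: infsum_cnj[symmetric] cinner_commute[symmetric])
  show A: "cinner (x + y) z = cinner x z + cinner y z"
    by transfer (simp add: cinner_add_left infsum_add cinner_summable)
  show S: "cinner (a *\<^sub>C x) y = a * cinner x y" for a x
    by transfer (simp add: cinner_scaleC_left infsum_cmult_right')
  show R: "complex_of_real r *\<^sub>C x = r *\<^sub>R x"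
    by transfer (simp add: scaleC_of_real)
  show "a *\<^sub>C (x + y) = a *\<^sub>C x + a *\<^sub>C y" by transfer (simp add: scaleC_add_right)
  show "(a + b) *\<^sub>C x = a *\<^sub>C x + b *\<^sub>C x" by transfer (simp add: scaleC_add_left)
  show "a *\<^sub>C b *\<^sub>C x = (a * b) *\<^sub>C x" by transfer (simp add: scaleC_scaleC)
  show "inner x y = Re (cinner x y)" by (simp add: inner_ell2_def)
  show "inner x y = inner y x" using C[of x y] by (simp add: inner_ell2_def)
  show "inner (x + y) z = inner x z + inner y z" by (simp add: inner_ell2_def A)
  show "inner (r *\<^sub>R x) y = r * inner x y"
    by (simp add: inner_ell2_def R[symmetric] S)
  show "0 \<le> inner x x"
    by (simp add: inner_ell2_def ell2_cinner_self infsum_nonneg)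
  show "inner x x = 0 \<longleftrightarrow> x = 0"
  proof
    assume "inner x x = 0"
    then have *: "(\<Sum>\<^sub>\<infinity>i. (norm (ell2_fun x i))\<^sup>2) = 0"
      by (simp add: inner_ell2_def ell2_cinner_self)
    have "(norm (ell2_fun x i))\<^sup>2 = 0" for i
      using nonneg_infsum_le_0D[of "\<lambda>i. (norm (ell2_fun x i))\<^sup>2" UNIV i] * ell2_fun[of x] by simp
    then show "x = 0" by transfer auto
  qed (simp add: inner_ell2_def ell2_cinner_self zero_ell2.rep_eq)
  show "norm x = sqrt (inner x x)" by (simp add: norm_ell2_def)
qed

end

lemma ell2_norm_power2: "(norm f)\<^sup>2 = (\<Sum>\<^sub>\<infinity>x. (norm (ell2_fun f x))\<^sup>2)"
  by (simp add: power2_norm_eq_inner inner_eq_Re_cinner ell2_cinner_self)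

lemma ell2_sum_le: "finite F \<Longrightarrow> (\<Sum>x\<in>F. (norm (ell2_fun f x))\<^sup>2) \<le> (norm f)\<^sup>2"
  unfolding ell2_norm_power2 using ell2_fun[of f] by (intro finite_sum_le_infsum) auto

lemma ell2_fun_bound: "norm (ell2_fun f x) \<le> norm f"
  using ell2_sum_le[of "{x}" f] by (simp add: power2_le_iff_abs_le)

instance ell2 :: (type, chilbert_space) chilbert_space
proof
  fix X :: "nat \<Rightarrow> ('a, 'b) ell2"
  assume X: "Cauchy X"
  have "Cauchy (\<lambda>n. ell2_fun (X n) x)" for x
  proof (rule CauchyI)
    fix e :: real assume "e > 0"
    then obtain M where "\<forall>m\<ge>M. \<forall>n\<ge>M. norm (X m - X n) < e" using CauchyD[OF X] by blast
    moreover have "norm (ell2_fun (X m) x - ell2_fun (X n) x) \<le> norm (X m - X n)" for m n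
      using ell2_fun_bound[of "X m - X n" x] by (simp add: minus_ell2.rep_eq)
    ultimately show "\<exists>M. \<forall>m\<ge>M. \<forall>n\<ge>M. norm (ell2_fun (X m) x - ell2_fun (X n) x) < e"
      by (meson le_less_trans)
  qed
  then have "\<exists>l. (\<lambda>n. ell2_fun (X n) x) \<longlonglongrightarrow> l" for x
    using Cauchy_convergent convergent_def by blast
  then obtain f where f: "\<And>x. (\<lambda>n. ell2_fun (X n) x) \<longlonglongrightarrow> f x" by metis
  have bound: "(\<Sum>x\<in>F. (norm (ell2_fun (X n) x - f x))\<^sup>2) \<le> e\<^sup>2"
    if "finite F" "\<forall>m\<ge>M. \<forall>n\<ge>M. norm (X m - X n) < e" "n \<ge> M" for F e M n
  proof (rule tendsto_upperbound)
    show "(\<lambda>m. \<Sum>x\<in>F. (norm (ell2_fun (X n) x - ell2_fun (X m) x))\<^sup>2)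
        \<longlonglongrightarrow> (\<Sum>x\<in>F. (norm (ell2_fun (X n) x - f x))\<^sup>2)"
      by (intro tendsto_intros f)
    show "\<forall>\<^sub>F m in sequentially. (\<Sum>x\<in>F. (norm (ell2_fun (X n) x - ell2_fun (X m) x))\<^sup>2) \<le> e\<^sup>2"
    proof (rule eventually_sequentiallyI[of M])
      fix m assume "m \<ge> M"
      have "(\<Sum>x\<in>F. (norm (ell2_fun (X n) x - ell2_fun (X m) x))\<^sup>2) \<le> (norm (X n - X m))\<^sup>2"
        using ell2_sum_le[OF that(1), of "X n - X m"] by (simp add: minus_ell2.rep_eq)
      also have "\<dots> \<le> e\<^sup>2" using that \<open>m \<ge> M\<close> by (intro power_mono) (auto intro: less_imp_le)
      finally show "(\<Sum>x\<in>F. (norm (ell2_fun (X n) x - ell2_fun (X m) x))\<^sup>2) \<le> e\<^sup>2" .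
    qed
  qed auto
  have diff: "(\<lambda>x. (norm (ell2_fun (X n) x - f x))\<^sup>2) summable_on UNIV"
    if "\<forall>m\<ge>M. \<forall>n\<ge>M. norm (X m - X n) < e" "n \<ge> M" for e M n
    by (rule nonneg_bdd_above_summable_on)
      (use bound[OF _ that] in \<open>auto simp: bdd_above_def\<close>)
  obtain M1 where M1: "\<forall>m\<ge>M1. \<forall>n\<ge>M1. norm (X m - X n) < 1" using CauchyD[OF X, of 1] by auto
  have "(\<lambda>x. (norm (- (ell2_fun (X M1) x - f x) + ell2_fun (X M1) x))\<^sup>2) summable_on UNIV"
    by (rule square_summable_add)
      (use diff[OF M1 order_refl] ell2_fun[of "X M1"] in \<open>auto simp: norm_minus_commute\<close>)
  then have f_in: "f \<in> {f. (\<lambda>x. (norm (f x))\<^sup>2) summable_on UNIV}" by simp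
  define L where "L = Abs_ell2 f"
  have L: "ell2_fun L = f" unfolding L_def using f_in by (rule Abs_ell2_inverse)
  have "X \<longlonglongrightarrow> L"
  proof (rule LIMSEQ_I)
    fix r :: real assume "r > 0"
    then obtain M where M: "\<forall>m\<ge>M. \<forall>n\<ge>M. norm (X m - X n) < r / 2"
      using CauchyD[OF X, of "r/2"] by auto
    have "norm (X n - L) < r" if "n \<ge> M" for n
    proof -
      have "(norm (X n - L))\<^sup>2 \<le> (r / 2)\<^sup>2"
        unfolding ell2_norm_power2 minus_ell2.rep_eq L
        by (rule infsum_le_finite_sums[OF diff[OF M that]]) (use bound[OF _ M that] in auto)
      then have "norm (X n - L) \<le> r / 2"
        using \<open>r > 0\<close> by (simp add: power2_le_iff_abs_le)
      then show ?thesis using \<open>r > 0\<close> by simp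
    qed
    then show "\<exists>M. \<forall>n\<ge>M. norm (X n - L) < r" by blast
  qed
  then show "convergent X" by (auto simp: convergent_def)
qed


section \<open>The space \<open>L\<^sup>2(\<T>)\<close>\<close>

text \<open>Normalised arc length on the unit circle, as a Borel measure on the complex plane.\<close>

definition circle_measure :: "complex measure"
  where "circle_measure = distr (uniform_measure lborel {0..1::real}) borel (\<lambda>t. cis (2 * pi * t))"

lemma sets_circle_measure [measurable_cong, simp]: "sets circle_measure = sets borel"
  and space_circle_measure [simp]: "space circle_measure = UNIV"
  by (simp_all add: circle_measure_def)

lemma cis_measurable [measurable]: "(\<lambda>t. cis (2 * pi * t)) \<in> borel_measurable borel"
  by (intro borel_measurable_continuous_onI continuous_intros)

interpretation circle: prob_space circle_measure
  unfolding circle_measure_def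
  by (intro prob_space.prob_space_distr prob_space_uniform_measure) auto

lemma AE_circle_norm: "AE z in circle_measure. cmod z = 1"
  unfolding circle_measure_def by (subst AE_distr_iff) auto

definition square_integrable :: "(complex \<Rightarrow> complex) \<Rightarrow> bool"
  where "square_integrable f \<longleftrightarrow> f \<in> borel_measurable circle_measure \<and>
    integrable circle_measure (\<lambda>z. (cmod (f z))\<^sup>2)"

lemma square_integrable_measurable: "square_integrable f \<Longrightarrow> f \<in> borel_measurable circle_measure"
  by (simp add: square_integrable_def)

lemma square_integrable_prod:
  assumes "square_integrable f" "square_integrable g"
  shows "integrable circle_measure (\<lambda>z. f z * cnj (g z))"
proof (rule Bochner_Integration.integrable_bound)
  show "integrable circle_measure (\<lambda>z. (cmod (f z))\<^sup>2 + (cmod (g z))\<^sup>2)"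
    using assms by (simp add: square_integrable_def)
  show "(\<lambda>z. f z * cnj (g z)) \<in> borel_measurable circle_measure"
    using assms[THEN square_integrable_measurable] by (auto intro!: borel_measurable_times
        borel_measurable_continuous_on[of cnj] continuous_intros)
  have "cmod (f z) * cmod (g z) \<le> (cmod (f z))\<^sup>2 + (cmod (g z))\<^sup>2" for z
  proof -
    have "0 \<le> cmod (f z) * cmod (g z)" by simp
    then show ?thesis using sum_squares_bound[of "cmod (f z)" "cmod (g z)"] by linarith
  qed
  then show "AE z in circle_measure. norm (f z * cnj (g z)) \<le> norm ((cmod (f z))\<^sup>2 + (cmod (g z))\<^sup>2)"
    by (simp add: norm_mult)
qed

lemma square_integrable_add:
  assumes "square_integrable f" "square_integrable g"
  shows "square_integrable (\<lambda>z. f z + g z)"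
  unfolding square_integrable_def
proof
  show m: "(\<lambda>z. f z + g z) \<in> borel_measurable circle_measure"
    using assms[THEN square_integrable_measurable] by simp
  show "integrable circle_measure (\<lambda>z. (cmod (f z + g z))\<^sup>2)"
  proof (rule Bochner_Integration.integrable_bound)
    show "integrable circle_measure (\<lambda>z. 2 * ((cmod (f z))\<^sup>2 + (cmod (g z))\<^sup>2))"
      using assms by (simp add: square_integrable_def)
    show "(\<lambda>z. (cmod (f z + g z))\<^sup>2) \<in> borel_measurable circle_measure"
      using m by measurable
    have "(cmod (f z + g z))\<^sup>2 \<le> 2 * ((cmod (f z))\<^sup>2 + (cmod (g z))\<^sup>2)" for z
    proof -
      have "(cmod (f z + g z))\<^sup>2 \<le> (cmod (f z) + cmod (g z))\<^sup>2"
        by (intro power_mono norm_triangle_ineq) auto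
      also have "\<dots> \<le> 2 * ((cmod (f z))\<^sup>2 + (cmod (g z))\<^sup>2)"
        using sum_squares_bound[of "cmod (f z)" "cmod (g z)"] by (simp add: power2_sum)
      finally show ?thesis .
    qed
    then show "AE z in circle_measure. norm ((cmod (f z + g z))\<^sup>2)
        \<le> norm (2 * ((cmod (f z))\<^sup>2 + (cmod (g z))\<^sup>2))"
      by simp
  qed
qed

lemma square_integrable_mult_bounded:
  assumes "square_integrable f" "h \<in> borel_measurable borel" "AE z in circle_measure. cmod (h z) \<le> C"
  shows "square_integrable (\<lambda>z. h z * f z)"
  unfolding square_integrable_def
proof
  have h: "h \<in> borel_measurable circle_measure" using assms(2) by simp
  show m: "(\<lambda>z. h z * f z) \<in> borel_measurable circle_measure"
    using h assms(1)[THEN square_integrable_measurable] by simp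
  show "integrable circle_measure (\<lambda>z. (cmod (h z * f z))\<^sup>2)"
  proof (rule Bochner_Integration.integrable_bound)
    show "integrable circle_measure (\<lambda>z. C\<^sup>2 * (cmod (f z))\<^sup>2)"
      using assms by (simp add: square_integrable_def)
    show "(\<lambda>z. (cmod (h z * f z))\<^sup>2) \<in> borel_measurable circle_measure" using m by measurable
    show "AE z in circle_measure. norm ((cmod (h z * f z))\<^sup>2) \<le> norm (C\<^sup>2 * (cmod (f z))\<^sup>2)"
      using assms(3) by eventually_elim
        (auto simp: norm_mult power_mult_distrib intro!: mult_right_mono power_mono)
  qed
qed

lemma square_integrable_cmult: "square_integrable f \<Longrightarrow> square_integrable (\<lambda>z. c * f z)"
  by (rule square_integrable_mult_bounded[where C = "cmod c"]) auto

definition l2_rel :: "(complex \<Rightarrow> complex) \<Rightarrow> (complex \<Rightarrow> complex) \<Rightarrow> bool"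
  where "l2_rel f g \<longleftrightarrow> square_integrable f \<and> square_integrable g \<and>
    (AE z in circle_measure. f z = g z)"

lemma l2_relI: "square_integrable f \<Longrightarrow> l2_rel f f"
  by (simp add: l2_rel_def)

quotient_type l2_circle = "complex \<Rightarrow> complex" / partial: l2_rel
proof (rule part_equivpI)
  show "\<exists>f. l2_rel f f"
    by (rule exI[of _ "\<lambda>_. 0"]) (simp add: l2_rel_def square_integrable_def)
  show "symp l2_rel" by (auto simp: symp_def l2_rel_def)
  show "transp l2_rel" by (auto simp: transp_def l2_rel_def)
qed

lemma l2_rel_integral:
  assumes "l2_rel f f'" "l2_rel g g'"
  shows "(LINT z|circle_measure. f z * cnj (g z)) = (LINT z|circle_measure. f' z * cnj (g' z))"
proof (rule integral_cong_AE)
  show "(\<lambda>z. f z * cnj (g z)) \<in> borel_measurable circle_measure"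
    "(\<lambda>z. f' z * cnj (g' z)) \<in> borel_measurable circle_measure"
    using assms square_integrable_prod borel_measurable_integrable unfolding l2_rel_def by blast+
  have "AE z in circle_measure. f z = f' z" "AE z in circle_measure. g z = g' z"
    using assms by (auto simp: l2_rel_def)
  then show "AE z in circle_measure. f z * cnj (g z) = f' z * cnj (g' z)"
    by eventually_elim simp
qed

instantiation l2_circle :: complex_inner
begin

lift_definition zero_l2_circle :: l2_circle is "\<lambda>_. 0"
  by (simp add: l2_rel_def square_integrable_def)
lift_definition plus_l2_circle :: "l2_circle \<Rightarrow> l2_circle \<Rightarrow> l2_circle" is "\<lambda>f g z. f z + g z"
  by (auto simp: l2_rel_def intro: square_integrable_add)
lift_definition uminus_l2_circle :: "l2_circle \<Rightarrow> l2_circle" is "\<lambda>f z. - f z"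
  using square_integrable_cmult[of _ "-1"] by (auto simp: l2_rel_def)
lift_definition minus_l2_circle :: "l2_circle \<Rightarrow> l2_circle \<Rightarrow> l2_circle" is "\<lambda>f g z. f z - g z"
  using square_integrable_add[OF _ square_integrable_cmult[of _ "-1"]] by (auto simp: l2_rel_def)
lift_definition scaleC_l2_circle :: "complex \<Rightarrow> l2_circle \<Rightarrow> l2_circle" is "\<lambda>c f z. c * f z"
  by (auto simp: l2_rel_def intro: square_integrable_cmult)
lift_definition scaleR_l2_circle :: "real \<Rightarrow> l2_circle \<Rightarrow> l2_circle" is "\<lambda>r f z. complex_of_real r * f z"
  by (auto simp: l2_rel_def intro: square_integrable_cmult)
lift_definition cinner_l2_circle :: "l2_circle \<Rightarrow> l2_circle \<Rightarrow> complex"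
  is "\<lambda>f g. LINT z|circle_measure. f z * cnj (g z)"
  by (rule l2_rel_integral)

definition inner_l2_circle :: "l2_circle \<Rightarrow> l2_circle \<Rightarrow> real"
  where "inner_l2_circle f g = Re (cinner f g)"
definition norm_l2_circle :: "l2_circle \<Rightarrow> real"
  where "norm_l2_circle f = sqrt (inner f f)"
definition sgn_l2_circle :: "l2_circle \<Rightarrow> l2_circle"
  where "sgn_l2_circle f = scaleR (inverse (sqrt (inner f f))) f"
definition dist_l2_circle :: "l2_circle \<Rightarrow> l2_circle \<Rightarrow> real"
  where "dist_l2_circle f g = norm (f - g)"
definition uniformity_l2_circle :: "(l2_circle \<times> l2_circle) filter"
  where "uniformity_l2_circle = (INF e\<in>{0<..}. principal {(x, y). dist x (y :: l2_circle) < e})"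
definition open_l2_circle :: "l2_circle set \<Rightarrow> bool"
  where "open_l2_circle U = (\<forall>x\<in>U. eventually (\<lambda>(x', y). x' = x \<longrightarrow> y \<in> U) uniformity)"

instance
proof
  fix a b :: complex and r s :: real and x y z :: l2_circle
  have neg: "square_integrable f \<Longrightarrow> square_integrable (\<lambda>z. - f z)" for f
    using square_integrable_cmult[of f "-1"] by simp
  have sub: "square_integrable f \<Longrightarrow> square_integrable g \<Longrightarrow> square_integrable (\<lambda>z. f z - g z)" for f g
    using square_integrable_add[OF _ neg] by simp
  have zero: "square_integrable (\<lambda>_. 0)" by (simp add: square_integrable_def)
  note sq = l2_rel_def square_integrable_add square_integrable_cmult neg sub zero
  show "x + y + z = x + (y + z)" by transfer (simp add: sq add.assoc)
  show "x + y = y + x" by transfer (simp add: sq add.commute)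
  show "0 + x = x" by transfer (simp add: sq)
  show "- x + x = 0" by transfer (simp add: sq)
  show "x - y = x + - y" by transfer (simp add: sq)
  show "r *\<^sub>R (x + y) = r *\<^sub>R x + r *\<^sub>R y" by transfer (simp add: sq distrib_left)
  show "(r + s) *\<^sub>R x = r *\<^sub>R x + s *\<^sub>R x" by transfer (simp add: sq distrib_right)
  show "r *\<^sub>R s *\<^sub>R x = (r * s) *\<^sub>R x" by transfer (simp add: sq mult.assoc)
  show "1 *\<^sub>R x = x" by transfer (simp add: sq)
  show "sgn x = scaleR (inverse (norm x)) x" by (simp add: sgn_l2_circle_def norm_l2_circle_def)
  show "dist x y = norm (x - y)" by (simp add: dist_l2_circle_def)
  show "uniformity = (INF e\<in>{0<..}. principal {(x, y). dist x (y :: l2_circle) < e})"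
    by (simp add: uniformity_l2_circle_def)
  show "open U = (\<forall>x\<in>U. eventually (\<lambda>(x', y). x' = x \<longrightarrow> y \<in> U) uniformity)"
    for U :: "l2_circle set" by (simp add: open_l2_circle_def)
  show C: "cinner x y = cnj (cinner y x)" for x y :: l2_circle
    by transfer (simp only: Bochner_Integration.integral_cnj[symmetric] complex_cnj_mult complex_cnj_cnj mult.commute)
  show A: "cinner (x + y) z = cinner x z + cinner y z"
    by transfer (simp add: l2_rel_def distrib_right square_integrable_prod)
  show S: "cinner (a *\<^sub>C x) y = a * cinner x y" for a x
    by transfer (simp add: mult.assoc)
  show R: "complex_of_real r *\<^sub>C x = r *\<^sub>R x" by transfer (simp add: sq)
  show "a *\<^sub>C (x + y) = a *\<^sub>C x + a *\<^sub>C y" by transfer (simp add: sq distrib_left)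
  show "(a + b) *\<^sub>C x = a *\<^sub>C x + b *\<^sub>C x"
    by transfer (simp add: sq distrib_right)
  show "a *\<^sub>C b *\<^sub>C x = (a * b) *\<^sub>C x" by transfer (simp add: sq mult.assoc)
  show "inner x y = Re (cinner x y)" by (simp add: inner_l2_circle_def)
  show "inner x y = inner y x" using C[of x y] by (simp add: inner_l2_circle_def)
  show "inner (x + y) z = inner x z + inner y z" by (simp add: inner_l2_circle_def A)
  show "inner (r *\<^sub>R x) y = r * inner x y"
    by (simp add: inner_l2_circle_def R[symmetric] S)
  have self: "(LINT z|circle_measure. f z * cnj (f z)) =
      complex_of_real (LINT z|circle_measure. (cmod (f z))\<^sup>2)" for f
    by (simp add: complex_norm_square[symmetric] del: of_real_power)
  show "0 \<le> inner x x"
    unfolding inner_l2_circle_def by transfer (simp add: self)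
  show "inner x x = 0 \<longleftrightarrow> x = 0"
    unfolding inner_l2_circle_def
  proof (transfer, unfold self)
    fix f assume f: "l2_rel f f"
    have "(LINT z|circle_measure. (cmod (f z))\<^sup>2) = 0 \<longleftrightarrow> (AE z in circle_measure. (cmod (f z))\<^sup>2 = 0)"
      using f by (intro integral_nonneg_eq_0_iff_AE) (auto simp: l2_rel_def square_integrable_def)
    then show "Re (complex_of_real (LINT z|circle_measure. (cmod (f z))\<^sup>2)) = 0 \<longleftrightarrow> l2_rel f (\<lambda>_. 0)"
      using f by (simp add: l2_rel_def) (simp add: square_integrable_def)
  qed
  show "norm x = sqrt (inner x x)" by (simp add: norm_l2_circle_def)
qed

end

lemma l2_circle_norm_power2:
  assumes "square_integrable f"
  shows "(norm (abs_l2_circle f))\<^sup>2 = (LINT z|circle_measure. (cmod (f z))\<^sup>2)"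
proof -
  have "complex_of_real ((norm (abs_l2_circle f))\<^sup>2) = (LINT z|circle_measure. f z * cnj (f z))"
    unfolding cinner_self[symmetric]
    by (rule cinner_l2_circle.abs_eq) (use assms in \<open>simp_all add: l2_rel_def\<close>)
  also have "\<dots> = complex_of_real (LINT z|circle_measure. (cmod (f z))\<^sup>2)"
    by (simp add: complex_norm_square[symmetric] del: of_real_power)
  finally show ?thesis by (simp only: of_real_eq_iff)
qed

text \<open>Riesz--Fischer\<close>

instance l2_circle :: chilbert_space
proof
  fix X :: "nat \<Rightarrow> l2_circle"
  assume X: "Cauchy X"
  define f where "f n = rep_l2_circle (X n)" for n
  have f: "square_integrable (f n)" and abs_f: "abs_l2_circle (f n) = X n" for n
    using Quotient3_rep_reflp[OF Quotient3_l2_circle, of "X n"]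
      Quotient3_abs_rep[OF Quotient3_l2_circle, of "X n"]
    by (auto simp: f_def l2_rel_def)
  have fm [measurable]: "f n \<in> borel_measurable circle_measure" for n
    using f by (rule square_integrable_measurable)
  have diff_sq: "square_integrable (\<lambda>z. f m z - f n z)" for m n
    using square_integrable_add[OF f square_integrable_cmult[OF f, of "-1"]] by simp
  have diff_abs: "abs_l2_circle (\<lambda>z. f m z - f n z) = X m - X n" for m n
    using minus_l2_circle.abs_eq[of "f m" "f n"] f by (simp add: abs_f l2_rel_def)
  have diff_int: "(LINT z|circle_measure. (cmod (f m z - f n z))\<^sup>2) = (norm (X m - X n))\<^sup>2" for m n
    using l2_circle_norm_power2[OF diff_sq, of m n] by (simp add: diff_abs)
  have diff_nn: "(\<integral>\<^sup>+z. ennreal ((cmod (f m z - f n z))\<^sup>2) \<partial>circle_measure) = ennreal ((norm (X m - X n))\<^sup>2)"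
    for m n
    using diff_sq[of m n] by (subst nn_integral_eq_integral) (auto simp: square_integrable_def diff_int)
  have "\<exists>r. strict_mono r \<and> (\<forall>k. norm (X (r (Suc k)) - X (r k)) < (1/2)^k)"
  proof -
    have "\<exists>M. \<forall>m\<ge>M. \<forall>n\<ge>M. norm (X m - X n) < (1/2)^k" for k :: nat
      using CauchyD[OF X, of "(1/2)^k"] by simp
    then obtain M where M: "\<And>k m n. m \<ge> M k \<Longrightarrow> n \<ge> M k \<Longrightarrow> norm (X m - X n) < (1/2)^k" by metis
    define r where "r = rec_nat (M 0) (\<lambda>k p. max (Suc p) (M (Suc k)))"
    have r0: "r 0 = M 0" and rS: "r (Suc k) = max (Suc (r k)) (M (Suc k))" for k
      by (simp_all add: r_def)
    have "M k \<le> r k" for k by (cases k) (auto simp: r0 rS)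
    moreover have "strict_mono r" by (rule strict_monoI_Suc) (simp add: rS)
    moreover from this have "M k \<le> r (Suc k)" for k
      by (meson calculation(1) less_imp_le order_trans strict_mono_Suc_iff)
    ultimately show ?thesis using M by blast
  qed
  then obtain r where r: "strict_mono r" and rd: "\<And>k. norm (X (r (Suc k)) - X (r k)) < (1/2)^k" by blast
  define g where "g k z = cmod (f (r (Suc k)) z - f (r k) z)" for k z
  have gm [measurable]: "g k \<in> borel_measurable circle_measure" for k
    unfolding g_def by measurable
  have g1: "(\<integral>\<^sup>+z. ennreal (g k z) \<partial>circle_measure) \<le> ennreal ((1/2)^k)" for k
  proof -
    have int1: "integrable circle_measure (g k)"
    proof (rule Bochner_Integration.integrable_bound)
      show "integrable circle_measure (\<lambda>z. 1 + (cmod (f (r (Suc k)) z - f (r k) z))\<^sup>2)"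
        using diff_sq by (simp add: square_integrable_def)
      have "t \<le> 1 + t\<^sup>2" for t :: real
        using sum_squares_bound[of t 1] by (smt (z3) one_power2 zero_le_power2 mult_cancel_left1)
      then show "AE z in circle_measure. norm (g k z) \<le> norm (1 + (cmod (f (r (Suc k)) z - f (r k) z))\<^sup>2)"
        by (simp add: g_def)
    qed simp
    have "(circle.expectation (g k))\<^sup>2 \<le> circle.expectation (\<lambda>z. (g k z)\<^sup>2)"
    proof -
      have "0 \<le> circle.variance (g k)" by (rule circle.variance_positive)
      moreover have "integrable circle_measure (\<lambda>z. (g k z)\<^sup>2)"
        using diff_sq[of "r (Suc k)" "r k"] by (simp add: g_def square_integrable_def)
      ultimately show ?thesis using circle.variance_eq[OF int1] by simp
    qed
    also have "\<dots> \<le> ((1/2)^k)\<^sup>2"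
      using rd[of k] by (simp add: g_def diff_int power_mono)
    finally have "circle.expectation (g k) \<le> (1/2)^k"
      by (rule power2_le_imp_le) simp
    then show ?thesis
      using int1 by (subst nn_integral_eq_integral) (auto simp: g_def)
  qed
  have "(\<integral>\<^sup>+z. (\<Sum>k. ennreal (g k z)) \<partial>circle_measure) = (\<Sum>k. \<integral>\<^sup>+z. ennreal (g k z) \<partial>circle_measure)"
    by (rule nn_integral_suminf) simp
  also have "\<dots> \<le> (\<Sum>k. ennreal ((1/2)^k))"
    by (rule suminf_le) (auto intro: g1)
  also have "\<dots> < \<infinity>"
    by (simp add: suminf_ennreal2 summable_geometric)
  finally have "AE z in circle_measure. (\<Sum>k. ennreal (g k z)) \<noteq> \<infinity>"
    by (intro nn_integral_PInf_AE) auto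
  then have conv: "AE z in circle_measure. convergent (\<lambda>k. f (r k) z)"
  proof eventually_elim
    case (elim z)
    then have "summable (\<lambda>k. g k z)"
      by (intro summable_suminf_not_top) (auto simp: g_def top_ennreal_def)
    then have "summable (\<lambda>k. f (r (Suc k)) z - f (r k) z)"
      unfolding g_def by (rule summable_norm_cancel)
    then show ?case
      using sum_lessThan_telescope[of "\<lambda>k. f (r k) z"]
      by (simp add: summable_iff_convergent convergent_diff_const_right_iff)
  qed
  define l where "l z = lim (\<lambda>k. f (r k) z)" for z
  have lm [measurable]: "l \<in> borel_measurable circle_measure"
    unfolding l_def by measurable
  have lim: "AE z in circle_measure. (\<lambda>k. f (r k) z) \<longlonglongrightarrow> l z"
    using conv by eventually_elim (simp add: l_def convergent_LIMSEQ_iff)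
  have bound: "(\<integral>\<^sup>+z. ennreal ((cmod (f n z - l z))\<^sup>2) \<partial>circle_measure) \<le> ennreal (e\<^sup>2)"
    if "\<forall>m\<ge>M. \<forall>n\<ge>M. norm (X m - X n) < e" "n \<ge> M" for e M n
  proof -
    have "(\<integral>\<^sup>+z. ennreal ((cmod (f n z - l z))\<^sup>2) \<partial>circle_measure)
        = (\<integral>\<^sup>+z. liminf (\<lambda>k. ennreal ((cmod (f n z - f (r k) z))\<^sup>2)) \<partial>circle_measure)"
    proof (rule nn_integral_cong_AE)
      show "AE z in circle_measure. ennreal ((cmod (f n z - l z))\<^sup>2)
          = liminf (\<lambda>k. ennreal ((cmod (f n z - f (r k) z))\<^sup>2))"
        using lim
      proof eventually_elim
        case (elim z)
        then have "(\<lambda>k. ennreal ((cmod (f n z - f (r k) z))\<^sup>2)) \<longlonglongrightarrow> ennreal ((cmod (f n z - l z))\<^sup>2)"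
          by (intro tendsto_intros) auto
        then show ?case by (rule lim_imp_Liminf[OF trivial_limit_sequentially, symmetric])
      qed
    qed
    also have "\<dots> \<le> liminf (\<lambda>k. \<integral>\<^sup>+z. ennreal ((cmod (f n z - f (r k) z))\<^sup>2) \<partial>circle_measure)"
      by (rule nn_integral_liminf) simp
    also have "\<dots> \<le> ennreal (e\<^sup>2)"
      unfolding diff_nn
    proof (rule Liminf_le)
      show "\<forall>\<^sub>F k in sequentially. ennreal ((norm (X n - X (r k)))\<^sup>2) \<le> ennreal (e\<^sup>2)"
      proof (rule eventually_sequentiallyI[of M])
        fix k assume "M \<le> k"
        then have "M \<le> r k" using seq_suble[OF r, of k] by simp
        then have "norm (X n - X (r k)) \<le> e" using that less_imp_le by blast
        then show "ennreal ((norm (X n - X (r k)))\<^sup>2) \<le> ennreal (e\<^sup>2)"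
          by (intro ennreal_leI power_mono) auto
      qed
    qed simp
    finally show ?thesis .
  qed
  have dsq: "square_integrable (\<lambda>z. f n z - l z)"
    if "\<forall>m\<ge>M. \<forall>n\<ge>M. norm (X m - X n) < e" "n \<ge> M" for e M n
    unfolding square_integrable_def
    using le_less_trans[OF bound[OF that] ennreal_less_top] by (auto intro!: integrableI_bounded)
  obtain M1 where M1: "\<forall>m\<ge>M1. \<forall>n\<ge>M1. norm (X m - X n) < 1" using CauchyD[OF X, of 1] by auto
  have l: "square_integrable l"
    using square_integrable_add[OF f[of M1] square_integrable_cmult[OF dsq[OF M1 order_refl], of "-1"]]
    by simp
  have "X \<longlonglongrightarrow> abs_l2_circle l"
  proof (rule LIMSEQ_I)
    fix \<epsilon> :: real assume "\<epsilon> > 0"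
    then obtain M where M: "\<forall>m\<ge>M. \<forall>n\<ge>M. norm (X m - X n) < \<epsilon> / 2"
      using CauchyD[OF X, of "\<epsilon>/2"] by auto
    have "norm (X n - abs_l2_circle l) < \<epsilon>" if "n \<ge> M" for n
    proof -
      have "X n - abs_l2_circle l = abs_l2_circle (\<lambda>z. f n z - l z)"
        using minus_l2_circle.abs_eq[of "f n" l] f l by (simp add: abs_f l2_rel_def)
      then have "(norm (X n - abs_l2_circle l))\<^sup>2 = (LINT z|circle_measure. (cmod (f n z - l z))\<^sup>2)"
        using l2_circle_norm_power2[OF dsq[OF M that]] by simp
      also have "\<dots> \<le> (\<epsilon> / 2)\<^sup>2"
        using bound[OF M that] dsq[OF M that]
        by (subst (asm) nn_integral_eq_integral) (auto simp: square_integrable_def)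
      finally have "norm (X n - abs_l2_circle l) \<le> \<epsilon> / 2"
        using \<open>\<epsilon> > 0\<close> by (simp add: power2_le_iff_abs_le)
      then show ?thesis using \<open>\<epsilon> > 0\<close> by simp
    qed
    then show "\<exists>M. \<forall>n\<ge>M. norm (X n - abs_l2_circle l) < \<epsilon>" by blast
  qed
  then show "convergent X" by (auto simp: convergent_def)
qed

lemma mult_z_rel:
  assumes "l2_rel f g"
  shows "l2_rel (\<lambda>z. z * f z) (\<lambda>z. z * g z)"
proof -
  have "square_integrable (\<lambda>z. z * h z)" if "square_integrable h" for h
    by (rule square_integrable_mult_bounded[where C = 1, OF that]) (use AE_circle_norm in auto)
  then show ?thesis using assms by (auto simp: l2_rel_def)
qed

lift_definition mult_z_fun :: "l2_circle \<Rightarrow> l2_circle" is "\<lambda>f z. z * f z"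
  by (rule mult_z_rel)

lemma cinner_mult_z: "cinner (mult_z_fun f) (mult_z_fun g) = cinner f g"
proof transfer
  fix f g assume fg: "l2_rel f f" "l2_rel g g"
  show "(LINT z|circle_measure. z * f z * cnj (z * g z)) = (LINT z|circle_measure. f z * cnj (g z))"
  proof (rule integral_cong_AE)
    show "(\<lambda>z. z * f z * cnj (z * g z)) \<in> borel_measurable circle_measure"
      "(\<lambda>z. f z * cnj (g z)) \<in> borel_measurable circle_measure"
      using fg fg[THEN mult_z_rel] unfolding l2_rel_def
      by (auto intro!: borel_measurable_integrable square_integrable_prod simp del: complex_cnj_mult)
    have key: "z * a * cnj (z * b) = a * cnj b" if "cmod z = 1" for z a b
    proof -
      have "z * a * cnj (z * b) = (z * cnj z) * (a * cnj b)" by (simp add: mult_ac)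
      also have "z * cnj z = 1" using that by (simp add: complex_norm_square[symmetric])
      finally show ?thesis by simp
    qed
    show "AE z in circle_measure. z * f z * cnj (z * g z) = f z * cnj (g z)"
      using AE_circle_norm by eventually_elim (rule key)
  qed
qed

text \<open>The operator \<open>M\<^sub>z\<close> on \<open>L\<^sup>2(\<T>)\<close>.\<close>

lift_definition mult_z :: "l2_circle \<Rightarrow>\<^sub>L l2_circle" is mult_z_fun
proof (rule bounded_linear_intro[where K = 1])
  fix f g :: l2_circle and r :: real
  show "mult_z_fun (f + g) = mult_z_fun f + mult_z_fun g"
    by transfer (use mult_z_rel[OF square_integrable_add[THEN l2_relI]] in \<open>simp add: distrib_left l2_rel_def\<close>)
  show "mult_z_fun (r *\<^sub>R f) = r *\<^sub>R mult_z_fun f"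
  proof transfer
    fix r :: real and f assume f: "l2_rel f f"
    have "(\<lambda>z. z * (complex_of_real r * f z)) = (\<lambda>z. complex_of_real r * (z * f z))"
      by (simp add: mult.left_commute)
    then show "l2_rel (\<lambda>z. z * (complex_of_real r * f z)) (\<lambda>z. complex_of_real r * (z * f z))"
      using mult_z_rel[OF f] by (simp add: l2_rel_def square_integrable_cmult)
  qed
  have "complex_of_real ((norm (mult_z_fun f))\<^sup>2) = complex_of_real ((norm f)\<^sup>2)"
    unfolding cinner_self[symmetric] by (rule cinner_mult_z)
  then have "norm (mult_z_fun f) = norm f"
    by (simp only: of_real_eq_iff) (simp add: power2_eq_iff_nonneg)
  then show "norm (mult_z_fun f) \<le> norm f * 1" by simp
qed


section \<open>Bounded operators\<close>

definition clinear_op :: "('h::chilbert_space \<Rightarrow>\<^sub>L 'k::chilbert_space) \<Rightarrow> bool"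
  where "clinear_op A \<longleftrightarrow> (\<forall>c x. A (c *\<^sub>C x) = c *\<^sub>C A x)"

lift_definition scaleC_op :: "complex \<Rightarrow> ('h::chilbert_space \<Rightarrow>\<^sub>L 'k::chilbert_space) \<Rightarrow> ('h \<Rightarrow>\<^sub>L 'k)"
  is "\<lambda>c A x. c *\<^sub>C A x"
proof -
  fix c and A :: "'h \<Rightarrow> 'k"
  assume A: "bounded_linear A"
  obtain K where K: "\<And>x. norm (A x) \<le> norm x * K" using A bounded_linear.bounded by blast
  show "bounded_linear (\<lambda>x. c *\<^sub>C A x)"
  proof (rule bounded_linear_intro[where K = "cmod c * K"])
    show "c *\<^sub>C A (x + y) = c *\<^sub>C A x + c *\<^sub>C A y" for x y
      by (simp add: linear_add[OF bounded_linear.linear[OF A]] scaleC_add_right)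
    show "c *\<^sub>C A (r *\<^sub>R x) = r *\<^sub>R c *\<^sub>C A x" for r x
      by (simp add: linear_scale[OF bounded_linear.linear[OF A]])
        (simp add: scaleC_scaleC mult.commute flip: scaleC_of_real)
    show "norm (c *\<^sub>C A x) \<le> norm x * (cmod c * K)" for x
      using mult_left_mono[OF K[of x], of "cmod c"] by (simp add: norm_scaleC mult_ac)
  qed
qed

definition adj :: "('h::chilbert_space \<Rightarrow>\<^sub>L 'k::chilbert_space) \<Rightarrow> ('k \<Rightarrow>\<^sub>L 'h)"
  where "adj A = (THE B. \<forall>x y. cinner (A x) y = cinner x (blinfun_apply B y))"

definition unitary_op :: "('h::chilbert_space \<Rightarrow>\<^sub>L 'h) \<Rightarrow> bool"
  where "unitary_op U \<longleftrightarrow> clinear_op U \<and> adj U o\<^sub>L U = id_blinfun \<and> U o\<^sub>L adj U = id_blinfun"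

definition compact_ops :: "('h::chilbert_space \<Rightarrow>\<^sub>L 'h) set"
  where "compact_ops = {A. clinear_op A \<and> compact (closure (A ` cball 0 1))}"

definition operator_algebra_generated :: "('h::chilbert_space \<Rightarrow>\<^sub>L 'h) set \<Rightarrow> ('h \<Rightarrow>\<^sub>L 'h) set"
  where "operator_algebra_generated S = \<Inter>{T. S \<subseteq> T \<and> T \<subseteq> {A. clinear_op A} \<and>
    id_blinfun \<in> T \<and> (\<forall>A\<in>T. \<forall>B\<in>T. A + B \<in> T \<and> A o\<^sub>L B \<in> T) \<and> (\<forall>c. \<forall>A\<in>T. scaleC_op c A \<in> T) \<and>
    closed T}"

definition cstar_generated :: "('h::chilbert_space \<Rightarrow>\<^sub>L 'h) set \<Rightarrow> ('h \<Rightarrow>\<^sub>L 'h) set"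
  where "cstar_generated S = \<Inter>{T. S \<subseteq> T \<and> T \<subseteq> {A. clinear_op A} \<and>
    0 \<in> T \<and> (\<forall>A\<in>T. \<forall>B\<in>T. A + B \<in> T \<and> A o\<^sub>L B \<in> T) \<and> (\<forall>c. \<forall>A\<in>T. scaleC_op c A \<in> T) \<and>
    (\<forall>A\<in>T. adj A \<in> T) \<and> closed T}"


section \<open>Tensor products\<close>

text \<open>The Hilbert space tensor product of \<open>\<ell>\<^sup>2(X)\<close> with \<open>K\<close> is realised as \<open>\<ell>\<^sup>2(X; K)\<close>. Lemmas
  \<open>cinner_tensor_vec\<close> and \<open>tensor_vec_dense\<close> are its defining properties.\<close>

lift_definition tensor_vec :: "('a, complex) ell2 \<Rightarrow> 'b::chilbert_space \<Rightarrow> ('a, 'b) ell2"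
  is "\<lambda>f y x. f x *\<^sub>C y"
  by (simp add: norm_scaleC power_mult_distrib summable_on_cmult_left)

lemma cinner_tensor_vec:
  "cinner (tensor_vec f x) (tensor_vec g y) = cinner f g * cinner x y"
proof -
  have "cinner (a *\<^sub>C x) (b *\<^sub>C y) = cinner a b * cinner x y" for a b
    by (simp add: cinner_scaleC_left cinner_scaleC_right cinner_complex_def)
  then show ?thesis
    by transfer (simp only: infsum_cmult_left')
qed

lift_definition ell2_basis :: "'a \<Rightarrow> ('a, complex) ell2" is "\<lambda>w v. if v = w then 1 else 0"
proof -
  fix w :: 'a
  have "(\<lambda>v. (cmod (if v = w then 1 else 0))\<^sup>2) summable_on {w}" by simp
  then show "(\<lambda>v. (cmod (if v = w then 1 else 0))\<^sup>2) summable_on UNIV"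
    by (rule summable_on_cong_neutral[THEN iffD1, rotated -1]) auto
qed

lemma tensor_vec_dense:
  "closure (span (range (\<lambda>(f, y). tensor_vec f y))) = (UNIV :: ('a, 'b::chilbert_space) ell2 set)"
proof -
  have "g \<in> closure (span (range (\<lambda>(f, y). tensor_vec f y)))" for g :: "('a, 'b) ell2"
    unfolding closure_approachable
  proof (intro allI impI)
    fix e :: real assume "e > 0"
    let ?S = "\<lambda>x. (norm (ell2_fun g x))\<^sup>2"
    have s: "?S summable_on UNIV" using ell2_fun[of g] by simp
    then have "(sum ?S \<longlongrightarrow> infsum ?S UNIV) (finite_subsets_at_top UNIV)"
      using infsum_tendsto by blast
    then have "\<forall>\<^sub>F F in finite_subsets_at_top UNIV. dist (sum ?S F) (infsum ?S UNIV) < e\<^sup>2"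
      by (rule tendstoD) (use \<open>e > 0\<close> in simp)
    then obtain F where F: "finite F" "dist (sum ?S F) (infsum ?S UNIV) < e\<^sup>2"
      by (auto simp: eventually_finite_subsets_at_top)
    define h where "h = (\<Sum>x\<in>F. tensor_vec (ell2_basis x) (ell2_fun g x))"
    have h: "ell2_fun h x = (if x \<in> F then ell2_fun g x else 0)" for x
    proof -
      have "ell2_fun (sum k G) x = (\<Sum>y\<in>G. ell2_fun (k y) x)" if "finite G"
        for k :: "'a \<Rightarrow> ('a, 'b) ell2" and G
        using that by induction (auto simp: zero_ell2.rep_eq plus_ell2.rep_eq)
      then have "ell2_fun h x = (\<Sum>y\<in>F. ell2_fun (tensor_vec (ell2_basis y) (ell2_fun g y)) x)"
        using F by (simp add: h_def)
      also have "\<dots> = (\<Sum>y\<in>F. if x = y then ell2_fun g y else 0)"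
        using scaleC_of_real[of 1] scaleC_of_real[of 0]
        by (intro sum.cong) (auto simp: tensor_vec.rep_eq ell2_basis.rep_eq)
      finally show ?thesis using F by simp
    qed
    have "(norm (g - h))\<^sup>2 = infsum ?S (UNIV - F)"
      unfolding ell2_norm_power2 by (rule infsum_cong_neutral) (auto simp: minus_ell2.rep_eq h)
    also have "\<dots> = infsum ?S UNIV - sum ?S F"
      using s F by (subst infsum_Diff) auto
    also have "\<dots> < e\<^sup>2" using F by (simp add: dist_real_def)
    finally have "norm (g - h) < e" using \<open>e > 0\<close> by (simp add: power_less_imp_less_base)
    moreover have "h \<in> span (range (\<lambda>(f, y). tensor_vec f y))"
      unfolding h_def by (intro span_sum span_base) auto
    ultimately show "\<exists>y\<in>span (range (\<lambda>(f, y). tensor_vec f y)). dist y g < e"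
      by (auto simp: dist_norm norm_minus_commute)
  qed
  then show ?thesis by auto
qed

text \<open>By density of the elementary tensors there is at most one such bounded operator.\<close>

definition op_tensor ::
  "(('a, complex) ell2 \<Rightarrow>\<^sub>L ('a, complex) ell2) \<Rightarrow> ('b \<Rightarrow>\<^sub>L 'b) \<Rightarrow>
    ('a, 'b::chilbert_space) ell2 \<Rightarrow>\<^sub>L ('a, 'b) ell2"
  where "op_tensor A B = (THE R. \<forall>f y. blinfun_apply R (tensor_vec f y) = tensor_vec (A f) (B y))"


section \<open>Star-algebras and C*-algebras with explicit carriers\<close>

record 'a star_alg = "'a ring" +
  scal :: "complex \<Rightarrow> 'a \<Rightarrow> 'a"
  star :: "'a \<Rightarrow> 'a"

record 'a cstar_alg = "'a star_alg" +
  anorm :: "'a \<Rightarrow> real"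

definition op_algebra :: "('h::chilbert_space \<Rightarrow>\<^sub>L 'h) set \<Rightarrow> ('h \<Rightarrow>\<^sub>L 'h) cstar_alg"
  where "op_algebra T = \<lparr>carrier = T, monoid.mult = (o\<^sub>L), one = id_blinfun, ring.zero = 0,
    ring.add = (+), scal = scaleC_op, star = adj, anorm = norm\<rparr>"

text \<open>Quotient by a closed two-sided ideal. The operations on cosets follow \<^const>\<open>rcoset_mult\<close>, and
  the norm of a coset is its distance to \<open>0\<close>.\<close>

definition cstar_quot :: "('a, 'm) cstar_alg_scheme \<Rightarrow> 'a set \<Rightarrow> 'a set cstar_alg"
  where "cstar_quot R J = \<lparr>carrier = carrier (R Quot J), monoid.mult = monoid.mult (R Quot J),
    one = one (R Quot J), ring.zero = ring.zero (R Quot J), ring.add = ring.add (R Quot J),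
    scal = (\<lambda>c X. \<Union>a\<in>X. J +>\<^bsub>R\<^esub> scal R c a), star = (\<lambda>X. \<Union>a\<in>X. J +>\<^bsub>R\<^esub> star R a),
    anorm = (\<lambda>X. INF a\<in>X. anorm R a)\<rparr>"

text \<open>As usual for C*-algebras, ideals are two-sided and norm-closed.\<close>

definition closed_ideal_generated :: "('a, 'm) cstar_alg_scheme \<Rightarrow> 'a set \<Rightarrow> 'a set"
  where "closed_ideal_generated R S = \<Inter>{J. ideal J R \<and> S \<subseteq> J \<and>
    (\<forall>a\<in>carrier R. (\<forall>e>0. \<exists>b\<in>J. anorm R (a \<ominus>\<^bsub>R\<^esub> b) < e) \<longrightarrow> a \<in> J)}"

text \<open>A bijective *-homomorphism between C*-algebras is automatically isometric.\<close>

definition cstar_isomorphic ::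
  "('a, 'm) cstar_alg_scheme \<Rightarrow> ('b, 'k) cstar_alg_scheme \<Rightarrow> bool"
  where "cstar_isomorphic R S \<longleftrightarrow> (\<exists>\<theta>\<in>ring_iso R S. \<forall>a\<in>carrier R.
    (\<forall>c. \<theta> (scal R c a) = scal S c (\<theta> a)) \<and> \<theta> (star R a) = star S (\<theta> a))"


section \<open>Crossed products by the integers\<close>

text \<open>The universal C*-norm of a *-algebra is the largest C*-seminorm. By the GNS construction the
  C*-seminorms are exactly the functions \<open>a \<mapsto> \<parallel>\<pi>(a)\<parallel>\<close> for *-representations \<open>\<pi>\<close>, so this is the
  supremum over all representations, without quantifying over Hilbert spaces.\<close>

definition cstar_seminorm :: "('a, 'm) star_alg_scheme \<Rightarrow> ('a \<Rightarrow> real) \<Rightarrow> bool"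
  where "cstar_seminorm R p \<longleftrightarrow>
    (\<forall>a\<in>carrier R. 0 \<le> p a \<and> p (star R a \<otimes>\<^bsub>R\<^esub> a) = (p a)\<^sup>2 \<and> (\<forall>c. p (scal R c a) = cmod c * p a)) \<and>
    (\<forall>a\<in>carrier R. \<forall>b\<in>carrier R. p (a \<oplus>\<^bsub>R\<^esub> b) \<le> p a + p b \<and> p (a \<otimes>\<^bsub>R\<^esub> b) \<le> p a * p b)"

definition universal_norm :: "('a, 'm) star_alg_scheme \<Rightarrow> 'a \<Rightarrow> real"
  where "universal_norm R a = (SUP p\<in>{p. cstar_seminorm R p}. p a)"

text \<open>Separated completion for a seminorm: Cauchy sequences modulo null sequences.\<close>

definition cauchy_algebra :: "('a, 'm) star_alg_scheme \<Rightarrow> ('a \<Rightarrow> real) \<Rightarrow> (nat \<Rightarrow> 'a) cstar_alg"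
  where "cauchy_algebra R p = \<lparr>
    carrier = {x. (\<forall>i. x i \<in> carrier R) \<and> (\<forall>e>0. \<exists>N. \<forall>i\<ge>N. \<forall>j\<ge>N. p (x i \<ominus>\<^bsub>R\<^esub> x j) < e)},
    monoid.mult = (\<lambda>x y i. x i \<otimes>\<^bsub>R\<^esub> y i), one = (\<lambda>i. \<one>\<^bsub>R\<^esub>), ring.zero = (\<lambda>i. \<zero>\<^bsub>R\<^esub>),
    ring.add = (\<lambda>x y i. x i \<oplus>\<^bsub>R\<^esub> y i), scal = (\<lambda>c x i. scal R c (x i)),
    star = (\<lambda>x i. star R (x i)), anorm = (\<lambda>x. lim (\<lambda>i. p (x i)))\<rparr>"

definition cstar_completion :: "('a, 'm) star_alg_scheme \<Rightarrow> ('a \<Rightarrow> real) \<Rightarrow> (nat \<Rightarrow> 'a) set cstar_alg"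
  where "cstar_completion R p = cstar_quot (cauchy_algebra R p)
    {x \<in> carrier (cauchy_algebra R p). (\<lambda>i. p (x i)) \<longlonglongrightarrow> 0}"

definition int_iterate :: "('a, 'm) star_alg_scheme \<Rightarrow> ('a \<Rightarrow> 'a) \<Rightarrow> int \<Rightarrow> 'a \<Rightarrow> 'a"
  where "int_iterate R \<alpha> k =
    (if 0 \<le> k then \<alpha> ^^ nat k else inv_into (carrier R) \<alpha> ^^ nat (- k))"

text \<open>A finitely supported \<open>f\<close> stands for the formal sum \<open>\<Sum>\<^sub>k u\<^sup>k f(k)\<close>. The product and the
  adjoint below are forced by \<open>a u = u \<alpha>(a)\<close> and unitarity of \<open>u\<close>: the product of
  \<open>u\<^sup>j a\<close> and \<open>u\<^sup>k b\<close> is \<open>u\<^sup>j\<^sup>+\<^sup>k \<alpha>\<^sup>k(a) b\<close>, and the adjoint of \<open>u\<^sup>-\<^sup>k a\<close> is \<open>u\<^sup>k \<alpha>\<^sup>k(star a)\<close>.\<close>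

definition algebraic_crossed_product ::
  "('a, 'm) star_alg_scheme \<Rightarrow> ('a \<Rightarrow> 'a) \<Rightarrow> (int \<Rightarrow> 'a) star_alg"
  where "algebraic_crossed_product R \<alpha> = \<lparr>
    carrier = {f. (\<forall>k. f k \<in> carrier R) \<and> finite {k. f k \<noteq> \<zero>\<^bsub>R\<^esub>}},
    monoid.mult = (\<lambda>f g m. \<Oplus>\<^bsub>R\<^esub>k\<in>{k. g k \<noteq> \<zero>\<^bsub>R\<^esub>}. int_iterate R \<alpha> k (f (m - k)) \<otimes>\<^bsub>R\<^esub> g k),
    one = (\<lambda>k. if k = 0 then \<one>\<^bsub>R\<^esub> else \<zero>\<^bsub>R\<^esub>), ring.zero = (\<lambda>k. \<zero>\<^bsub>R\<^esub>),
    ring.add = (\<lambda>f g k. f k \<oplus>\<^bsub>R\<^esub> g k), scal = (\<lambda>c f k. scal R c (f k)),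
    star = (\<lambda>f k. int_iterate R \<alpha> k (star R (f (- k))))\<rparr>"

definition crossed_product ::
  "('a, 'm) cstar_alg_scheme \<Rightarrow> ('a \<Rightarrow> 'a) \<Rightarrow> (nat \<Rightarrow> int \<Rightarrow> 'a) set cstar_alg"
  where "crossed_product R \<alpha> = cstar_completion (algebraic_crossed_product R \<alpha>)
    (universal_norm (algebraic_crossed_product R \<alpha>))"


section \<open>The noncommutative disc algebra and the Cuntz algebra\<close>

text \<open>The free semigroup on a finite type \<open>'n\<close> of letters is the type of words \<open>'n list\<close>.\<close>

type_synonym 'n fock = "('n list, complex) ell2"
type_synonym 'n fock_op = "('n list, complex) ell2 \<Rightarrow>\<^sub>L ('n list, complex) ell2"

lemma creation_has_sum:
  fixes f :: "'n list \<Rightarrow> complex"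
  assumes "(\<lambda>w. (cmod (f w))\<^sup>2) summable_on UNIV"
  shows "((\<lambda>w. (cmod (case w of [] \<Rightarrow> 0 | j # v \<Rightarrow> if j = i then f v else 0))\<^sup>2)
    has_sum (\<Sum>\<^sub>\<infinity>w. (cmod (f w))\<^sup>2)) UNIV" (is "(?g has_sum _) _")
proof -
  have "((\<lambda>w. (cmod (f w))\<^sup>2) has_sum (\<Sum>\<^sub>\<infinity>w. (cmod (f w))\<^sup>2)) UNIV"
    using assms by (rule has_sum_infsum)
  then have "(?g has_sum (\<Sum>\<^sub>\<infinity>w. (cmod (f w))\<^sup>2)) (range (Cons i))"
    by (subst has_sum_reindex) (auto simp: o_def)
  then show ?thesis
    by (rule has_sum_cong_neutral[THEN iffD1, rotated -1]) (auto split: list.splits)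
qed

lift_definition creation_fun :: "'n \<Rightarrow> 'n fock \<Rightarrow> 'n fock"
  is "\<lambda>i f w. case w of [] \<Rightarrow> 0 | j # v \<Rightarrow> if j = i then f v else 0"
  by (rule has_sum_imp_summable[OF creation_has_sum])

lift_definition creation :: "'n \<Rightarrow> 'n fock_op" is creation_fun
proof (rule bounded_linear_intro[where K = 1])
  fix i :: 'n and f g :: "'n fock" and r :: real
  show "creation_fun i (f + g) = creation_fun i f + creation_fun i g"
    by transfer (auto split: list.split)
  show "creation_fun i (r *\<^sub>R f) = r *\<^sub>R creation_fun i f"
    by transfer (auto split: list.split)
  have "(norm (creation_fun i f))\<^sup>2 = (norm f)\<^sup>2"
    unfolding ell2_norm_power2 creation_fun.rep_eq
    by (rule infsumI, rule creation_has_sum) (use ell2_fun[of f] in simp)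
  then show "norm (creation_fun i f) \<le> norm f * 1" by (simp add: power2_eq_iff_nonneg)
qed

lemma creation_basis: "creation i (ell2_basis w) = ell2_basis (i # w)"
  by (rule ell2_fun_inject[THEN iffD1])
    (auto simp: fun_eq_iff creation.rep_eq creation_fun.rep_eq ell2_basis.rep_eq split: list.split)

definition nc_disc_algebra :: "'n fock_op set"
  where "nc_disc_algebra = operator_algebra_generated (range creation)"

definition cuntz_toeplitz :: "'n fock_op set"
  where "cuntz_toeplitz = cstar_generated (range creation)"

definition cuntz_algebra :: "'n fock_op set cstar_alg"
  where "cuntz_algebra = cstar_quot (op_algebra cuntz_toeplitz) compact_ops"

text \<open>Norm of the operator matrix \<open>(A i j)\<^sub>i\<^sub>,\<^sub>j\<^sub><\<^sub>m\<close> acting on the direct sum of \<open>m\<close> copies of the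
  Hilbert space.\<close>

definition opmatrix_norm :: "nat \<Rightarrow> (nat \<Rightarrow> nat \<Rightarrow> 'h::chilbert_space \<Rightarrow>\<^sub>L 'h) \<Rightarrow> real"
  where "opmatrix_norm m A = (SUP x\<in>{x. (\<Sum>j<m. (norm (x j))\<^sup>2) \<le> 1}.
    sqrt (\<Sum>i<m. (norm (\<Sum>j<m. A i j (x j)))\<^sup>2))"

definition completely_isometric_on ::
  "('h::chilbert_space \<Rightarrow>\<^sub>L 'h) set \<Rightarrow> (('h \<Rightarrow>\<^sub>L 'h) \<Rightarrow> ('h \<Rightarrow>\<^sub>L 'h)) \<Rightarrow> bool"
  where "completely_isometric_on T \<phi> \<longleftrightarrow> (\<forall>m A. (\<forall>i<m. \<forall>j<m. A i j \<in> T) \<longrightarrow>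
    opmatrix_norm m (\<lambda>i j. \<phi> (A i j)) = opmatrix_norm m A)"

definition aut_nc_disc :: "('n fock_op \<Rightarrow> 'n fock_op) set"
  where "aut_nc_disc = {\<phi> \<in> ring_iso (op_algebra nc_disc_algebra) (op_algebra nc_disc_algebra).
    (\<forall>c. \<forall>A\<in>nc_disc_algebra. \<phi> (scaleC_op c A) = scaleC_op c (\<phi> A)) \<and>
    completely_isometric_on nc_disc_algebra \<phi>}"

definition conj_by :: "'n fock_op \<Rightarrow> 'n fock_op \<Rightarrow> 'n fock_op"
  where "conj_by U A = adj U o\<^sub>L A o\<^sub>L U"

definition implements :: "'n fock_op \<Rightarrow> ('n fock_op \<Rightarrow> 'n fock_op) \<Rightarrow> bool"
  where "implements U \<phi> \<longleftrightarrow> unitary_op U \<and> (\<forall>A\<in>nc_disc_algebra. conj_by U A = \<phi> A)"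

text \<open>The automorphism of the Cuntz algebra induced by \<open>conj_by U\<close>, which acts on a coset by
  taking its image.\<close>

definition induced_aut :: "'n fock_op \<Rightarrow> 'n fock_op set \<Rightarrow> 'n fock_op set"
  where "induced_aut U X = conj_by U ` X"

definition ampliation :: "'n fock_op \<Rightarrow> ('n list, l2_circle) ell2 \<Rightarrow>\<^sub>L ('n list, l2_circle) ell2"
  where "ampliation A = op_tensor A id_blinfun"

definition dilation_algebra ::
  "'n fock_op \<Rightarrow> (('n list, l2_circle) ell2 \<Rightarrow>\<^sub>L ('n list, l2_circle) ell2) set"
  where "dilation_algebra U = cstar_generated (ampliation ` cuntz_toeplitz \<union> {op_tensor U mult_z})"

definition dilation_ideal ::
  "'n fock_op \<Rightarrow> (('n list, l2_circle) ell2 \<Rightarrow>\<^sub>L ('n list, l2_circle) ell2) set"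
  where "dilation_ideal U =
    closed_ideal_generated (op_algebra (dilation_algebra U)) (ampliation ` compact_ops)"

end

theory Submission
  imports Defs
begin

text \<open>
  Write \<open>E\<close> for the Cuntz--Toeplitz algebra, \<open>B\<close> for \<open>dilation_algebra U\<close>, \<open>J\<close> for \<open>dilation_ideal U\<close> and
  \<open>W = U \<otimes> M\<^sub>z\<close>. A finitely supported family \<open>a\<close> in \<open>E\<close> is sent to
  \<open>\<Psi>(a) = \<Sum>\<^sub>k W\<^sup>k (a(k) \<otimes> 1)\<close>, a *-homomorphism for the twisted convolution with dense range in \<open>B\<close>, and
  everything reduces to showing that the universal norm of the class of \<open>a\<close> in the algebraic crossed product
  of the Cuntz algebra is the distance from \<open>\<Psi>(a)\<close> to \<open>J\<close>. That distance is a C*-seminorm, whence one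
  inequality. Conversely let \<open>p\<close> be a C*-seminorm. It is at most the norm on the coefficient algebra, because
  a self-adjoint strict contraction is the average of a unitary and its adjoint, so \<open>p(a)\<close> is at most the sum
  of the norms of the coefficients, each of which is at most \<open>\<parallel>\<Psi>(a)\<parallel>\<close>. Applied to high powers of \<open>a\<^sup>*a\<close>,
  whose supports grow only linearly, this gives \<open>p(a) \<le> \<parallel>\<Psi>(a)\<parallel>\<close>. Hence \<open>p\<close> extends to \<open>B\<close>; if it vanishes
  on the compact operators, the kernel of the extension contains \<open>J\<close>, and \<open>p(a)\<close> is at most the distance.
\<close>

text \<open>The universal norm is a supremum over C*-seminorms, not over representations, so every
  estimate has to come from the seminorm axioms and from explicit operators. Two facts usually read
  off from spectral theory are obtained by hand: square roots come from a contraction principle, and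
  the C*-identity of the quotient norm comes from powers of 1 - k^2. The factor M_z makes the
  coefficients visible: U alone may satisfy relations with E, whereas the orthonormal functions z^k
  separate the terms of \<Psi>(a), so that each coefficient is controlled by the norm of the sum.
  The high powers are reached by iterating y -> adj y y, because the C*-identity then makes each
  step an equality for p. The extension of p to B is not built; its kernel is described by
  approximating families. The isomorphism is not defined on generators either: a Cauchy sequence in
  the algebraic crossed product has a unique limit in B modulo J, so the completion is B modulo the
  same relation as the right-hand side.\<close>

section \<open>Adjoints\<close>

text \<open>The representing vector is the minimiser of |x|^2 - 2 g(x): a minimising sequence is
  Cauchy by the parallelogram law, and the first variation at the minimum vanishes.\<close>

lemma riesz_real:
  fixes g :: "'h::{real_inner, complete_space} \<Rightarrow> real"
  assumes "bounded_linear g"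
  obtains y where "\<And>x. g x = inner x y"
proof -
  interpret bounded_linear g by fact
  obtain K where K: "\<And>x. norm (g x) \<le> norm x * K" using bounded by blast
  define Q where "Q x = (norm x)\<^sup>2 - 2 * g x" for x
  have Q_lower: "- K\<^sup>2 \<le> Q x" for x
  proof -
    have "0 \<le> (norm x - K)\<^sup>2" by simp
    then have "0 \<le> (norm x)\<^sup>2 - 2 * (norm x * K) + K\<^sup>2" by (simp add: power2_diff)
    moreover have "g x \<le> norm x * K" using K[of x] by simp
    ultimately show ?thesis unfolding Q_def by linarith
  qed
  define m where "m = (INF x. Q x)"
  have bdd: "bdd_below (range Q)" using Q_lower by (auto simp: bdd_below_def)
  have m_le: "m \<le> Q x" for x unfolding m_def by (rule cINF_lower[OF bdd]) simp
  have "\<exists>x. Q x < m + 1 / real (Suc n)" for n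
    using cINF_less_iff[OF UNIV_not_empty bdd, of "m + 1 / real (Suc n)"] by (auto simp: m_def)
  then obtain X where X: "\<And>n. Q (X n) < m + 1 / real (Suc n)" by metis
  \<comment> \<open>Parallelogram law; the linear part of \<open>Q\<close> cancels at the
    midpoint.\<close>
  have par: "(norm (x - y))\<^sup>2 = 2 * Q x + 2 * Q y - 4 * Q ((1/2) *\<^sub>R (x + y))" for x y
  proof -
    have "(norm (x - y))\<^sup>2 = (norm x)\<^sup>2 + (norm y)\<^sup>2 - 2 * inner x y"
      "(norm (x + y))\<^sup>2 = (norm x)\<^sup>2 + (norm y)\<^sup>2 + 2 * inner x y"
      by (simp_all add: power2_norm_eq_inner algebra_simps inner_commute)
    moreover have "(norm ((1/2) *\<^sub>R (x + y)))\<^sup>2 = (norm (x + y))\<^sup>2 / 4"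
      by (simp add: power_divide)
    moreover have "g ((1/2) *\<^sub>R (x + y)) = (g x + g y) / 2" by (simp add: scaleR add)
    ultimately show ?thesis
      unfolding Q_def by argo
  qed
  have dist: "(norm (X i - X j))\<^sup>2 \<le> 2 / real (Suc i) + 2 / real (Suc j)" for i j
    using par[of "X i" "X j"] X[of i] X[of j] m_le[of "(1/2) *\<^sub>R (X i + X j)"] by simp
  have "Cauchy X"
  proof (rule CauchyI)
    fix e :: real assume "e > 0"
    then obtain N where N: "4 / e\<^sup>2 < real (Suc N)"
      using reals_Archimedean2[of "4 / e\<^sup>2"] by (meson less_trans of_nat_less_iff lessI)
    have "norm (X i - X j) < e" if "i \<ge> N" "j \<ge> N" for i j
    proof -
      have "2 / real (Suc i) \<le> 2 / real (Suc N)" "2 / real (Suc j) \<le> 2 / real (Suc N)"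
        using that by (auto intro!: divide_left_mono)
      then have "(norm (X i - X j))\<^sup>2 \<le> 4 / real (Suc N)" using dist[of i j] by simp
      also have "\<dots> < e\<^sup>2" using N \<open>e > 0\<close> by (simp add: field_simps)
      finally show ?thesis using \<open>e > 0\<close> by (simp add: power_less_imp_less_base)
    qed
    then show "\<exists>M. \<forall>m\<ge>M. \<forall>n\<ge>M. norm (X m - X n) < e" by blast
  qed
  then obtain y where y: "X \<longlonglongrightarrow> y" using Cauchy_convergent convergent_def by blast
  have "(\<lambda>n. Q (X n)) \<longlonglongrightarrow> Q y"
    unfolding Q_def by (intro tendsto_intros y tendsto)
  moreover have "(\<lambda>n. m + 1 / real (Suc n)) \<longlonglongrightarrow> m + 0"
    by (intro tendsto_add tendsto_const LIMSEQ_Suc[OF lim_inverse_n'])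
  ultimately have "Q y \<le> m"
    using X by (intro LIMSEQ_le[of "\<lambda>n. Q (X n)" "Q y"]) (auto intro: less_imp_le)
  then have min: "Q y \<le> Q x" for x using m_le[of x] by linarith
  have "g x = inner x y" for x
  proof (rule ccontr)
    assume ne: "g x \<noteq> inner x y"
    define d where "d = g x - inner x y"
    have "0 \<le> t\<^sup>2 * (norm x)\<^sup>2 - 2 * t * d" for t
    proof -
      have "Q (y + t *\<^sub>R x) = Q y + t\<^sup>2 * (norm x)\<^sup>2 - 2 * t * d"
        unfolding Q_def d_def power2_norm_eq_inner
        by (simp add: inner_commute add scaleR algebra_simps power2_eq_square)
      then show ?thesis using min[of "y + t *\<^sub>R x"] by simp
    qed
    note * = this
    have x0: "x \<noteq> 0" using ne zero by auto
    \<comment> \<open>The value t = d / |x|^2 minimises the quadratic in t.\<close>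
    have "0 \<le> (d / (norm x)\<^sup>2)\<^sup>2 * (norm x)\<^sup>2 - 2 * (d / (norm x)\<^sup>2) * d" by (rule *)
    also have "\<dots> = - (d\<^sup>2 / (norm x)\<^sup>2)" using x0 by (simp add: field_simps power2_eq_square)
    finally have "d\<^sup>2 / (norm x)\<^sup>2 \<le> 0" by simp
    then show False using x0 ne by (simp add: d_def divide_le_0_iff)
  qed
  then show ?thesis by (rule that)
qed

section \<open>Calculus of the complex inner product and existence of adjoints\<close>

lemma cinner_diff_left: "cinner (x - y) z = cinner x z - cinner y z"
  for x y z :: "'a::complex_inner"
  using cinner_add_left[of "x - y" y z] by simp

lemma cinner_diff_right: "cinner z (x - y) = cinner z x - cinner z y"
  for x y z :: "'a::complex_inner"
  using cinner_add_right[of z "x - y" y] by simp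

lemma cinner_zero_left [simp]: "cinner 0 z = 0" for z :: "'a::complex_inner"
  using cinner_diff_left[of 0 0 z] by simp

lemma cinner_zero_right [simp]: "cinner z 0 = 0" for z :: "'a::complex_inner"
  using cinner_diff_right[of z 0 0] by simp

lemma cinner_sum_left: "cinner (\<Sum>i\<in>F. f i) z = (\<Sum>i\<in>F. cinner (f i) z)"
  for z :: "'a::complex_inner"
  by (induction F rule: infinite_finite_induct) (auto simp: cinner_add_left)

lemma cinner_sum_right: "cinner z (\<Sum>i\<in>F. f i) = (\<Sum>i\<in>F. cinner z (f i))"
  for z :: "'a::complex_inner"
  by (induction F rule: infinite_finite_induct) (auto simp: cinner_add_right)

lemma cinner_eqI: "x = y" if "\<And>z. cinner x z = cinner y z" for x y :: "'a::complex_inner"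
proof -
  have "cinner (x - y) (x - y) = 0" using that by (simp add: cinner_diff_left)
  then show ?thesis by (simp add: cinner_self)
qed

lemma cinner_eqI': "x = y" if "\<And>z. cinner z x = cinner z y" for x y :: "'a::complex_inner"
proof (rule cinner_eqI)
  show "cinner x z = cinner y z" for z
    using arg_cong[OF that[of z], of cnj] by (simp only: cinner_commute[symmetric])
qed

lemma scaleC_zero_right [simp]: "c *\<^sub>C (0::'a::complex_inner) = 0"
  using norm_scaleC[of c "0::'a"] by simp

lemma scaleC_zero_left [simp]: "0 *\<^sub>C (x::'a::complex_inner) = 0"
  using norm_scaleC[of 0 x] by simp

lemma scaleC_one [simp]: "1 *\<^sub>C (x::'a::complex_inner) = x"
  using scaleC_of_real[of 1 x] by simp

lemma scaleC_minus1: "(-1) *\<^sub>C (x::'a::complex_inner) = - x"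
  using scaleC_of_real[of "-1" x] by simp

lemma bounded_linear_scaleC_left: "bounded_linear (\<lambda>c. c *\<^sub>C (x::'a::complex_inner))"
  by (rule bounded_linear_intro[where K = "norm x"])
    (auto simp: scaleC_add_left norm_scaleC scaleR_conv_of_real scaleC_scaleC[symmetric] scaleC_of_real)

lemma bounded_linear_scaleC_right: "bounded_linear (\<lambda>x. c *\<^sub>C (x::'a::complex_inner))"
proof (rule bounded_linear_intro[where K = "cmod c"])
  show "c *\<^sub>C r *\<^sub>R x = r *\<^sub>R c *\<^sub>C x" for r and x :: 'a
    by (simp add: scaleC_scaleC mult.commute flip: scaleC_of_real)
qed (auto simp: scaleC_add_right norm_scaleC)

lemma scaleC_diff_right: "c *\<^sub>C (x - y) = c *\<^sub>C x - c *\<^sub>C (y::'a::complex_inner)"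
  by (rule linear_diff[OF bounded_linear.linear[OF bounded_linear_scaleC_right]])

lemma scaleC_minus_right: "c *\<^sub>C (- x) = - (c *\<^sub>C (x::'a::complex_inner))"
  by (rule linear_neg[OF bounded_linear.linear[OF bounded_linear_scaleC_right]])

text \<open>The real theorem gives the real parts; evaluating at \<i> x recovers the imaginary
  parts, since Re (\<i> z) = - Im z.\<close>

lemma riesz:
  fixes f :: "'h::chilbert_space \<Rightarrow> complex"
  assumes "bounded_linear f" and "\<And>c x. f (c *\<^sub>C x) = c * f x"
  obtains y where "\<And>x. f x = cinner x y"
proof -
  obtain y where y: "\<And>x. Re (f x) = inner x y"
    using riesz_real[OF bounded_linear_compose[OF bounded_linear_Re assms(1)]] by blast
  have "f x = cinner x y" for x
  proof (rule complex_eqI)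
    show "Re (f x) = Re (cinner x y)" using y[of x] by (simp add: inner_eq_Re_cinner)
    have "Re (f (\<i> *\<^sub>C x)) = Re (cinner (\<i> *\<^sub>C x) y)"
      using y[of "\<i> *\<^sub>C x"] by (simp add: inner_eq_Re_cinner)
    then show "Im (f x) = Im (cinner x y)" by (simp add: assms(2) cinner_scaleC_left)
  qed
  then show ?thesis by (rule that)
qed

lemma clinear_opD: "clinear_op A \<Longrightarrow> A (c *\<^sub>C x) = c *\<^sub>C A x"
  by (simp add: clinear_op_def)

text \<open>Riesz is applied to x -> <A x, y> for each y. The bound on \<open>b\<close> comes from
  |b y|^2 = <A (b y), y>.\<close>

lemma adjoint_exists:
  fixes A :: "'h::chilbert_space \<Rightarrow>\<^sub>L 'k::chilbert_space"
  assumes A: "clinear_op A"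
  obtains B :: "'k \<Rightarrow>\<^sub>L 'h" where "\<And>x y. cinner (A x) y = cinner x (B y)"
proof -
  have "\<exists>z. \<forall>x. cinner (A x) y = cinner x z" for y
  proof -
    have "bounded_linear (\<lambda>x. cinner (A x) y)"
    proof (rule bounded_linear_intro[where K = "norm A * norm y"])
      show "norm (cinner (A x) y) \<le> norm x * (norm A * norm y)" for x
        using order_trans[OF norm_cinner_le mult_right_mono[OF norm_blinfun[of A x] norm_ge_zero[of y]]]
        by (simp add: mult_ac)
    qed (simp_all add: blinfun.add_right cinner_add_left cinner_scaleC_left scaleR_conv_of_real clinear_opD[OF A]
        flip: scaleC_of_real)
    then show ?thesis
      using riesz[of "\<lambda>x. cinner (A x) y"] by (auto simp: clinear_opD[OF A] cinner_scaleC_left)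
  qed
  then obtain b where b: "\<And>x y. cinner (A x) y = cinner x (b y)" by metis
  have "bounded_linear b"
  proof (rule bounded_linear_intro[where K = "norm A"])
    show "b (x + y) = b x + b y" for x y
      by (rule cinner_eqI') (simp add: b[symmetric] cinner_add_right)
    show "b (r *\<^sub>R x) = r *\<^sub>R b x" for r x
      by (rule cinner_eqI') (simp add: b[symmetric] cinner_scaleC_right flip: scaleC_of_real)
    show "norm (b x) \<le> norm x * norm A" for x
    proof (cases "b x = 0")
      case False
      have "(norm (b x))\<^sup>2 = cmod (cinner (b x) (b x))" by (simp add: cinner_self norm_power)
      also have "\<dots> = cmod (cinner (A (b x)) x)" by (simp add: b)
      also have "\<dots> \<le> norm (A (b x)) * norm x" by (rule norm_cinner_le)
      also have "\<dots> \<le> norm A * norm (b x) * norm x"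
        by (intro mult_right_mono norm_blinfun) simp
      finally show ?thesis using False by (simp add: power2_eq_square mult_ac)
    qed simp
  qed
  then show ?thesis
    using that[of "Blinfun b"] by (simp add: bounded_linear_Blinfun_apply b)
qed

text \<open>Resolves the definite description in \<open>adj\<close>; the algebraic laws of the
  adjoint then follow by testing inner products.\<close>

lemma adj_eqI:
  assumes "\<And>x y. cinner (blinfun_apply A x) y = cinner x (blinfun_apply B y)"
  shows "adj A = B"
  unfolding adj_def
proof (rule the_equality)
  show "C = B" if "\<forall>x y. cinner (blinfun_apply A x) y = cinner x (blinfun_apply C y)" for C
    by (rule blinfun_eqI, rule cinner_eqI') (simp add: that[rule_format, symmetric] assms[symmetric])
qed (use assms in auto)

lemma adj:
  assumes "clinear_op A"
  shows "cinner (A x) y = cinner x (adj A y)"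
proof -
  obtain B where "\<And>x y. cinner (A x) y = cinner x (blinfun_apply B y)"
    using adjoint_exists[OF assms] by blast
  then show ?thesis using adj_eqI[of A B] by simp
qed

lemma adj': "clinear_op A \<Longrightarrow> cinner (adj A x) y = cinner x (A y)"
  using arg_cong[OF adj[of A y x], of cnj] by (simp only: cinner_commute[symmetric])

lemma clinear_adj [simp]: "clinear_op A \<Longrightarrow> clinear_op (adj A)"
  unfolding clinear_op_def[of "adj A"]
  by (intro allI, rule cinner_eqI) (simp add: adj' cinner_scaleC_left)

lemma adj_adj [simp]: "clinear_op A \<Longrightarrow> adj (adj A) = A"
  by (rule adj_eqI) (simp add: adj')

section \<open>Complex-linear operators as an algebra with involution\<close>

lemma clinear_zero [simp]: "clinear_op 0"
  and clinear_id [simp]: "clinear_op id_blinfun"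
  and clinear_add: "clinear_op A \<Longrightarrow> clinear_op B \<Longrightarrow> clinear_op (A + B)"
  and clinear_diff: "clinear_op A \<Longrightarrow> clinear_op B \<Longrightarrow> clinear_op (A - B)"
  and clinear_uminus: "clinear_op A \<Longrightarrow> clinear_op (- A)"
  and clinear_scaleC_op: "clinear_op A \<Longrightarrow> clinear_op (scaleC_op c A)"
  and clinear_scaleR: "clinear_op A \<Longrightarrow> clinear_op (r *\<^sub>R A)"
proof -
  have comm: "c *\<^sub>C d *\<^sub>C x = d *\<^sub>C c *\<^sub>C x" for c d and x :: "'z::chilbert_space"
    by (simp add: scaleC_scaleC mult.commute)
  show "clinear_op 0" "clinear_op id_blinfun" by (auto simp: clinear_op_def)
  show "clinear_op A \<Longrightarrow> clinear_op B \<Longrightarrow> clinear_op (A + B)"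
    by (auto simp: clinear_op_def blinfun.add_left scaleC_add_right)
  show "clinear_op A \<Longrightarrow> clinear_op B \<Longrightarrow> clinear_op (A - B)"
    by (auto simp: clinear_op_def blinfun.diff_left scaleC_diff_right)
  show "clinear_op A \<Longrightarrow> clinear_op (- A)"
    by (auto simp: clinear_op_def blinfun.minus_left scaleC_minus_right)
  show *: "clinear_op A \<Longrightarrow> clinear_op (scaleC_op c A)" for c
    by (auto simp: clinear_op_def scaleC_op.rep_eq comm)
  have "r *\<^sub>R A = scaleC_op (complex_of_real r) A"
    by (rule blinfun_eqI) (simp add: scaleC_op.rep_eq scaleC_of_real blinfun.scaleR_left)
  then show "clinear_op A \<Longrightarrow> clinear_op (r *\<^sub>R A)" by (simp add: *)
qed

lemma clinear_compose: "clinear_op A \<Longrightarrow> clinear_op B \<Longrightarrow> clinear_op (A o\<^sub>L B)"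
  by (simp add: clinear_op_def)

lemmas clinear_intros = clinear_add clinear_diff clinear_uminus clinear_scaleC_op clinear_scaleR clinear_compose
  clinear_adj clinear_zero clinear_id

lemma clinear_sum: "(\<And>i. i \<in> F \<Longrightarrow> clinear_op (A i)) \<Longrightarrow> clinear_op (\<Sum>i\<in>F. A i)"
  by (induction F rule: infinite_finite_induct) (auto intro: clinear_intros)

lemma adj_zero [simp]: "adj 0 = 0"
  and adj_id [simp]: "adj id_blinfun = id_blinfun"
  by (rule adj_eqI, simp)+

lemma adj_add: "clinear_op A \<Longrightarrow> clinear_op B \<Longrightarrow> adj (A + B) = adj A + adj B"
  by (rule adj_eqI) (simp add: blinfun.add_left cinner_add_left cinner_add_right adj)

lemma adj_diff: "clinear_op A \<Longrightarrow> clinear_op B \<Longrightarrow> adj (A - B) = adj A - adj B"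
  by (rule adj_eqI) (simp add: blinfun.diff_left cinner_diff_left cinner_diff_right adj)

lemma adj_scaleC: "clinear_op A \<Longrightarrow> adj (scaleC_op c A) = scaleC_op (cnj c) (adj A)"
  by (rule adj_eqI) (simp add: scaleC_op.rep_eq cinner_scaleC_left cinner_scaleC_right adj)

lemma adj_scaleR: "clinear_op A \<Longrightarrow> adj (r *\<^sub>R A) = r *\<^sub>R adj A"
  by (rule adj_eqI)
    (simp add: blinfun.scaleR_left cinner_scaleC_left cinner_scaleC_right adj flip: scaleC_of_real)

lemma adj_compose: "clinear_op A \<Longrightarrow> clinear_op B \<Longrightarrow> adj (A o\<^sub>L B) = adj B o\<^sub>L adj A"
  by (rule adj_eqI) (simp add: adj)

lemma adj_sum: "(\<And>i. i \<in> F \<Longrightarrow> clinear_op (A i)) \<Longrightarrow> adj (\<Sum>i\<in>F. A i) = (\<Sum>i\<in>F. adj (A i))"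
  by (induction F rule: infinite_finite_induct) (auto simp: adj_add clinear_sum)

text \<open>Cauchy-Schwarz gives |A x|^2 = <x, adj A A x>, hence |A|^2 \<le> |adj A A| \<le> |adj A|
  |A|. This yields |A| \<le> |adj A|, and the same for \<open>adj A\<close> gives equality.\<close>

lemma norm_adj_compose_self:
  assumes A: "clinear_op A"
  shows "norm (adj A o\<^sub>L A) = (norm A)\<^sup>2" and "norm (adj A) = norm A"
proof -
  have 1: "(norm A)\<^sup>2 \<le> norm (adj A o\<^sub>L A)" if A: "clinear_op A" for A :: "'x::chilbert_space \<Rightarrow>\<^sub>L 'y::chilbert_space"
  proof -
    have "norm (A x) \<le> sqrt (norm (adj A o\<^sub>L A)) * norm x" for x
    proof (rule power2_le_imp_le)
      have "(norm (A x))\<^sup>2 = cmod (cinner (A x) (A x))" by (simp add: cinner_self norm_power)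
      also have "\<dots> = cmod (cinner x ((adj A o\<^sub>L A) x))" by (simp add: adj A)
      also have "\<dots> \<le> norm x * norm ((adj A o\<^sub>L A) x)" by (rule norm_cinner_le)
      also have "\<dots> \<le> norm x * (norm (adj A o\<^sub>L A) * norm x)"
        by (intro mult_left_mono norm_blinfun) simp
      finally show "(norm (A x))\<^sup>2 \<le> (sqrt (norm (adj A o\<^sub>L A)) * norm x)\<^sup>2"
        by (simp add: power_mult_distrib) (simp add: power2_eq_square mult_ac)
    qed simp
    then have "norm A \<le> sqrt (norm (adj A o\<^sub>L A))" by (intro norm_blinfun_bound) auto
    then show ?thesis using power_mono[of "norm A" "sqrt (norm (adj A o\<^sub>L A))" 2] by simp
  qed
  have 2: "norm A \<le> norm (adj A)" if A: "clinear_op A" for A :: "'x::chilbert_space \<Rightarrow>\<^sub>L 'y::chilbert_space"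
  proof (cases "norm A = 0")
    case False
    have "norm A * norm A \<le> norm (adj A) * norm A"
      using order_trans[OF 1[OF A] norm_blinfun_compose] by (simp add: power2_eq_square)
    then show ?thesis using False by simp
  qed simp
  show eq: "norm (adj A) = norm A" using 2[OF A] 2[of "adj A"] A by simp
  show "norm (adj A o\<^sub>L A) = (norm A)\<^sup>2"
    using 1[OF A] norm_blinfun_compose[of "adj A" A] eq by (simp add: power2_eq_square)
qed

text \<open>The type \<open>\<Rightarrow>\<^sub>L\<close> consists of real-linear maps, so complex
  linearity is carried as a predicate. It is an intersection of closed conditions and therefore
  survives norm limits.\<close>

lemma closed_clinear: "closed {A. clinear_op A}"
proof -
  have "closed {A :: 'a::chilbert_space \<Rightarrow>\<^sub>L 'b::chilbert_space. A (c *\<^sub>C x) = c *\<^sub>C A x}" for c x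
    by (intro closed_Collect_eq continuous_intros
        continuous_on_compose2[OF bounded_linear.continuous_on[OF bounded_linear_scaleC_right continuous_on_id]]) auto
  then have "closed (\<Inter>c. \<Inter>x. {A :: 'a \<Rightarrow>\<^sub>L 'b. A (c *\<^sub>C x) = c *\<^sub>C A x})"
    by (intro closed_INT) auto
  moreover have "(\<Inter>c. \<Inter>x. {A :: 'a \<Rightarrow>\<^sub>L 'b. A (c *\<^sub>C x) = c *\<^sub>C A x}) = {A. clinear_op A}"
    by (auto simp: clinear_op_def)
  ultimately show ?thesis by simp
qed

lemma norm_scaleC_op: "norm (scaleC_op c A) = cmod c * norm A"
proof (cases "c = 0")
  case True
  then have "scaleC_op c A = 0" by (intro blinfun_eqI) (simp add: scaleC_op.rep_eq)
  then show ?thesis using True by simp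
next
  case False
  have le: "norm (scaleC_op c A) \<le> cmod c * norm A" for c and A :: "'a \<Rightarrow>\<^sub>L 'b"
    by (rule norm_blinfun_bound)
      (auto simp: scaleC_op.rep_eq norm_scaleC mult.assoc intro!: mult_left_mono norm_blinfun)
  have "A = scaleC_op (1 / c) (scaleC_op c A)"
    using False by (intro blinfun_eqI) (simp add: scaleC_op.rep_eq scaleC_scaleC)
  then have "norm A \<le> norm (scaleC_op c A) / cmod c"
    using le[of "1 / c" "scaleC_op c A"] by (simp add: norm_divide)
  then show ?thesis using le[of c A] False by (intro antisym) (auto simp: field_simps)
qed

lemma tendsto_adj:
  assumes "X \<longlonglongrightarrow> A" "\<And>n. clinear_op (X n)"
  shows "(\<lambda>n. adj (X n)) \<longlonglongrightarrow> adj A"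
proof -
  have A: "clinear_op A" using closed_sequentially[OF closed_clinear _ assms(1)] assms(2) by simp
  have "(\<lambda>n. norm (X n - A)) \<longlonglongrightarrow> 0" using assms(1) by (simp add: LIM_zero_iff tendsto_norm_zero)
  moreover have "norm (adj (X n) - adj A) = norm (X n - A)" for n
    using A assms(2)[of n] by (simp add: adj_diff[symmetric] norm_adj_compose_self clinear_diff)
  ultimately show ?thesis
    by - (rule LIM_zero_cancel, rule tendsto_norm_zero_cancel, simp)
qed

lemma tendsto_scaleC_op: "X \<longlonglongrightarrow> A \<Longrightarrow> (\<lambda>n. scaleC_op c (X n)) \<longlonglongrightarrow> scaleC_op c A"
proof -
  have "scaleC_op c A - scaleC_op c B = scaleC_op c (A - B)" for A B :: "'a \<Rightarrow>\<^sub>L 'b"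
    by (rule blinfun_eqI)
      (simp add: scaleC_op.rep_eq blinfun.diff_left scaleC_diff_right)
  note diff = this
  assume "X \<longlonglongrightarrow> A"
  then have "(\<lambda>n. norm (X n - A)) \<longlonglongrightarrow> 0" by (simp add: LIM_zero_iff tendsto_norm_zero)
  then have "(\<lambda>n. norm (scaleC_op c (X n) - scaleC_op c A)) \<longlonglongrightarrow> 0"
    by (simp add: diff norm_scaleC_op tendsto_mult_right_zero)
  then show "(\<lambda>n. scaleC_op c (X n)) \<longlonglongrightarrow> scaleC_op c A"
    by (rule LIM_zero_cancel[OF tendsto_norm_zero_cancel])
qed

lemma compose_scaleC_left: "scaleC_op c A o\<^sub>L B = scaleC_op c (A o\<^sub>L B)"
  by (rule blinfun_eqI) (simp add: scaleC_op.rep_eq)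

lemma compose_scaleC_right: "clinear_op A \<Longrightarrow> A o\<^sub>L scaleC_op c B = scaleC_op c (A o\<^sub>L B)"
  by (rule blinfun_eqI) (simp add: scaleC_op.rep_eq clinear_opD)

lemma scaleC_op_minus1: "scaleC_op (-1) A = - A"
  by (rule blinfun_eqI) (simp add: scaleC_op.rep_eq scaleC_minus1 blinfun.minus_left)

lemma scaleC_op_scaleC_op: "scaleC_op c (scaleC_op d A) = scaleC_op (c * d) A"
  by (rule blinfun_eqI) (simp add: scaleC_op.rep_eq scaleC_scaleC)

lemma scaleC_op_of_real: "scaleC_op (complex_of_real r) A = r *\<^sub>R A"
  by (rule blinfun_eqI) (simp add: scaleC_op.rep_eq scaleC_of_real blinfun.scaleR_left)

lemma scaleC_op_add: "scaleC_op c (A + B) = scaleC_op c A + scaleC_op c B"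
  by (rule blinfun_eqI) (simp add: scaleC_op.rep_eq scaleC_add_right blinfun.add_left)

lemma blinfun_compose_assoc: "(A o\<^sub>L B) o\<^sub>L C = A o\<^sub>L (B o\<^sub>L C)"
  by (rule blinfun_eqI) simp

lemma compose_id_left [simp]: "id_blinfun o\<^sub>L A = A"
  and compose_id_right [simp]: "A o\<^sub>L id_blinfun = A"
  by (rule blinfun_eqI, simp)+

lemmas compose_add_left = bounded_bilinear.add_left[OF bounded_bilinear_blinfun_compose]
lemmas compose_add_right = bounded_bilinear.add_right[OF bounded_bilinear_blinfun_compose]
lemmas compose_diff_left = bounded_bilinear.diff_left[OF bounded_bilinear_blinfun_compose]
lemmas compose_diff_right = bounded_bilinear.diff_right[OF bounded_bilinear_blinfun_compose]
lemmas compose_minus_left = bounded_bilinear.minus_left[OF bounded_bilinear_blinfun_compose]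
lemmas compose_zero_left = bounded_bilinear.zero_left[OF bounded_bilinear_blinfun_compose]
lemmas compose_zero_right = bounded_bilinear.zero_right[OF bounded_bilinear_blinfun_compose]
lemmas compose_sum_left = bounded_bilinear.sum_left[OF bounded_bilinear_blinfun_compose]
lemmas compose_sum_right = bounded_bilinear.sum_right[OF bounded_bilinear_blinfun_compose]
lemmas compose_scaleR_left = bounded_bilinear.scaleR_left[OF bounded_bilinear_blinfun_compose]
lemmas compose_scaleR_right = bounded_bilinear.scaleR_right[OF bounded_bilinear_blinfun_compose]
lemmas tendsto_compose_op = bounded_bilinear.tendsto[OF bounded_bilinear_blinfun_compose]

instance chilbert_space \<subseteq> banach ..

section \<open>Concrete C*-algebras\<close>

primrec oppow :: "('h::real_normed_vector \<Rightarrow>\<^sub>L 'h) \<Rightarrow> nat \<Rightarrow> ('h \<Rightarrow>\<^sub>L 'h)" where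
  "oppow A 0 = id_blinfun"
| "oppow A (Suc n) = A o\<^sub>L oppow A n"

text \<open>The premise makes the set of all complex-linear operators a candidate, so the
  intersection runs over a nonempty family.\<close>

lemma cstar_generated_closed:
  fixes S :: "('h::chilbert_space \<Rightarrow>\<^sub>L 'h) set"
  assumes S: "S \<subseteq> {A. clinear_op A}"
  shows "S \<subseteq> cstar_generated S"
    and "A \<in> cstar_generated S \<Longrightarrow> clinear_op A"
    and "A \<in> cstar_generated S \<Longrightarrow> B \<in> cstar_generated S \<Longrightarrow> A + B \<in> cstar_generated S"
    and "A \<in> cstar_generated S \<Longrightarrow> B \<in> cstar_generated S \<Longrightarrow> A o\<^sub>L B \<in> cstar_generated S"
    and "A \<in> cstar_generated S \<Longrightarrow> scaleC_op c A \<in> cstar_generated S"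
    and "A \<in> cstar_generated S \<Longrightarrow> adj A \<in> cstar_generated S"
    and "closed (cstar_generated S)"
proof -
  let ?P = "\<lambda>T. S \<subseteq> T \<and> T \<subseteq> {A. clinear_op A} \<and>
    0 \<in> T \<and> (\<forall>A\<in>T. \<forall>B\<in>T. A + B \<in> T \<and> A o\<^sub>L B \<in> T) \<and> (\<forall>c. \<forall>A\<in>T. scaleC_op c A \<in> T) \<and>
    (\<forall>A\<in>T. adj A \<in> T) \<and> closed T"
  have top: "?P {A. clinear_op A}"
    using S closed_clinear by (auto intro: clinear_intros)
  show "S \<subseteq> cstar_generated S" unfolding cstar_generated_def by blast
  show "A \<in> cstar_generated S \<Longrightarrow> clinear_op A"
    using top unfolding cstar_generated_def by blast
  show "A \<in> cstar_generated S \<Longrightarrow> B \<in> cstar_generated S \<Longrightarrow> A + B \<in> cstar_generated S"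
    "A \<in> cstar_generated S \<Longrightarrow> B \<in> cstar_generated S \<Longrightarrow> A o\<^sub>L B \<in> cstar_generated S"
    "A \<in> cstar_generated S \<Longrightarrow> scaleC_op c A \<in> cstar_generated S"
    "A \<in> cstar_generated S \<Longrightarrow> adj A \<in> cstar_generated S"
    unfolding cstar_generated_def by blast+
  show "closed (cstar_generated S)"
    unfolding cstar_generated_def by (rule closed_Inter) blast
qed

lemma scaleC_op_zero [simp]: "scaleC_op 0 A = 0"
  by (rule blinfun_eqI) (simp add: scaleC_op.rep_eq)

lemma scaleC_op_one [simp]: "scaleC_op 1 A = A"
  by (rule blinfun_eqI) (simp add: scaleC_op.rep_eq)

text \<open>The unit is an assumption because \<open>cstar_generated\<close> does not adjoin one.
  For the Cuntz--Toeplitz algebra it arises as the product of \<open>adj (creation i)\<close> and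
  \<open>creation i\<close>, for \<open>dilation_algebra U\<close> as
  \<open>ampliation id_blinfun\<close>.\<close>

locale cstar_ops =
  fixes T :: "('h::chilbert_space \<Rightarrow>\<^sub>L 'h) set"
  assumes clin: "A \<in> T \<Longrightarrow> clinear_op A"
    and id_mem: "id_blinfun \<in> T"
    and add_mem: "A \<in> T \<Longrightarrow> B \<in> T \<Longrightarrow> A + B \<in> T"
    and compose_mem: "A \<in> T \<Longrightarrow> B \<in> T \<Longrightarrow> A o\<^sub>L B \<in> T"
    and scaleC_mem: "A \<in> T \<Longrightarrow> scaleC_op c A \<in> T"
    and adj_mem: "A \<in> T \<Longrightarrow> adj A \<in> T"
    and closed_T: "closed T"
begin

lemma zero_mem: "0 \<in> T"
  using scaleC_mem[OF id_mem, of 0] by simp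

lemma uminus_mem: "A \<in> T \<Longrightarrow> - A \<in> T"
  using scaleC_mem[of A "-1"] by (simp add: scaleC_op_minus1)

lemma diff_mem: "A \<in> T \<Longrightarrow> B \<in> T \<Longrightarrow> A - B \<in> T"
  using add_mem[of A "- B"] uminus_mem by simp

lemma scaleR_mem: "A \<in> T \<Longrightarrow> r *\<^sub>R A \<in> T"
  using scaleC_mem[of A "complex_of_real r"] by (simp add: scaleC_op_of_real)

lemma sum_mem: "(\<And>i. i \<in> F \<Longrightarrow> A i \<in> T) \<Longrightarrow> (\<Sum>i\<in>F. A i) \<in> T"
  by (induction F rule: infinite_finite_induct) (auto intro: zero_mem add_mem)

lemma oppow_mem: "A \<in> T \<Longrightarrow> oppow A n \<in> T"
  by (induction n) (auto intro: id_mem compose_mem)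

lemmas mems = zero_mem id_mem add_mem compose_mem scaleC_mem adj_mem uminus_mem diff_mem scaleR_mem

text \<open>The square root \<open>s\<close> of \<open>1 - h\<^sup>2\<close> is \<open>1 - y\<close> for the fixed point \<open>y\<close> of \<open>y \<mapsto> (h\<^sup>2 + y\<^sup>2) / 2\<close>, and
  \<open>w = h + \<i> s\<close>.\<close>

lemma selfadjoint_eq_average_of_unitary:
  assumes h: "h \<in> T" "adj h = h" "norm h < 1"
  obtains w where "w \<in> T" "adj w o\<^sub>L w = id_blinfun" "w o\<^sub>L adj w = id_blinfun"
    "h = (1/2) *\<^sub>R (w + adj w)"
proof -
  \<comment> \<open>The radius |h| < 1 makes \<open>f\<close> a contraction with constant |h|.
    Commutation with \<open>h\<close> is built in because the cross terms in
    \<open>adj w o\<^sub>L w\<close> cancel only if h and s commute.\<close>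
  define S where "S = {y \<in> T. adj y = y \<and> y o\<^sub>L h = h o\<^sub>L y \<and> norm y \<le> norm h}"
  define f where "f y = (1/2) *\<^sub>R ((h o\<^sub>L h) + (y o\<^sub>L y))" for y
  have ST: "y \<in> T" "clinear_op y" if "y \<in> S" for y using that clin by (auto simp: S_def)
  have "closed S"
    unfolding closed_sequential_limits
  proof (intro allI impI)
    fix Y y assume "(\<forall>n. Y n \<in> S) \<and> Y \<longlonglongrightarrow> y"
    then have Y: "\<And>n. Y n \<in> S" and lim: "Y \<longlonglongrightarrow> y" by auto
    have y: "y \<in> T" using closed_sequentially[OF closed_T _ lim] Y ST by blast
    have "(\<lambda>n. adj (Y n)) \<longlonglongrightarrow> adj y" using lim Y ST by (intro tendsto_adj) auto
    then have "adj y = y" using LIMSEQ_unique lim Y by (simp add: S_def)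
    moreover have "y o\<^sub>L h = h o\<^sub>L y"
    proof (rule LIMSEQ_unique)
      show "(\<lambda>n. Y n o\<^sub>L h) \<longlonglongrightarrow> (y o\<^sub>L h)" by (intro tendsto_compose_op lim tendsto_const)
      have "(\<lambda>n. h o\<^sub>L Y n) \<longlonglongrightarrow> (h o\<^sub>L y)" by (intro tendsto_compose_op lim tendsto_const)
      then show "(\<lambda>n. Y n o\<^sub>L h) \<longlonglongrightarrow> (h o\<^sub>L y)" using Y by (simp add: S_def)
    qed
    moreover have "norm y \<le> norm h"
      by (rule LIMSEQ_le_const2[OF tendsto_norm[OF lim]]) (use Y in \<open>auto simp: S_def\<close>)
    ultimately show "y \<in> S" using y by (simp add: S_def)
  qed
  then have "Topological_Spaces.complete S" by (simp add: complete_eq_closed)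
  moreover have "0 \<in> S" by (simp add: S_def zero_mem compose_zero_left compose_zero_right)
  then have "S \<noteq> {}" by blast
  moreover have "f ` S \<subseteq> S"
  proof
    fix z assume "z \<in> f ` S"
    then obtain y where y: "y \<in> S" and z: "z = f y" by auto
    have "norm ((h o\<^sub>L h) + (y o\<^sub>L y)) \<le> norm h * norm h + norm y * norm y"
      by (intro order_trans[OF norm_triangle_ineq] add_mono norm_blinfun_compose)
    also have "\<dots> \<le> norm h * norm h + norm h * norm h"
      using y by (intro add_left_mono mult_mono) (auto simp: S_def)
    also have "\<dots> \<le> 2 * norm h"
      using mult_left_mono[of "norm h" 1 "norm h"] h by simp
    finally have "norm (f y) \<le> norm h" by (simp add: f_def)
    moreover have "f y \<in> T" using y ST h by (auto simp: f_def intro!: mems)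
    moreover have "adj (f y) = f y"
    proof -
      have *: "adj y = y" using y by (simp add: S_def)
      show ?thesis
        unfolding f_def using ST(2)[OF y] clin[OF h(1)]
        by (simp only: adj_scaleR adj_add adj_compose clinear_compose clinear_add * h(2))
    qed
    moreover have "y o\<^sub>L (y o\<^sub>L h) = h o\<^sub>L (y o\<^sub>L y)"
    proof -
      have yh: "y o\<^sub>L h = h o\<^sub>L y" using y by (simp add: S_def)
      have "y (h v) = h (y v)" for v
        using arg_cong[OF yh, of "\<lambda>A. blinfun_apply A v"] by simp
      then show ?thesis by (intro blinfun_eqI) simp
    qed
    then have "f y o\<^sub>L h = h o\<^sub>L f y"
      by (simp add: f_def compose_scaleR_left compose_scaleR_right compose_add_left compose_add_right
          blinfun_compose_assoc)
    ultimately show "z \<in> S" by (simp add: S_def z)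
  qed
  moreover have "dist (f x) (f y) \<le> norm h * dist x y" if "x \<in> S" "y \<in> S" for x y
  proof -
    \<comment> \<open>x^2 - y^2 = x (x - y) + (x - y) y holds without commutation of x and
      y.\<close>
    have "f x - f y = (1/2) *\<^sub>R ((x o\<^sub>L (x - y)) + ((x - y) o\<^sub>L y))"
      by (simp add: f_def compose_diff_left compose_diff_right algebra_simps)
    also have "norm \<dots> \<le> (1/2) * (norm x * norm (x - y) + norm (x - y) * norm y)"
      by (simp add: order_trans[OF norm_triangle_ineq] add_mono norm_blinfun_compose)
    also have "\<dots> \<le> (1/2) * (norm h * norm (x - y) + norm (x - y) * norm h)"
      using that by (intro mult_left_mono add_mono mult_right_mono) (auto simp: S_def)
    finally show ?thesis by (simp add: dist_norm)
  qed
  ultimately have "\<exists>!y\<in>S. f y = y"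
    using h(3) by (intro Banach_fix[where c = "norm h"]) auto
  then obtain y where y: "y \<in> S" "f y = y" by blast
  define s where "s = id_blinfun - y"
  have "(h o\<^sub>L h) + (y o\<^sub>L y) = y + y"
    using arg_cong[OF y(2), of "\<lambda>z. 2 *\<^sub>R z"] by (simp add: f_def scaleR_2)
  then have yy: "(y o\<^sub>L y) = y + y - (h o\<^sub>L h)" by (simp add: algebra_simps)
  have hs: "h o\<^sub>L s = s o\<^sub>L h"
    using y by (simp add: s_def S_def compose_diff_left compose_diff_right)
  have ss: "(s o\<^sub>L s) = id_blinfun - (h o\<^sub>L h)"
    by (simp add: s_def compose_diff_left compose_diff_right yy)
  have s: "s \<in> T" "adj s = s" "clinear_op s"
    using y by (auto simp: s_def S_def adj_diff clin intro: mems clinear_intros)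
  define w where "w = h + scaleC_op \<i> s"
  have aw: "adj w = h - scaleC_op \<i> s"
    using h s scaleC_op_minus1[of "scaleC_op \<i> s"]
    by (simp add: w_def adj_add adj_scaleC clin clinear_intros scaleC_op_scaleC_op)
  have sq: "scaleC_op \<i> s o\<^sub>L scaleC_op \<i> s = (h o\<^sub>L h) - id_blinfun"
    using s scaleC_op_minus1[of "(s o\<^sub>L s)"]
    by (simp add: compose_scaleC_left compose_scaleC_right scaleC_op_scaleC_op ss)
  have "h o\<^sub>L scaleC_op \<i> s = scaleC_op \<i> s o\<^sub>L h"
    using h clin by (simp add: compose_scaleC_left compose_scaleC_right hs)
  then have "adj w o\<^sub>L w = id_blinfun" "w o\<^sub>L adj w = id_blinfun"
    unfolding aw unfolding w_def compose_add_left compose_add_right compose_diff_left compose_diff_right sq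
    by simp_all
  moreover have "h = (1/2) *\<^sub>R (w + adj w)"
    unfolding aw by (simp add: w_def scaleR_2[symmetric])
  moreover have "w \<in> T" using h s by (simp add: w_def mems)
  ultimately show ?thesis using that by blast
qed

text \<open>The C*-identity makes p(1) equal to its square, so p is at most 1 on unitaries and hence
  on their averages. Scaling extends the bound to all self-adjoint elements, and one more use of the
  C*-identity, at adj A A, to all A.\<close>

lemma cstar_seminorm_le_norm:
  assumes nonneg: "\<And>A. A \<in> T \<Longrightarrow> 0 \<le> p A"
    and star: "\<And>A. A \<in> T \<Longrightarrow> p (adj A o\<^sub>L A) = (p A)\<^sup>2"
    and scal: "\<And>A c. A \<in> T \<Longrightarrow> p (scaleC_op c A) = cmod c * p A"
    and add: "\<And>A B. A \<in> T \<Longrightarrow> B \<in> T \<Longrightarrow> p (A + B) \<le> p A + p B"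
    and A: "A \<in> T"
  shows "p A \<le> norm A"
proof -
  have "p id_blinfun = (p id_blinfun)\<^sup>2" using star[OF id_mem] by simp
  then have id1: "p id_blinfun \<le> 1" by (auto simp: power2_eq_square)
  have unitary: "p w \<le> 1" if "w \<in> T" "adj w o\<^sub>L w = id_blinfun" for w
    using star[OF that(1)] that(2) id1 by (intro power2_le_imp_le[of "p w" 1]) auto
  have scalR: "p (r *\<^sub>R A) = \<bar>r\<bar> * p A" if "A \<in> T" for r A
    using scal[OF that, of "complex_of_real r"] by (simp add: scaleC_op_of_real)
  have less1: "p h \<le> 1" if h: "h \<in> T" "adj h = h" "norm h < 1" for h
  proof -
    obtain w where w: "w \<in> T" "adj w o\<^sub>L w = id_blinfun" "w o\<^sub>L adj w = id_blinfun"
      "h = (1/2) *\<^sub>R (w + adj w)"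
      using selfadjoint_eq_average_of_unitary[OF h] .
    have "p h = (1/2) * p (w + adj w)" using w by (simp add: scalR mems)
    also have "\<dots> \<le> (1/2) * (p w + p (adj w))" using w by (intro mult_left_mono add mems) auto
    also have "\<dots> \<le> (1/2) * (1 + 1)"
      using w clin[OF w(1)] by (intro mult_left_mono add_mono unitary) (auto intro: mems)
    finally show ?thesis by simp
  qed
  have selfadj: "p h \<le> norm h" if h: "h \<in> T" "adj h = h" for h
  proof (rule dense_le)
    fix r assume "r < p h"
    show "r \<le> norm h"
    proof (rule ccontr)
      assume "\<not> r \<le> norm h"
      then have r: "norm h < r" "0 < r" using norm_ge_zero[of h] by linarith+
      have "p ((1/r) *\<^sub>R h) \<le> 1"
        using h r clin by (intro less1) (auto intro: mems simp: adj_scaleR)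
      then have "p h \<le> r" using r h by (simp add: scalR field_simps)
      then show False using \<open>r < p h\<close> by simp
    qed
  qed
  have "(p A)\<^sup>2 = p (adj A o\<^sub>L A)" using star A by simp
  also have "\<dots> \<le> norm (adj A o\<^sub>L A)"
    using A clin[OF A] by (intro selfadj) (auto intro: mems simp: adj_compose)
  also have "\<dots> = (norm A)\<^sup>2" using norm_adj_compose_self clin[OF A] by blast
  finally show ?thesis by (rule power2_le_imp_le) simp
qed

end

text \<open>An operator form of the bound t (1 - t^2)^n \<le> 1 / sqrt n on [0, 1], obtained from a
  decay estimate for vectors instead of functional calculus.\<close>

lemma norm_power_one_minus_square:
  fixes k :: "'h::chilbert_space \<Rightarrow>\<^sub>L 'h"
  assumes k: "clinear_op k" "adj k = k" "norm k \<le> 1"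
  defines "D \<equiv> id_blinfun - (k o\<^sub>L k)"
  shows "norm (oppow D n) \<le> 1" and "sqrt (real n) * norm (k o\<^sub>L oppow D n) \<le> 1"
proof -
  have le: "norm (k x) \<le> norm x" for x
    using norm_blinfun[of k x] mult_right_mono[OF k(3), of "norm x"] by simp
  have "inner (k x) y = inner x (k y)" for x y
    using adj[OF k(1), of x y] k(2) by (simp add: inner_eq_Re_cinner)
  then have kk: "inner x (k (k x)) = (norm (k x))\<^sup>2" for x
    by (simp add: power2_norm_eq_inner)
  have D: "(norm (D x))\<^sup>2 \<le> (norm x)\<^sup>2 - (norm (k x))\<^sup>2" for x
  proof -
    have "(norm (D x))\<^sup>2 = (norm x)\<^sup>2 - 2 * inner x (k (k x)) + (norm (k (k x)))\<^sup>2"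
      unfolding D_def power2_norm_eq_inner
      by (simp add: blinfun.diff_left inner_diff_left inner_diff_right inner_commute)
    also have "(norm (k (k x)))\<^sup>2 \<le> (norm (k x))\<^sup>2" using le by (intro power_mono) auto
    finally show ?thesis by (simp add: kk)
  qed
  have Dle: "norm (D x) \<le> norm x" for x
    by (rule power2_le_imp_le) (use D[of x] zero_le_power2[of "norm (k x)"] in \<open>linarith, simp\<close>)
  have comm: "k (D x) = D (k x)" for x
    by (simp add: D_def blinfun.diff_left blinfun.diff_right)
  \<comment> \<open>Each application of \<open>D\<close> costs at least |k y|^2 of the squared norm,
    which pays for the additional summand; the old summands do not grow because k commutes with the
    contraction \<open>D\<close>.\<close>
  have main: "(norm (oppow D n x))\<^sup>2 + real n * (norm (k (oppow D n x)))\<^sup>2 \<le> (norm x)\<^sup>2" for x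
  proof (induction n)
    case (Suc n)
    let ?y = "oppow D n x"
    have "(norm (D ?y))\<^sup>2 + real (Suc n) * (norm (k (D ?y)))\<^sup>2
        \<le> ((norm ?y)\<^sup>2 - (norm (k ?y))\<^sup>2) + real (Suc n) * (norm (k ?y))\<^sup>2"
      unfolding comm using D Dle by (intro add_mono mult_left_mono power_mono) auto
    also have "\<dots> = (norm ?y)\<^sup>2 + real n * (norm (k ?y))\<^sup>2" by (simp add: algebra_simps)
    also have "\<dots> \<le> (norm x)\<^sup>2" by (rule Suc.IH)
    finally show ?case by simp
  qed simp
  show "norm (oppow D n) \<le> 1"
  proof (rule norm_blinfun_bound)
    fix x
    have "0 \<le> real n * (norm (k (oppow D n x)))\<^sup>2" by simp
    then have "(norm (oppow D n x))\<^sup>2 \<le> (norm x)\<^sup>2" using main[of x] by linarith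
    then show "norm (oppow D n x) \<le> 1 * norm x"
      unfolding mult_1 by (rule power2_le_imp_le) simp
  qed simp
  have "norm (k o\<^sub>L oppow D n) \<le> 1 / sqrt (real n)" if "n > 0"
  proof (rule norm_blinfun_bound)
    fix x
    have "real n * (norm (k (oppow D n x)))\<^sup>2 \<le> (norm x)\<^sup>2"
      using main[of x] zero_le_power2[of "norm (oppow D n x)"] by linarith
    then have "(sqrt (real n) * norm (k (oppow D n x)))\<^sup>2 \<le> (norm x)\<^sup>2"
      by (simp add: power_mult_distrib)
    then have "sqrt (real n) * norm (k (oppow D n x)) \<le> norm x" by (rule power2_le_imp_le) simp
    then show "norm ((k o\<^sub>L oppow D n) x) \<le> 1 / sqrt (real n) * norm x"
      using that by (simp add: field_simps)
  qed simp
  then show "sqrt (real n) * norm (k o\<^sub>L oppow D n) \<le> 1"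
    by (cases "n = 0") (auto simp: field_simps)
qed

section \<open>Ideals and quotients\<close>

lemma (in cstar_ops) ring_op_algebra: "ring (op_algebra T)"
proof (rule ringI)
  show "abelian_group (op_algebra T)"
  proof (rule abelian_groupI)
    fix A assume "A \<in> carrier (op_algebra T)"
    then show "\<exists>B\<in>carrier (op_algebra T). B \<oplus>\<^bsub>op_algebra T\<^esub> A = \<zero>\<^bsub>op_algebra T\<^esub>"
      by (intro bexI[of _ "- A"]) (auto simp: op_algebra_def mems)
  qed (auto simp: op_algebra_def mems)
  show "Group.monoid (op_algebra T)"
    by (rule monoidI) (auto simp: op_algebra_def mems blinfun_compose_assoc)
qed (auto simp: op_algebra_def compose_add_left compose_add_right)

lemma (in cstar_ops) op_algebra_minus:
  assumes "A \<in> T" "B \<in> T"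
  shows "\<ominus>\<^bsub>op_algebra T\<^esub> B = - B" "A \<ominus>\<^bsub>op_algebra T\<^esub> B = A - B"
proof -
  interpret R: ring "op_algebra T" by (rule ring_op_algebra)
  show "\<ominus>\<^bsub>op_algebra T\<^esub> B = - B"
    by (rule R.minus_equality) (use assms in \<open>auto simp: op_algebra_def mems\<close>)
  then show "A \<ominus>\<^bsub>op_algebra T\<^esub> B = A - B"
    by (simp add: a_minus_def) (simp add: op_algebra_def)
qed

text \<open>Additive inverses are automatic because - A is the product of - id and A, which lies in
  the ideal.\<close>

lemma (in cstar_ops) ideal_op_algebra_iff:
  "ideal J (op_algebra T) \<longleftrightarrow> J \<subseteq> T \<and> 0 \<in> J \<and> (\<forall>A\<in>J. \<forall>B\<in>J. A + B \<in> J) \<and>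
    (\<forall>A\<in>J. \<forall>B\<in>T. B o\<^sub>L A \<in> J \<and> A o\<^sub>L B \<in> J)"
proof
  assume "ideal J (op_algebra T)"
  then interpret ideal J "op_algebra T" .
  show "J \<subseteq> T \<and> 0 \<in> J \<and> (\<forall>A\<in>J. \<forall>B\<in>J. A + B \<in> J) \<and>
    (\<forall>A\<in>J. \<forall>B\<in>T. B o\<^sub>L A \<in> J \<and> A o\<^sub>L B \<in> J)"
    using a_subset additive_subgroup.zero_closed[OF is_additive_subgroup]
      additive_subgroup.a_closed[OF is_additive_subgroup] I_l_closed I_r_closed
    by (auto simp: op_algebra_def)
next
  assume *: "J \<subseteq> T \<and> 0 \<in> J \<and> (\<forall>A\<in>J. \<forall>B\<in>J. A + B \<in> J) \<and>
    (\<forall>A\<in>J. \<forall>B\<in>T. B o\<^sub>L A \<in> J \<and> A o\<^sub>L B \<in> J)"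
  interpret R: ring "op_algebra T" by (rule ring_op_algebra)
  have neg: "- A \<in> J" if "A \<in> J" for A
    using * that uminus_mem[OF id_mem] by (metis compose_id_left compose_minus_left)
  show "ideal J (op_algebra T)"
  proof (rule idealI[OF ring_op_algebra])
    show "subgroup J (add_monoid (op_algebra T))"
    proof (rule R.add.subgroupI)
      show "\<ominus>\<^bsub>op_algebra T\<^esub> A \<in> J" if "A \<in> J" for A
        using neg[OF that] op_algebra_minus(1)[of A A] that * by auto
    qed (use * in \<open>auto simp: op_algebra_def\<close>)
  qed (use * in \<open>auto simp: op_algebra_def\<close>)
qed

section \<open>Star ideals and operations on cosets\<close>

locale star_ideal = cstar_ops +
  fixes J :: "('a::chilbert_space \<Rightarrow>\<^sub>L 'a) set"
  assumes J_sub: "J \<subseteq> T"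
    and J_zero: "0 \<in> J"
    and J_add: "A \<in> J \<Longrightarrow> B \<in> J \<Longrightarrow> A + B \<in> J"
    and J_left: "A \<in> J \<Longrightarrow> B \<in> T \<Longrightarrow> B o\<^sub>L A \<in> J"
    and J_right: "A \<in> J \<Longrightarrow> B \<in> T \<Longrightarrow> A o\<^sub>L B \<in> J"
    and J_adj: "A \<in> J \<Longrightarrow> adj A \<in> J"
begin

lemma J_T: "A \<in> J \<Longrightarrow> A \<in> T"
  using J_sub by auto

lemma J_scaleC: "A \<in> J \<Longrightarrow> scaleC_op c A \<in> J"
  using J_left[of A "scaleC_op c id_blinfun"] by (simp add: mems compose_scaleC_left)

lemma J_scaleR: "A \<in> J \<Longrightarrow> r *\<^sub>R A \<in> J"
  using J_scaleC[of A "complex_of_real r"] by (simp add: scaleC_op_of_real)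

lemma J_uminus: "A \<in> J \<Longrightarrow> - A \<in> J"
  using J_scaleC[of A "-1"] by (simp add: scaleC_op_minus1)

lemma J_diff_commute: "A - B \<in> J \<Longrightarrow> B - A \<in> J"
  using J_uminus[of "A - B"] by simp

lemma J_diff_trans: "A - B \<in> J \<Longrightarrow> B - C \<in> J \<Longrightarrow> A - C \<in> J"
  using J_add[of "A - B" "B - C"] by simp

lemma J_sum: "(\<And>i. i \<in> F \<Longrightarrow> A i \<in> J) \<Longrightarrow> (\<Sum>i\<in>F. A i) \<in> J"
  by (induction F rule: infinite_finite_induct) (auto intro: J_zero J_add)

lemma diff_compose_mem:
  assumes "A - A' \<in> J" "B - B' \<in> J" "A' \<in> T" "B \<in> T"
  shows "(A o\<^sub>L B) - (A' o\<^sub>L B') \<in> J"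
proof -
  have "(A o\<^sub>L B) - (A' o\<^sub>L B') = ((A - A') o\<^sub>L B) + (A' o\<^sub>L (B - B'))"
    by (simp add: compose_diff_left compose_diff_right)
  then show ?thesis using assms by (simp add: J_add J_left J_right)
qed

definition cl :: "('a \<Rightarrow>\<^sub>L 'a) \<Rightarrow> ('a \<Rightarrow>\<^sub>L 'a) set"
  where "cl A = {B. B - A \<in> J}"

lemma coset_eq: "J +>\<^bsub>op_algebra T\<^esub> A = cl A"
proof -
  have "J +>\<^bsub>op_algebra T\<^esub> A = {j + A | j. j \<in> J}"
    by (auto simp: a_r_coset_def r_coset_def op_algebra_def)
  also have "\<dots> = cl A"
    unfolding cl_def by (auto intro!: exI[of _ "_ - A"])
  finally show ?thesis .
qed

lemma cl_eq_iff: "cl A = cl B \<longleftrightarrow> A - B \<in> J"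
proof
  assume "cl A = cl B"
  moreover have "A \<in> cl A" by (simp add: cl_def J_zero)
  ultimately show "A - B \<in> J" by (simp add: cl_def)
next
  assume "A - B \<in> J"
  then show "cl A = cl B" unfolding cl_def by (auto intro: J_diff_trans J_diff_commute)
qed

lemma cl_self: "A \<in> cl A"
  by (simp add: cl_def J_zero)

lemma cl_subset: "A \<in> T \<Longrightarrow> B \<in> cl A \<Longrightarrow> B \<in> T"
  using add_mem[of "B - A" A] J_T[of "B - A"] by (simp add: cl_def)

abbreviation "Quo \<equiv> cstar_quot (op_algebra T) J"

lemma carrier_quot: "carrier Quo = cl ` T"
proof -
  have "carrier Quo = (\<Union>A\<in>carrier (op_algebra T). {J +>\<^bsub>op_algebra T\<^esub> A})"
    by (simp add: cstar_quot_def FactRing_def A_RCOSETS_def RCOSETS_def a_r_coset_def)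
  then show ?thesis by (auto simp: coset_eq) (auto simp: op_algebra_def)
qed

lemma add_quot:
  assumes "A \<in> T" "B \<in> T"
  shows "cl A \<oplus>\<^bsub>Quo\<^esub> cl B = cl (A + B)"
proof -
  have "cl A \<oplus>\<^bsub>Quo\<^esub> cl B = (\<Union>a\<in>cl A. \<Union>b\<in>cl B. {a + b})"
    by (simp add: cstar_quot_def FactRing_def set_add_def set_mult_def op_algebra_def)
  also have "\<dots> = cl (A + B)"
  proof (intro equalityI subsetI)
    fix x assume "x \<in> (\<Union>a\<in>cl A. \<Union>b\<in>cl B. {a + b})"
    then obtain a b where "x = a + b" "a - A \<in> J" "b - B \<in> J" by (auto simp: cl_def)
    then show "x \<in> cl (A + B)" using J_add[of "a - A" "b - B"] by (simp add: cl_def algebra_simps)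
  next
    fix x assume "x \<in> cl (A + B)"
    then have "x - B \<in> cl A" by (simp add: cl_def algebra_simps)
    then show "x \<in> (\<Union>a\<in>cl A. \<Union>b\<in>cl B. {a + b})"
      using cl_self[of B] by (intro UN_I[of "x - B"] UN_I[of B]) auto
  qed
  finally show ?thesis .
qed

text \<open>In \<open>FactRing\<close> a product of cosets is a union over all representatives;
  \<open>diff_compose_mem\<close> makes this family constant and \<open>cl_self\<close> shows that
  it is nonempty.\<close>

lemma mult_quot:
  assumes "A \<in> T" "B \<in> T"
  shows "cl A \<otimes>\<^bsub>Quo\<^esub> cl B = cl (A o\<^sub>L B)"
proof -
  have "cl A \<otimes>\<^bsub>Quo\<^esub> cl B = (\<Union>a\<in>cl A. \<Union>b\<in>cl B. cl (a o\<^sub>L b))"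
    by (simp add: cstar_quot_def FactRing_def rcoset_mult_def coset_eq) (simp add: op_algebra_def)
  also have "\<dots> = (\<Union>a\<in>cl A. \<Union>b\<in>cl B. cl (A o\<^sub>L B))"
  proof (intro SUP_cong refl)
    fix a b assume a: "a \<in> cl A" and b: "b \<in> cl B"
    then show "cl (a o\<^sub>L b) = cl (A o\<^sub>L B)"
      using assms cl_subset[OF assms(2) b] unfolding cl_eq_iff by (intro diff_compose_mem) (auto simp: cl_def)
  qed
  also have "\<dots> = cl (A o\<^sub>L B)" using cl_self by auto
  finally show ?thesis .
qed

lemma one_quot: "\<one>\<^bsub>Quo\<^esub> = cl id_blinfun"
  by (simp add: cstar_quot_def FactRing_def coset_eq) (simp add: op_algebra_def)

lemma cl_zero: "cl 0 = J"
  by (simp add: cl_def)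

lemma zero_quot: "\<zero>\<^bsub>Quo\<^esub> = cl 0"
  by (simp add: cstar_quot_def FactRing_def cl_zero)

lemma scal_quot:
  assumes "A \<in> T"
  shows "scal Quo c (cl A) = cl (scaleC_op c A)"
proof -
  have "scal Quo c (cl A) = (\<Union>a\<in>cl A. cl (scaleC_op c a))"
    by (simp add: cstar_quot_def coset_eq) (simp add: op_algebra_def)
  also have "\<dots> = (\<Union>a\<in>cl A. cl (scaleC_op c A))"
  proof (intro SUP_cong refl)
    fix a assume "a \<in> cl A"
    moreover have "scaleC_op c a - scaleC_op c A = scaleC_op c (a - A)"
      using scaleC_op_add[of c "a - A" A] by simp
    ultimately show "cl (scaleC_op c a) = cl (scaleC_op c A)"
      by (simp add: cl_eq_iff J_scaleC) (simp add: cl_def J_scaleC)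
  qed
  also have "\<dots> = cl (scaleC_op c A)" using cl_self by auto
  finally show ?thesis .
qed

lemma star_quot:
  assumes "A \<in> T"
  shows "star Quo (cl A) = cl (adj A)"
proof -
  have "star Quo (cl A) = (\<Union>a\<in>cl A. cl (adj a))"
    by (simp add: cstar_quot_def coset_eq) (simp add: op_algebra_def)
  also have "\<dots> = (\<Union>a\<in>cl A. cl (adj A))"
  proof (intro SUP_cong refl)
    fix a assume a: "a \<in> cl A"
    then have "adj a - adj A = adj (a - A)"
      using cl_subset[OF assms a] assms by (simp add: adj_diff clin)
    then show "cl (adj a) = cl (adj A)"
      using a by (simp add: cl_eq_iff) (simp add: cl_def J_adj)
  qed
  also have "\<dots> = cl (adj A)" using cl_self by auto
  finally show ?thesis .
qed

lemmas quot_simps = carrier_quot add_quot mult_quot one_quot zero_quot scal_quot star_quot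

lemma abelian_group_quot: "abelian_group Quo"
proof (rule abelian_groupI)
  fix X assume "X \<in> carrier Quo"
  then obtain A where "A \<in> T" "X = cl A" by (auto simp: carrier_quot)
  then show "\<exists>Y\<in>carrier Quo. Y \<oplus>\<^bsub>Quo\<^esub> X = \<zero>\<^bsub>Quo\<^esub>"
    by (intro bexI[of _ "cl (- A)"]) (auto simp: quot_simps mems)
qed (auto simp: quot_simps mems add_ac)

text \<open>Products in \<open>algebraic_crossed_product\<close> are finite sums formed in the
  coefficient ring, here a quotient; this pulls them back to sums of operators.\<close>

lemma finsum_quot:
  assumes "finite F" "\<And>i. i \<in> F \<Longrightarrow> A i \<in> T"
  shows "(\<Oplus>\<^bsub>Quo\<^esub>i\<in>F. cl (A i)) = cl (\<Sum>i\<in>F. A i)"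
proof -
  interpret Q: abelian_group Quo by (rule abelian_group_quot)
  show ?thesis
    using assms
  proof (induction F rule: finite_induct)
    case (insert i F)
    then have "(\<Oplus>\<^bsub>Quo\<^esub>i\<in>insert i F. cl (A i)) = cl (A i) \<oplus>\<^bsub>Quo\<^esub> (\<Oplus>\<^bsub>Quo\<^esub>i\<in>F. cl (A i))"
      by (intro Q.finsum_insert) (auto simp: carrier_quot)
    then show ?case using insert by (simp add: add_quot sum_mem)
  qed (simp add: zero_quot)
qed

end

text \<open>Kept apart from \<open>star_ideal\<close>: the universal norm is determined by the Cuntz
  algebra as a *-algebra, while for \<open>dilation_ideal U\<close> a quotient norm has to be
  handled, and its kernel is J only if J is closed.\<close>

locale closed_star_ideal = star_ideal +
  assumes closed_J: "closed J"
begin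

text \<open>The quotient norm, taken on representatives, so that it is a seminorm on
  operators.\<close>

definition qnorm :: "('a \<Rightarrow>\<^sub>L 'a) \<Rightarrow> real"
  where "qnorm A = infdist A J"

lemma qnorm_nonneg: "0 \<le> qnorm A"
  by (simp add: qnorm_def infdist_nonneg)

lemma qnorm_le: "j \<in> J \<Longrightarrow> qnorm A \<le> norm (A - j)"
  using infdist_le[of j J A] by (simp add: qnorm_def dist_norm)

lemma qnorm_le_norm: "qnorm A \<le> norm A"
  using qnorm_le[OF J_zero, of A] by simp

lemma qnorm_less:
  assumes "qnorm A < e"
  obtains j where "j \<in> J" "norm (A - j) < e"
proof -
  have "(INF j\<in>J. dist A j) < e"
    using assms J_zero by (auto simp: qnorm_def infdist_def split: if_splits)
  then obtain j where "j \<in> J" "dist A j < e"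
    using J_zero by (subst (asm) cINF_less_iff) auto
  then show ?thesis using that by (simp add: dist_norm)
qed

lemma qnorm_approx:
  assumes "e > 0"
  shows "\<exists>j\<in>J. norm (A - j) < qnorm A + e"
proof -
  have "qnorm A < qnorm A + e" using assms by simp
  then show ?thesis by (rule qnorm_less) blast
qed

lemma qnorm_leI: "(\<And>e. e > 0 \<Longrightarrow> \<exists>j\<in>J. norm (A - j) \<le> r + e) \<Longrightarrow> qnorm A \<le> r"
  by (rule field_le_epsilon) (meson qnorm_le order_trans)

lemma qnorm_eq_0_iff: "qnorm A = 0 \<longleftrightarrow> A \<in> J"
  using in_closed_iff_infdist_zero[OF closed_J] J_zero by (auto simp: qnorm_def)

lemma qnorm_triangle: "qnorm (A + B) \<le> qnorm A + qnorm B"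
proof (rule qnorm_leI)
  fix e :: real assume "e > 0"
  then obtain j k where "j \<in> J" "norm (A - j) < qnorm A + e / 2" "k \<in> J" "norm (B - k) < qnorm B + e / 2"
    using qnorm_approx[of "e / 2" A] qnorm_approx[of "e / 2" B] half_gt_zero by blast
  then show "\<exists>j\<in>J. norm (A + B - j) \<le> qnorm A + qnorm B + e"
    using norm_triangle_ineq[of "A - j" "B - k"] by (intro bexI[of _ "j + k"]) (auto simp: J_add algebra_simps)
qed

lemma qnorm_cong:
  assumes "A - B \<in> J"
  shows "qnorm A = qnorm B"
proof -
  have "qnorm (A - B) = 0" "qnorm (B - A) = 0"
    using assms J_diff_commute[OF assms] by (simp_all add: qnorm_eq_0_iff)
  then show ?thesis using qnorm_triangle[of B "A - B"] qnorm_triangle[of A "B - A"] by simp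
qed

lemma qnorm_scaleC: "qnorm (scaleC_op c A) = cmod c * qnorm A"
proof -
  have le: "qnorm (scaleC_op c A) \<le> cmod c * qnorm A" for c A
  proof (rule qnorm_leI)
    fix e :: real assume "e > 0"
    then have "e / (cmod c + 1) > 0" by (intro divide_pos_pos add_nonneg_pos) simp_all
    then obtain j where j: "j \<in> J" "norm (A - j) < qnorm A + e / (cmod c + 1)"
      using qnorm_approx by blast
    have "norm (scaleC_op c A - scaleC_op c j) = cmod c * norm (A - j)"
      using scaleC_op_add[of c "A - j" j] by (simp add: norm_scaleC_op[symmetric])
    also have "\<dots> \<le> cmod c * (qnorm A + e / (cmod c + 1))"
      using j by (intro mult_left_mono) auto
    also have "\<dots> \<le> cmod c * qnorm A + e"
    proof -
      have "cmod c * (e / (cmod c + 1)) = e * (cmod c / (cmod c + 1))" by simp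
      also have "\<dots> \<le> e * 1"
        using \<open>e > 0\<close> norm_ge_zero[of c] by (intro mult_left_mono) (auto simp: divide_le_eq_1 add_nonneg_pos)
      finally show ?thesis by (simp add: distrib_left)
    qed
    finally show "\<exists>j\<in>J. norm (scaleC_op c A - j) \<le> cmod c * qnorm A + e"
      using J_scaleC[OF j(1)] by blast
  qed
  show ?thesis
  proof (cases "c = 0")
    case False
    have "qnorm A \<le> qnorm (scaleC_op c A) / cmod c"
      using le[of "1 / c" "scaleC_op c A"] False by (simp add: scaleC_op_scaleC_op norm_divide)
    then show ?thesis using le[of c A] False by (simp add: field_simps)
  qed (simp add: qnorm_eq_0_iff J_zero)
qed

lemma qnorm_uminus: "qnorm (- A) = qnorm A"
  using qnorm_scaleC[of "-1" A] by (simp add: scaleC_op_minus1)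

lemma qnorm_minus_commute: "qnorm (A - B) = qnorm (B - A)"
  using qnorm_uminus[of "A - B"] by simp

lemma qnorm_compose:
  assumes "A \<in> T" "B \<in> T"
  shows "qnorm (A o\<^sub>L B) \<le> qnorm A * qnorm B"
proof -
  have *: "qnorm (A o\<^sub>L B) \<le> (qnorm A + e) * (qnorm B + e)" if "e > 0" for e
  proof -
    obtain j k where j: "j \<in> J" "norm (A - j) < qnorm A + e" and k: "k \<in> J" "norm (B - k) < qnorm B + e"
      using qnorm_approx[OF \<open>e > 0\<close>] by blast
    have "(A o\<^sub>L B) - ((A - j) o\<^sub>L (B - k)) \<in> J"
      using assms j k by (intro diff_compose_mem) (auto simp: mems J_T)
    then have "qnorm (A o\<^sub>L B) = qnorm ((A - j) o\<^sub>L (B - k))" by (rule qnorm_cong)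
    also have "\<dots> \<le> norm (A - j) * norm (B - k)"
      using qnorm_le_norm norm_blinfun_compose order_trans by blast
    also have "\<dots> \<le> (qnorm A + e) * (qnorm B + e)"
      using j k \<open>e > 0\<close> qnorm_nonneg[of A] by (intro mult_mono) auto
    finally show ?thesis .
  qed
  have "((\<lambda>e. (qnorm A + e) * (qnorm B + e)) \<longlongrightarrow> (qnorm A + 0) * (qnorm B + 0)) (at_right 0)"
    by (intro tendsto_intros)
  then show ?thesis
    using * by (intro tendsto_lowerbound[where F = "at_right 0"])
      (auto simp: eventually_at_right_less intro: eventually_mono[OF eventually_at_right_less])
qed

lemma qnorm_adj:
  assumes "A \<in> T"
  shows "qnorm (adj A) = qnorm A"
proof -
  have le: "qnorm (adj A) \<le> qnorm A" if "A \<in> T" for A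
  proof (rule qnorm_leI)
    fix e :: real assume "e > 0"
    then obtain j where j: "j \<in> J" "norm (A - j) < qnorm A + e"
      using qnorm_approx by blast
    then have "norm (adj A - adj j) = norm (A - j)"
      using that by (simp add: adj_diff[symmetric] clin J_T norm_adj_compose_self clinear_diff)
    then show "\<exists>k\<in>J. norm (adj A - k) \<le> qnorm A + e"
      using j J_adj by (intro bexI[of _ "adj j"]) auto
  qed
  show ?thesis
    using le[OF assms] le[OF adj_mem[OF assms]] assms by (simp add: clin)
qed

text \<open>The elements \<open>1 - (1 - k\<^sup>2)\<^sup>n\<close> serve as an approximate unit at \<open>k \<in> J\<close>.\<close>

lemma qnorm_adj_compose_self:
  assumes A: "A \<in> T"
  shows "qnorm (adj A o\<^sub>L A) = (qnorm A)\<^sup>2"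
proof (rule antisym)
  show "qnorm (adj A o\<^sub>L A) \<le> (qnorm A)\<^sup>2"
    using qnorm_compose[of "adj A" A] A by (simp add: qnorm_adj mems power2_eq_square)
  show "(qnorm A)\<^sup>2 \<le> qnorm (adj A o\<^sub>L A)"
  proof (rule dense_ge)
    fix t assume "qnorm (adj A o\<^sub>L A) < t"
    then obtain j where j: "j \<in> J" "norm ((adj A o\<^sub>L A) - j) < t" by (rule qnorm_less)
    have cA: "clinear_op A" "clinear_op j" using A j clin J_T by auto
    define S where "S = adj A o\<^sub>L A"
    have S: "adj S = S" "clinear_op S" using cA by (auto simp: S_def adj_compose clinear_intros)
    \<comment> \<open>adj A A is self-adjoint, so replacing j by its self-adjoint part does not
      increase the distance.\<close>
    define k where "k = (1/2) *\<^sub>R (j + adj j)"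
    have k: "k \<in> J" "adj k = k" "clinear_op k"
      using j cA by (auto simp: k_def adj_scaleR adj_add J_add J_adj J_scaleR clinear_intros add.commute)
    have "S - k = (1/2) *\<^sub>R ((S - j) + adj (S - j))"
      using S cA scaleR_2[of S] by (simp add: k_def adj_diff algebra_simps flip: scaleR_add_left)
    also have "norm \<dots> \<le> (1/2) * (norm (S - j) + norm (adj (S - j)))"
      by (simp add: norm_triangle_ineq)
    also have "\<dots> = norm (S - j)"
      using S cA by (simp add: norm_adj_compose_self clinear_diff)
    finally have Sk: "norm (S - k) \<le> t" using j by (simp add: S_def)
    \<comment> \<open>Scaling by 1 / c makes \<open>k'\<close> a contraction; the summand 1 keeps c
      positive when k = 0.\<close>
    define c where "c = norm k + 1"
    have c: "c > 0" unfolding c_def by (intro add_nonneg_pos) auto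
    define k' where "k' = (1/c) *\<^sub>R k"
    have k': "k' \<in> J" "adj k' = k'" "clinear_op k'" "norm k' \<le> 1"
      using k c by (auto simp: k'_def J_scaleR adj_scaleR clinear_intros) (simp add: c_def)
    define D where "D = id_blinfun - (k' o\<^sub>L k')"
    define E where "E n = oppow D n" for n
    have DT: "D \<in> T" using k' J_T by (simp add: D_def mems)
    have aD: "adj D = D" using k' by (simp add: D_def adj_diff adj_compose clinear_intros)
    have comm: "oppow D n o\<^sub>L D = D o\<^sub>L oppow D n" for n
      by (induction n) (auto simp: blinfun_compose_assoc)
    have aE: "adj (E n) = E n" for n
    proof (unfold E_def, induction n)
      case (Suc n)
      then show ?case using DT clin oppow_mem[OF DT] by (simp add: adj_compose aD comm)
    qed simp
    have ET: "E n \<in> T" for n unfolding E_def by (rule oppow_mem[OF DT])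
    have E1: "norm (E n) \<le> 1" and E2: "sqrt (real n) * norm (k' o\<^sub>L E n) \<le> 1" for n
      unfolding E_def D_def by (rule norm_power_one_minus_square[OF k'(3,2,4)])+
    have EJ: "id_blinfun - E n \<in> J" for n
    proof (unfold E_def, induction n)
      case (Suc n)
      have "id_blinfun - D \<in> J" using k' by (simp add: D_def J_left J_T)
      then have "(id_blinfun o\<^sub>L id_blinfun) - (D o\<^sub>L oppow D n) \<in> J"
        using Suc DT by (intro diff_compose_mem) (auto simp: mems)
      then show ?case by simp
    qed (simp add: J_zero)
    \<comment> \<open>Multiplication by \<open>E n\<close> leaves the coset of A unchanged and
      nearly annihilates k, so the square of |A E| is |E (adj A A) E|, where adj A A is within t of
      k.\<close>
    have bound: "(qnorm A)\<^sup>2 \<le> t + c / sqrt (real n)" if "n > 0" for n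
    proof -
      have "(A o\<^sub>L id_blinfun) - (A o\<^sub>L E n) \<in> J"
        using A EJ by (intro diff_compose_mem) (auto simp: mems J_zero)
      then have "qnorm A = qnorm (A o\<^sub>L E n)" by (intro qnorm_cong) simp
      then have "(qnorm A)\<^sup>2 \<le> (norm (A o\<^sub>L E n))\<^sup>2"
        using qnorm_le_norm qnorm_nonneg by (simp add: power_mono)
      also have "\<dots> = norm (adj (A o\<^sub>L E n) o\<^sub>L (A o\<^sub>L E n))"
        using A ET by (intro norm_adj_compose_self(1)[symmetric]) (auto simp: mems clin)
      also have "adj (A o\<^sub>L E n) o\<^sub>L (A o\<^sub>L E n) = E n o\<^sub>L (S o\<^sub>L E n)"
        using A ET by (simp add: adj_compose clin aE S_def blinfun_compose_assoc)
      also have "\<dots> = (E n o\<^sub>L ((S - k) o\<^sub>L E n)) + (E n o\<^sub>L (k o\<^sub>L E n))"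
        by (simp add: compose_diff_left compose_diff_right)
      also have "norm \<dots> \<le> norm (E n) * (norm (S - k) * norm (E n)) + norm (E n) * norm (k o\<^sub>L E n)"
        by (intro order_trans[OF norm_triangle_ineq] add_mono order_trans[OF norm_blinfun_compose]
            mult_left_mono norm_blinfun_compose) auto
      also have "\<dots> \<le> 1 * (t * 1) + 1 * norm (k o\<^sub>L E n)"
        using E1 Sk order_trans[OF norm_ge_zero Sk] by (intro add_mono mult_mono) auto
      also have "norm (k o\<^sub>L E n) = c * norm (k' o\<^sub>L E n)"
        using c by (simp add: k'_def compose_scaleR_left)
      also have "\<dots> \<le> c * (1 / sqrt (real n))"
        using E2[of n] c that by (intro mult_left_mono) (auto simp: field_simps)
      finally show ?thesis by simp
    qed
    have "(\<lambda>n. t + c / sqrt (real n)) \<longlonglongrightarrow> t + 0"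
      by (rule tendsto_add[OF tendsto_const real_tendsto_divide_at_top[OF tendsto_const
          filterlim_compose[OF sqrt_at_top filterlim_real_sequentially]]])
    then have "(qnorm A)\<^sup>2 \<le> t + 0"
      by (rule LIMSEQ_le_const) (use bound in \<open>auto intro!: exI[of _ 1]\<close>)
    then show "(qnorm A)\<^sup>2 \<le> t" by simp
  qed
qed

text \<open>Along a fast subsequence each difference is corrected by an element of J to operator
  norm below 2^-k. The corrected differences are summable in T, and their sum gives the
  limit.\<close>

lemma quotient_complete:
  fixes b :: "nat \<Rightarrow> 'a \<Rightarrow>\<^sub>L 'a"
  assumes b: "\<And>n. b n \<in> T" and Cauchy: "\<And>e. e > 0 \<Longrightarrow> \<exists>N. \<forall>i\<ge>N. \<forall>j\<ge>N. qnorm (b i - b j) < e"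
  obtains c where "c \<in> T" "(\<lambda>n. qnorm (b n - c)) \<longlonglongrightarrow> 0"
proof -
  have "\<exists>N. \<forall>i\<ge>N. \<forall>j\<ge>N. qnorm (b i - b j) < (1/2)^k" for k :: nat
    by (rule Cauchy) simp
  then obtain M where M: "\<And>k i j. i \<ge> M k \<Longrightarrow> j \<ge> M k \<Longrightarrow> qnorm (b i - b j) < (1/2)^k" by metis
  \<comment> \<open>Partial sums of \<open>M\<close> are monotone and dominate every
    \<open>M k\<close>, so neighbouring terms of the subsequence are within (1/2)^k.\<close>
  define r where "r k = (\<Sum>l\<le>k. M l)" for k
  have rM: "M k \<le> r k" "r k \<le> r (Suc k)" for k
    by (auto simp: r_def intro: member_le_sum)
  have "\<exists>j\<in>J. norm (b (r (Suc k)) - b (r k) - j) < (1/2)^k" for k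
    using qnorm_less[OF M[OF order_trans[OF rM] rM(1), of k]] by blast
  then obtain j where j: "\<And>k. j k \<in> J" "\<And>k. norm (b (r (Suc k)) - b (r k) - j k) < (1/2)^k" by metis
  define d where "d k = b (r (Suc k)) - b (r k) - j k" for k
  have dT: "d k \<in> T" for k using j b J_T by (auto simp: d_def mems)
  have sd: "summable d"
    by (rule summable_comparison_test[of _ "\<lambda>k. (1/2)^k"])
      (use j in \<open>auto simp: d_def intro!: summable_geometric less_imp_le\<close>)
  define c where "c = b (r 0) + suminf d"
  have "suminf d \<in> T"
    by (rule closed_sequentially[OF closed_T _ summable_LIMSEQ[OF sd]]) (auto intro: sum_mem dT)
  then have cT: "c \<in> T" using b by (simp add: c_def mems)
  \<comment> \<open>The lifted partial sums differ from the subsequence only by the accumulated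
    corrections in J.\<close>
  have part: "b (r k) - (b (r 0) + (\<Sum>l<k. d l)) \<in> J" for k
  proof (induction k)
    case (Suc k)
    have "b (r (Suc k)) - (b (r 0) + (\<Sum>l<Suc k. d l)) = (b (r k) - (b (r 0) + (\<Sum>l<k. d l))) + j k"
      by (simp add: d_def)
    then show ?case using Suc j(1) J_add by metis
  qed (simp add: J_zero)
  have lim_r: "(\<lambda>k. qnorm (b (r k) - c)) \<longlonglongrightarrow> 0"
  proof (rule tendsto_sandwich[OF _ _ tendsto_const])
    have "(\<lambda>k. (\<Sum>l<k. d l) - suminf d) \<longlonglongrightarrow> suminf d - suminf d"
      by (intro tendsto_intros summable_LIMSEQ sd)
    then show "(\<lambda>k. norm ((\<Sum>l<k. d l) - suminf d)) \<longlonglongrightarrow> 0" by (simp add: tendsto_norm_zero)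
    have "qnorm (b (r k) - c) = qnorm ((\<Sum>l<k. d l) - suminf d)" for k
      using part[of k] by (intro qnorm_cong) (simp add: c_def algebra_simps)
    then show "\<forall>\<^sub>F k in sequentially. qnorm (b (r k) - c) \<le> norm ((\<Sum>l<k. d l) - suminf d)"
      by (simp add: qnorm_le_norm)
  qed (simp add: qnorm_nonneg)
  have "(\<lambda>n. qnorm (b n - c)) \<longlonglongrightarrow> 0"
  proof (rule LIMSEQ_I)
    fix e :: real assume "e > 0"
    then obtain k0 where k0: "\<And>k. k \<ge> k0 \<Longrightarrow> qnorm (b (r k) - c) < e / 2"
      using LIMSEQ_D[OF lim_r, of "e / 2"] qnorm_nonneg by auto
    obtain k1 where k1: "(1/2)^k1 < e / 2"
      using real_arch_pow_inv[of "e / 2" "1/2"] \<open>e > 0\<close> by auto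
    define k where "k = max k0 k1"
    have "(1/2::real)^k \<le> (1/2)^k1" by (rule power_decreasing) (auto simp: k_def)
    then have k: "qnorm (b (r k) - c) < e / 2" "(1/2::real)^k < e / 2"
      using k0[of k] order.strict_trans1[OF _ k1] by (simp_all add: k_def)
    have "norm (qnorm (b n - c) - 0) < e" if "n \<ge> M k" for n
      using qnorm_triangle[of "b n - b (r k)" "b (r k) - c"] M[OF that rM(1)] k qnorm_nonneg[of "b n - c"]
      by simp
    then show "\<exists>N. \<forall>n\<ge>N. norm (qnorm (b n - c) - 0) < e" by blast
  qed
  with cT show ?thesis by (rule that)
qed

end

section \<open>Tensor products of operators\<close>

lemma tensor_vec_add_left: "tensor_vec (f + g) y = tensor_vec f y + tensor_vec g y"
  by transfer (simp add: scaleC_add_left)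

lemma tensor_vec_scaleC_left: "tensor_vec (c *\<^sub>C f) y = c *\<^sub>C tensor_vec f y"
  by transfer (simp add: scaleC_scaleC scaleC_complex_def)

lemma tensor_vec_scaleR_left: "tensor_vec (r *\<^sub>R f) y = r *\<^sub>R tensor_vec f y"
  by (simp add: tensor_vec_scaleC_left flip: scaleC_of_real)

lemma norm_tensor_vec: "norm (tensor_vec f y) = norm f * norm y"
proof -
  have "complex_of_real ((norm (tensor_vec f y))\<^sup>2) = complex_of_real ((norm f * norm y)\<^sup>2)"
    unfolding cinner_self[symmetric] cinner_tensor_vec by (simp add: cinner_self power_mult_distrib)
  then show ?thesis unfolding of_real_eq_iff by (simp add: power2_eq_iff_nonneg)
qed

lemma blinfun_eq_on_tensors:
  fixes R S :: "('a, 'b::chilbert_space) ell2 \<Rightarrow>\<^sub>L 'c::real_normed_vector"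
  assumes "\<And>f y. R (tensor_vec f y) = S (tensor_vec f y)"
  shows "R = S"
proof -
  let ?Z = "{x. (R - S) x = 0}"
  have "span (range (\<lambda>(f, y). tensor_vec f y)) \<subseteq> ?Z"
  proof (rule span_minimal)
    show "subspace ?Z" by (auto simp: subspace_def blinfun.add_right blinfun.scaleR_right)
  qed (auto simp: assms blinfun.diff_left)
  moreover have "closed ?Z" by (intro closed_Collect_eq continuous_intros)
  ultimately have "closure (span (range (\<lambda>(f, y). tensor_vec f y))) \<subseteq> ?Z" by (rule closure_minimal)
  then have "(R - S) x = 0" for x unfolding tensor_vec_dense by auto
  then show ?thesis by (intro blinfun_eqI) (simp add: blinfun.diff_left)
qed

text \<open>The partial map is given by its graph, so it need not be shown well defined beforehand:
  the norm bound passes to the closure of D and makes that closure the graph of an everywhere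
  defined bounded map.\<close>

lemma bounded_extension:
  fixes D :: "('a::banach \<times> 'b::banach) set"
  assumes D: "subspace D" and dense: "closure (fst ` D) = UNIV"
    and bound: "\<And>u v. (u, v) \<in> D \<Longrightarrow> norm v \<le> C * norm u"
  obtains R :: "'a \<Rightarrow>\<^sub>L 'b" where "\<And>u v. (u, v) \<in> D \<Longrightarrow> R u = v"
proof -
  let ?G = "closure D"
  have sub: "subspace ?G"
    unfolding subspace_def
  proof (intro conjI ballI allI)
    show "0 \<in> ?G" using subspace_0[OF D] closure_subset by blast
  next
    fix x y assume "x \<in> ?G" "y \<in> ?G"
    then obtain X Y where "\<And>n. X n \<in> D" "X \<longlonglongrightarrow> x" "\<And>n. Y n \<in> D" "Y \<longlonglongrightarrow> y"
      unfolding closure_sequential by blast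
    then show "x + y \<in> ?G"
      unfolding closure_sequential
      by (intro exI[of _ "\<lambda>n. X n + Y n"]) (auto intro: subspace_add[OF D] tendsto_add)
  next
    fix c x assume "x \<in> ?G"
    then obtain X where "\<And>n. X n \<in> D" "X \<longlonglongrightarrow> x" unfolding closure_sequential by blast
    then show "c *\<^sub>R x \<in> ?G"
      unfolding closure_sequential
      by (intro exI[of _ "\<lambda>n. c *\<^sub>R X n"]) (auto intro: subspace_scale[OF D] tendsto_scaleR)
  qed
  have "closed {p :: 'a \<times> 'b. norm (snd p) \<le> C * norm (fst p)}"
    by (intro closed_Collect_le continuous_intros)
  moreover have "D \<subseteq> {p. norm (snd p) \<le> C * norm (fst p)}" using bound by auto
  ultimately have "?G \<subseteq> {p. norm (snd p) \<le> C * norm (fst p)}" by (intro closure_minimal)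
  then have bound': "norm v \<le> C * norm u" if "(u, v) \<in> ?G" for u v using that by auto
  have unique: "v = w" if "(u, v) \<in> ?G" "(u, w) \<in> ?G" for u v w
    using bound'[of 0 "v - w"] subspace_diff[OF sub that] by simp
  have "\<exists>v. (u, v) \<in> ?G" for u
  proof -
    have "u \<in> closure (fst ` D)" using dense by simp
    then obtain U where U: "\<And>n. U n \<in> fst ` D" "U \<longlonglongrightarrow> u" unfolding closure_sequential by blast
    then have "\<exists>v. (U n, v) \<in> D" for n by force
    then obtain V where V: "\<And>n. (U n, V n) \<in> D" by metis
    have VU: "norm (V m - V n) \<le> C * norm (U m - U n)" for m n
      using bound subspace_diff[OF D V[of m] V[of n]] by simp
    \<comment> \<open>Replaces C, whose sign is unknown, by a positive constant.\<close>
    have VU': "norm (V m - V n) \<le> (\<bar>C\<bar> + 1) * norm (U m - U n)" for m n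
      by (rule order_trans[OF VU]) (intro mult_right_mono, auto)
    have "Cauchy V"
    proof (rule CauchyI)
      fix e :: real assume "e > 0"
      then have "e / (\<bar>C\<bar> + 1) > 0" by (intro divide_pos_pos) auto
      then obtain M where M: "\<forall>m\<ge>M. \<forall>n\<ge>M. norm (U m - U n) < e / (\<bar>C\<bar> + 1)"
        using CauchyD[OF LIMSEQ_imp_Cauchy[OF U(2)]] by blast
      have "norm (V m - V n) < e" if "m \<ge> M" "n \<ge> M" for m n
      proof -
        have "(\<bar>C\<bar> + 1) * norm (U m - U n) < (\<bar>C\<bar> + 1) * (e / (\<bar>C\<bar> + 1))"
          using M that by (intro mult_strict_left_mono) auto
        then show ?thesis using VU'[of m n] by simp
      qed
      then show "\<exists>M. \<forall>m\<ge>M. \<forall>n\<ge>M. norm (V m - V n) < e" by blast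
    qed
    then obtain v where "V \<longlonglongrightarrow> v" using Cauchy_convergent convergent_def by blast
    then have "(\<lambda>n. (U n, V n)) \<longlonglongrightarrow> (u, v)" using U(2) by (rule tendsto_Pair[rotated])
    then have "(u, v) \<in> ?G" unfolding closure_sequential using V by (intro exI[of _ "\<lambda>n. (U n, V n)"]) auto
    then show ?thesis by blast
  qed
  then obtain r where r: "\<And>u. (u, r u) \<in> ?G" by metis
  have "bounded_linear r"
  proof (rule bounded_linear_intro[where K = C])
    show "r (u + v) = r u + r v" for u v
      using unique[OF r] subspace_add[OF sub r[of u] r[of v]] by simp
    show "r (c *\<^sub>R u) = c *\<^sub>R r u" for c u
      using unique[OF r] subspace_scale[OF sub r[of u], of c] by simp
    show "norm (r u) \<le> norm u * C" for u
      using bound'[OF r[of u]] by (simp add: mult.commute)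
  qed
  moreover have "r u = v" if "(u, v) \<in> D" for u v
    using unique[OF r] that closure_subset[of D] by blast
  ultimately show ?thesis
    by (intro that[of "Blinfun r"]) (simp add: bounded_linear_Blinfun_apply)
qed

lemma clinear_oppow: "clinear_op A \<Longrightarrow> clinear_op (oppow A n)"
  by (induction n) (auto intro: clinear_intros)

lemma oppow_commute: "oppow A n o\<^sub>L A = A o\<^sub>L oppow A n"
  by (induction n) (auto simp: blinfun_compose_assoc)

text \<open>The norm of a sum of elementary tensors depends only on the Gram matrices of the two
  families, and V preserves that of the first.\<close>

lemma norm_sum_tensor_isometry:
  fixes f :: "'i \<Rightarrow> ('a, complex) ell2" and y :: "'i \<Rightarrow> 'b::chilbert_space"
  assumes "clinear_op V" "adj V o\<^sub>L V = id_blinfun"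
  shows "norm (\<Sum>i\<in>F. tensor_vec (blinfun_apply V (f i)) (y i)) = norm (\<Sum>i\<in>F. tensor_vec (f i) (y i))"
    (is "norm ?v = norm ?u")
proof -
  have "cinner (V g) (V h) = cinner g h" for g h
    using arg_cong[OF assms(2), of "\<lambda>A. blinfun_apply A h"] by (simp add: adj assms(1))
  then have "cinner ?v ?v = cinner ?u ?u"
    by (simp add: cinner_sum_left cinner_sum_right cinner_tensor_vec)
  then show ?thesis unfolding cinner_self of_real_eq_iff by (simp add: power2_eq_iff_nonneg)
qed

lemma tensor_id_isometry_exists:
  fixes A :: "('a, complex) ell2 \<Rightarrow>\<^sub>L ('a, complex) ell2"
  assumes A: "clinear_op A" "adj A o\<^sub>L A = id_blinfun"
  obtains R :: "('a, 'b::chilbert_space) ell2 \<Rightarrow>\<^sub>L ('a, 'b) ell2"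
  where "\<And>f y. R (tensor_vec f y) = tensor_vec (A f) y"
proof -
  define g :: "('a, complex) ell2 \<times> 'b \<Rightarrow> ('a, 'b) ell2 \<times> ('a, 'b) ell2"
    where "g = (\<lambda>(f, y). (tensor_vec f y, tensor_vec (A f) y))"
  let ?D = "span (range g)"
  have "fst ` ?D = span (fst ` range g)"
    by (rule linear_span_image[OF bounded_linear.linear[OF bounded_linear_fst], symmetric])
  also have "fst ` range g = range (\<lambda>(f, y). tensor_vec f y)"
    by (auto simp: g_def image_comp o_def split_def)
  finally have dense: "closure (fst ` ?D) = UNIV" by (simp add: tensor_vec_dense)
  have bound: "norm v \<le> 1 * norm u" if uv: "(u, v) \<in> ?D" for u v
  proof -
    obtain t r where t: "finite t" "t \<subseteq> range g" "(u, v) = (\<Sum>a\<in>t. r a *\<^sub>R a)"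
      using uv unfolding span_explicit by blast
    \<comment> \<open>A span element is a finite real combination of pairs. \<open>inv_into\<close>
      chooses factors for each pair, and the scalar is absorbed into the first factor.\<close>
    define F where "F a = r a *\<^sub>R fst (inv_into UNIV g a)" for a
    define Y where "Y a = snd (inv_into UNIV g a)" for a
    have "a = (tensor_vec (fst (inv_into UNIV g a)) (Y a), tensor_vec (A (fst (inv_into UNIV g a))) (Y a))" if "a \<in> t" for a
    proof -
      have "g (inv_into UNIV g a) = a" using that t(2) by (intro f_inv_into_f) auto
      then show ?thesis by (simp add: g_def Y_def split_def)
    qed
    note * = this
    have "r a *\<^sub>R a = (tensor_vec (F a) (Y a), tensor_vec (A (F a)) (Y a))" if "a \<in> t" for a
      by (subst *[OF that]) (simp add: F_def blinfun.scaleR_right tensor_vec_scaleR_left)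
    then have "(u, v) = (\<Sum>a\<in>t. (tensor_vec (F a) (Y a), tensor_vec (A (F a)) (Y a)))"
      using t(3) by simp
    then have "u = (\<Sum>a\<in>t. tensor_vec (F a) (Y a))" "v = (\<Sum>a\<in>t. tensor_vec (A (F a)) (Y a))"
      by (simp_all add: sum_prod)
    then show ?thesis using norm_sum_tensor_isometry[OF A, where f = F and y = Y and F = t] by simp
  qed
  obtain R where R: "\<And>u v. (u, v) \<in> ?D \<Longrightarrow> blinfun_apply R u = v"
    using bounded_extension[OF subspace_span dense bound] by blast
  have "R (tensor_vec f y) = tensor_vec (A f) y" for f y
    by (rule R, rule span_base) (auto simp: g_def intro!: image_eqI[of _ _ "(f, y)"])
  then show ?thesis by (rule that)
qed

text \<open>Every operator is a linear combination of unitaries, so that it suffices to extend isometries.\<close>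

lemma tensor_id_exists:
  fixes A :: "('a, complex) ell2 \<Rightarrow>\<^sub>L ('a, complex) ell2"
  assumes A: "clinear_op A"
  obtains R :: "('a, 'b::chilbert_space) ell2 \<Rightarrow>\<^sub>L ('a, 'b) ell2"
  where "\<And>f y. R (tensor_vec f y) = tensor_vec (A f) y"
proof -
  interpret L: cstar_ops "{A :: ('a, complex) ell2 \<Rightarrow>\<^sub>L ('a, complex) ell2. clinear_op A}"
    by unfold_locales (auto intro: clinear_intros closed_clinear)
  define P where "P A \<longleftrightarrow> (\<exists>R :: ('a, 'b) ell2 \<Rightarrow>\<^sub>L ('a, 'b) ell2. \<forall>f y. R (tensor_vec f y) = tensor_vec (blinfun_apply A f) y)" for A
  have add: "P (B + C)" if "P B" "P C" for B C
  proof -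
    obtain R S :: "('a, 'b) ell2 \<Rightarrow>\<^sub>L ('a, 'b) ell2" where
      "\<forall>f y. R (tensor_vec f y) = tensor_vec (B f) y" "\<forall>f y. S (tensor_vec f y) = tensor_vec (C f) y"
      using \<open>P B\<close> \<open>P C\<close> unfolding P_def by blast
    then show ?thesis
      unfolding P_def by (intro exI[of _ "R + S"]) (simp add: blinfun.add_left tensor_vec_add_left)
  qed
  have scale: "P (scaleC_op c B)" if "P B" for c B
  proof -
    obtain R :: "('a, 'b) ell2 \<Rightarrow>\<^sub>L ('a, 'b) ell2" where "\<forall>f y. R (tensor_vec f y) = tensor_vec (B f) y"
      using \<open>P B\<close> unfolding P_def by blast
    then show ?thesis
      unfolding P_def by (intro exI[of _ "scaleC_op c R"]) (simp add: scaleC_op.rep_eq tensor_vec_scaleC_left)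
  qed
  have isometry: "P w" if "clinear_op w" "adj w o\<^sub>L w = id_blinfun" for w
    using tensor_id_isometry_exists[OF that] unfolding P_def by blast
  have selfadj: "P h" if h: "clinear_op h" "adj h = h" for h
  proof -
    \<comment> \<open>Makes h / t a strict contraction, as the averaging lemma demands, also when h
      = 0.\<close>
    define t where "t = norm h + 1"
    have t: "t > 0" unfolding t_def by (intro add_nonneg_pos) auto
    obtain w where w: "clinear_op w" "adj w o\<^sub>L w = id_blinfun" "w o\<^sub>L adj w = id_blinfun"
      "(1 / t) *\<^sub>R h = (1/2) *\<^sub>R (w + adj w)"
      using L.selfadjoint_eq_average_of_unitary[of "(1 / t) *\<^sub>R h"] h t
      by (auto simp: adj_scaleR clinear_scaleR) (auto simp: t_def)
    have "h = (t / 2) *\<^sub>R (w + adj w)"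
      using arg_cong[OF w(4), of "\<lambda>x. t *\<^sub>R x"] t by simp
    then have "h = scaleC_op (complex_of_real (t / 2)) (w + adj w)" by (simp only: scaleC_op_of_real)
    moreover have "P (w + adj w)" using w by (intro add isometry) simp_all
    ultimately show ?thesis using scale by metis
  qed
  have "P (A + adj A)" using A by (intro selfadj) (simp_all add: clinear_add adj_add add.commute)
  moreover have "P (scaleC_op \<i> (A - adj A))"
  proof (rule selfadj)
    have "adj (scaleC_op \<i> (A - adj A)) = scaleC_op \<i> (scaleC_op (-1) (adj A - A))"
      using A by (simp add: adj_scaleC adj_diff clinear_diff scaleC_op_scaleC_op)
    then show "adj (scaleC_op \<i> (A - adj A)) = scaleC_op \<i> (A - adj A)" by (simp add: scaleC_op_minus1)
  qed (use A in \<open>simp add: clinear_intros\<close>)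
  \<comment> \<open>Decomposition into real and imaginary parts, both rescaled to the self-adjoint
    operators A + adj A and \<i> (A - adj A).\<close>
  ultimately have "P (scaleC_op (1/2) (A + adj A) + scaleC_op (- \<i> / 2) (scaleC_op \<i> (A - adj A)))"
    by (rule add[OF scale scale])
  also have "scaleC_op (1/2) (A + adj A) + scaleC_op (- \<i> / 2) (scaleC_op \<i> (A - adj A)) = scaleC_op (1/2) (A + A)"
    by (simp add: scaleC_op_scaleC_op flip: scaleC_op_add)
  also have "\<dots> = A" using scaleC_op_of_real[of "1/2" "A + A"] by (simp add: scaleR_2[symmetric])
  finally show ?thesis using that unfolding P_def by blast
qed

text \<open>This is 1 tensor B. In the model of square-summable K-valued families it acts
  coordinatewise, so unlike A tensor 1 it needs no extension by density.\<close>

lift_definition pointwise_op :: "('b::chilbert_space \<Rightarrow>\<^sub>L 'b) \<Rightarrow> ('a, 'b) ell2 \<Rightarrow> ('a, 'b) ell2"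
  is "\<lambda>B g x. blinfun_apply B (g x)"
proof (rule summable_on_comparison_test)
  fix B :: "'b \<Rightarrow>\<^sub>L 'b" and g :: "'a \<Rightarrow> 'b" and x
  assume "(\<lambda>x. (norm (g x))\<^sup>2) summable_on UNIV"
  then show "(\<lambda>x. (norm B)\<^sup>2 * (norm (g x))\<^sup>2) summable_on UNIV" by (rule summable_on_cmult_right)
  show "(norm (B (g x)))\<^sup>2 \<le> (norm B)\<^sup>2 * (norm (g x))\<^sup>2"
    using power_mono[OF norm_blinfun[of B "g x"], of 2] by (simp add: power_mult_distrib)
qed simp

lemma bounded_linear_pointwise_op:
  fixes B :: "'b::chilbert_space \<Rightarrow>\<^sub>L 'b"
  shows "bounded_linear (pointwise_op B :: ('a, 'b) ell2 \<Rightarrow> ('a, 'b) ell2)"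
proof (rule bounded_linear_intro[where K = "norm B"])
  fix g h :: "('a, 'b) ell2" and r :: real
  show "pointwise_op B (g + h) = pointwise_op B g + pointwise_op B h"
    by transfer (simp add: blinfun.add_right)
  show "pointwise_op B (r *\<^sub>R g) = r *\<^sub>R pointwise_op B g"
    by transfer (simp add: blinfun.scaleR_right)
  have "(norm (pointwise_op B g))\<^sup>2 \<le> (norm B)\<^sup>2 * (norm g)\<^sup>2"
    unfolding ell2_norm_power2 pointwise_op.rep_eq
  proof (subst infsum_cmult_right'[symmetric], rule infsum_mono)
    show "(\<lambda>x. (norm (B (ell2_fun g x)))\<^sup>2) summable_on UNIV"
      using ell2_fun[of "pointwise_op B g"] by (simp add: pointwise_op.rep_eq)
    show "(\<lambda>x. (norm B)\<^sup>2 * (norm (ell2_fun g x))\<^sup>2) summable_on UNIV"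
      using ell2_fun[of g] by (intro summable_on_cmult_right) simp
    show "(norm (B (ell2_fun g x)))\<^sup>2 \<le> (norm B)\<^sup>2 * (norm (ell2_fun g x))\<^sup>2" for x
      using power_mono[OF norm_blinfun[of B "ell2_fun g x"], of 2] by (simp add: power_mult_distrib)
  qed
  then have "(norm (pointwise_op B g))\<^sup>2 \<le> (norm g * norm B)\<^sup>2" by (simp add: power_mult_distrib mult.commute)
  then show "norm (pointwise_op B g) \<le> norm g * norm B" by (rule power2_le_imp_le) simp
qed

text \<open>Existence comes from factoring A tensor B as (A tensor 1)(1 tensor B), uniqueness from
  density; together they resolve the definite description in \<open>op_tensor\<close>.\<close>

lemma op_tensor_apply:
  assumes A: "clinear_op A" and B: "clinear_op B"
  shows "op_tensor A B (tensor_vec f y) = tensor_vec (A f) (B y)"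
proof -
  obtain R :: "('a, 'b) ell2 \<Rightarrow>\<^sub>L ('a, 'b) ell2" where
    R: "\<And>f y. R (tensor_vec f y) = tensor_vec (A f) y"
    using tensor_id_exists[OF A] by blast
  define S where "S = R o\<^sub>L Blinfun (pointwise_op B)"
  have "pointwise_op B (tensor_vec f y) = tensor_vec f (B y)" for f :: "('a, complex) ell2" and y
    using B by transfer (simp add: clinear_opD)
  then have S: "\<forall>f y. S (tensor_vec f y) = tensor_vec (A f) (B y)"
    by (simp add: S_def bounded_linear_Blinfun_apply[OF bounded_linear_pointwise_op] R)
  have "op_tensor A B = S"
    unfolding op_tensor_def
  proof (rule the_equality)
    show "\<forall>f y. S (tensor_vec f y) = tensor_vec (A f) (B y)" by (rule S)
    show "Q = S" if "\<forall>f y. blinfun_apply Q (tensor_vec f y) = tensor_vec (A f) (B y)" for Q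
      by (rule blinfun_eq_on_tensors) (simp add: that S)
  qed
  then show ?thesis using S by simp
qed

lemma op_tensor_eqI:
  assumes "clinear_op A" "clinear_op B" "\<And>f y. blinfun_apply R (tensor_vec f y) = tensor_vec (A f) (B y)"
  shows "op_tensor A B = R"
  by (rule blinfun_eq_on_tensors) (simp add: op_tensor_apply assms)

text \<open>Multiplication by c is itself a bounded real-linear operator, so complex linearity
  becomes an identity of operators that can be tested on elementary tensors.\<close>

lemma clinear_op_tensor: "clinear_op A \<Longrightarrow> clinear_op B \<Longrightarrow> clinear_op (op_tensor A B)"
proof -
  assume A: "clinear_op A" and B: "clinear_op B"
  have sc: "bounded_linear (\<lambda>x. c *\<^sub>C x)" for c :: complex
    by (rule bounded_linear_scaleC_right)
  have "op_tensor A B o\<^sub>L Blinfun (\<lambda>x. c *\<^sub>C x) = Blinfun (\<lambda>x. c *\<^sub>C x) o\<^sub>L op_tensor A B" for c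
  proof (rule blinfun_eq_on_tensors)
    fix f :: "('a, complex) ell2" and y :: 'b
    have "op_tensor A B (c *\<^sub>C tensor_vec f y) = c *\<^sub>C op_tensor A B (tensor_vec f y)"
      by (simp add: op_tensor_apply A B clinear_opD[OF A] flip: tensor_vec_scaleC_left)
    then show "(op_tensor A B o\<^sub>L Blinfun (\<lambda>x. c *\<^sub>C x)) (tensor_vec f y)
        = (Blinfun (\<lambda>x. c *\<^sub>C x) o\<^sub>L op_tensor A B) (tensor_vec f y)"
      by (simp add: bounded_linear_Blinfun_apply bounded_linear_scaleC_right)
  qed
  then have "(op_tensor A B o\<^sub>L Blinfun (\<lambda>x. c *\<^sub>C x)) x = (Blinfun (\<lambda>x. c *\<^sub>C x) o\<^sub>L op_tensor A B) x" for c x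
    by simp
  then show "clinear_op (op_tensor A B)"
    by (simp add: clinear_op_def bounded_linear_Blinfun_apply bounded_linear_scaleC_right)
qed

lemma op_tensor_compose:
  assumes "clinear_op A" "clinear_op B" "clinear_op A'" "clinear_op B'"
  shows "op_tensor A B o\<^sub>L op_tensor A' B' = op_tensor (A o\<^sub>L A') (B o\<^sub>L B')"
  by (rule op_tensor_eqI[symmetric]) (simp_all add: op_tensor_apply assms clinear_compose)

lemma op_tensor_id: "op_tensor id_blinfun id_blinfun = id_blinfun"
  by (rule op_tensor_eqI) simp_all

lemma op_tensor_add_left:
  assumes "clinear_op A" "clinear_op A'" "clinear_op B"
  shows "op_tensor (A + A') B = op_tensor A B + op_tensor A' B"
  by (rule op_tensor_eqI)
    (simp_all add: op_tensor_apply assms clinear_add blinfun.add_left tensor_vec_add_left)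

lemma op_tensor_scaleC_left:
  assumes "clinear_op A" "clinear_op B"
  shows "op_tensor (scaleC_op c A) B = scaleC_op c (op_tensor A B)"
  by (rule op_tensor_eqI)
    (simp_all add: op_tensor_apply assms clinear_scaleC_op scaleC_op.rep_eq tensor_vec_scaleC_left)

lemma op_tensor_zero_left: "clinear_op B \<Longrightarrow> op_tensor 0 B = 0"
  by (rule op_tensor_eqI) (use tensor_vec_scaleC_left[of 0 0] in simp_all)

lemma op_tensor_sum_left:
  assumes "clinear_op B" "\<And>i. i \<in> F \<Longrightarrow> clinear_op (A i)"
  shows "op_tensor (\<Sum>i\<in>F. A i) B = (\<Sum>i\<in>F. op_tensor (A i) B)"
  using assms(2)
  by (induction F rule: infinite_finite_induct)
    (simp_all add: op_tensor_zero_left op_tensor_add_left assms(1) clinear_sum)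

lemma adj_op_tensor:
  assumes A: "clinear_op A" and B: "clinear_op B"
  shows "adj (op_tensor A B) = op_tensor (adj A) (adj B)"
proof (rule blinfun_eq_on_tensors)
  fix g x
  let ?R = "op_tensor A B"
  have R: "clinear_op ?R" using A B by (rule clinear_op_tensor)
  have *: "cinner h (adj ?R (tensor_vec g x)) = cinner h (op_tensor (adj A) (adj B) (tensor_vec g x))" for h
  proof -
    have bl: "bounded_linear (\<lambda>h. cinner h z)" for z :: "('a, 'b) ell2"
      by (rule bounded_linear_intro[where K = "norm z"])
        (auto simp: cinner_add_left norm_cinner_le cinner_scaleC_left scaleR_conv_of_real simp flip: scaleC_of_real)
    define u where "u = adj ?R (tensor_vec g x)"
    define v where "v = op_tensor (adj A) (adj B) (tensor_vec g x)"
    have "cinner (tensor_vec f y) u = cinner (tensor_vec f y) v" for f y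
      by (simp add: u_def v_def adj[OF R, symmetric] op_tensor_apply A B cinner_tensor_vec adj)
    then have "Blinfun (\<lambda>h. cinner h u) = Blinfun (\<lambda>h. cinner h v)"
      by (intro blinfun_eq_on_tensors) (simp add: bounded_linear_Blinfun_apply bl)
    then have "Blinfun (\<lambda>h. cinner h u) h = Blinfun (\<lambda>h. cinner h v) h" by simp
    then show ?thesis by (simp add: bounded_linear_Blinfun_apply bl u_def v_def)
  qed
  then show "adj ?R (tensor_vec g x) = op_tensor (adj A) (adj B) (tensor_vec g x)"
    by (rule cinner_eqI')
qed

section \<open>Integer powers of unitaries\<close>

definition upow :: "('h::chilbert_space \<Rightarrow>\<^sub>L 'h) \<Rightarrow> int \<Rightarrow> ('h \<Rightarrow>\<^sub>L 'h)"
  where "upow U k = (if 0 \<le> k then oppow U (nat k) else oppow (adj U) (nat (- k)))"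

lemma upow_0 [simp]: "upow U 0 = id_blinfun"
  and upow_1 [simp]: "upow U 1 = U"
  by (simp_all add: upow_def)

lemma upow_of_nat: "upow U (int n) = oppow U n"
  by (simp add: upow_def)

lemma upow_neg_of_nat: "upow U (- int n) = oppow (adj U) n"
  by (cases "n = 0") (simp_all add: upow_def)

lemma clinear_upow: "clinear_op U \<Longrightarrow> clinear_op (upow U k)"
  by (simp add: upow_def clinear_oppow)

lemma unitaryD:
  assumes "unitary_op U"
  shows "clinear_op U" "adj U o\<^sub>L U = id_blinfun" "U o\<^sub>L adj U = id_blinfun"
  using assms by (auto simp: unitary_op_def)

lemma upow_plus_one:
  assumes "unitary_op U"
  shows "upow U (k + 1) = U o\<^sub>L upow U k"
proof (cases "0 \<le> k")
  case True
  then obtain n where "k = int n" using nonneg_int_cases by blast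
  then have "k + 1 = int (Suc n)" by simp
  then show ?thesis unfolding \<open>k = int n\<close> by (simp only: upow_of_nat oppow.simps)
next
  case False
  then obtain n where k: "k = - int (Suc n)" by (metis not_le negD)
  then have "k + 1 = - int n" by simp
  then show ?thesis unfolding k
    using unitaryD[OF assms] by (simp only: upow_neg_of_nat oppow.simps)
      (simp add: upow_neg_of_nat flip: blinfun_compose_assoc)
qed

lemma upow_minus_one:
  assumes "unitary_op U"
  shows "upow U (k - 1) = adj U o\<^sub>L upow U k"
  using upow_plus_one[OF assms, of "k - 1"] unitaryD[OF assms]
  by (simp flip: blinfun_compose_assoc)

lemma upow_add:
  assumes "unitary_op U"
  shows "upow U (j + k) = upow U j o\<^sub>L upow U k"
proof (induction j rule: int_induct[where k = 0])
  case (step1 i)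
  have "upow U (i + 1 + k) = U o\<^sub>L upow U (i + k)"
    using upow_plus_one[OF assms, of "i + k"] by (simp add: add_ac)
  then show ?case using step1 by (simp add: upow_plus_one[OF assms] blinfun_compose_assoc)
next
  case (step2 i)
  have "upow U (i - 1 + k) = adj U o\<^sub>L upow U (i + k)"
    using upow_minus_one[OF assms, of "i + k"] by (simp add: algebra_simps)
  then show ?case using step2 by (simp add: upow_minus_one[OF assms] blinfun_compose_assoc)
qed simp

lemma upow_inverse:
  assumes "unitary_op U"
  shows "upow U (- k) o\<^sub>L upow U k = id_blinfun" "upow U k o\<^sub>L upow U (- k) = id_blinfun"
  by (simp_all flip: upow_add[OF assms])

lemma upow_cancel:
  assumes "unitary_op U"
  shows "upow U (- k) o\<^sub>L (upow U k o\<^sub>L A) = A" "upow U k o\<^sub>L (upow U (- k) o\<^sub>L A) = A"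
  using upow_inverse[OF assms, of k] by (simp_all flip: blinfun_compose_assoc)

lemma adj_oppow:
  assumes "clinear_op A"
  shows "adj (oppow A n) = oppow (adj A) n"
  by (induction n) (simp_all add: adj_compose assms clinear_oppow oppow_commute)

lemma adj_upow:
  assumes "unitary_op U"
  shows "adj (upow U k) = upow U (- k)"
  using unitaryD(1)[OF assms] by (auto simp: upow_def adj_oppow)

lemma adj_unitary: "unitary_op U \<Longrightarrow> unitary_op (adj U)"
  by (simp add: unitary_op_def)

lemma oppow_op_tensor:
  assumes "clinear_op A" "clinear_op B"
  shows "oppow (op_tensor A B) n = op_tensor (oppow A n) (oppow B n)"
  by (induction n) (simp_all add: op_tensor_id op_tensor_compose assms clinear_oppow)

lemma upow_op_tensor:
  assumes "clinear_op A" "clinear_op B"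
  shows "upow (op_tensor A B) k = op_tensor (upow A k) (upow B k)"
  by (simp add: upow_def oppow_op_tensor adj_op_tensor assms)

lemma unitary_op_tensor:
  assumes "unitary_op A" "unitary_op B"
  shows "unitary_op (op_tensor A B)"
  using assms by (auto simp: unitary_op_def clinear_op_tensor adj_op_tensor op_tensor_compose op_tensor_id)


section \<open>Multiplication by \<open>z\<close>\<close>

lemma l2_circle_cases:
  obtains f where "x = abs_l2_circle f" "square_integrable f"
proof -
  have "abs_l2_circle (rep_l2_circle x) = x"
    by (rule Quotient3_abs_rep[OF Quotient3_l2_circle])
  moreover have "l2_rel (rep_l2_circle x) (rep_l2_circle x)"
    by (rule Quotient3_rep_reflp[OF Quotient3_l2_circle])
  ultimately show ?thesis using that[of "rep_l2_circle x"] by (simp add: l2_rel_def)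
qed

lemma mult_z_abs: "square_integrable f \<Longrightarrow> mult_z (abs_l2_circle f) = abs_l2_circle (\<lambda>z. z * f z)"
  unfolding mult_z.rep_eq by (rule mult_z_fun.abs_eq) (rule l2_relI)

lemma square_integrable_mult_z: "square_integrable f \<Longrightarrow> square_integrable (\<lambda>z. z * f z)"
  using mult_z_rel[OF l2_relI] by (simp add: l2_rel_def)

lemma clinear_mult_z: "clinear_op mult_z"
  unfolding clinear_op_def
proof (intro allI)
  fix c and x :: l2_circle
  obtain f where x: "x = abs_l2_circle f" and f: "square_integrable f" by (rule l2_circle_cases)
  have sc: "c *\<^sub>C abs_l2_circle g = abs_l2_circle (\<lambda>z. c * g z)" if "square_integrable g" for g
    by (rule scaleC_l2_circle.abs_eq) (rule l2_relI[OF that])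
  show "mult_z (c *\<^sub>C x) = c *\<^sub>C mult_z x"
    using f by (simp add: x sc mult_z_abs square_integrable_cmult square_integrable_mult_z mult.left_commute)
qed

text \<open>Multiplication by z is isometric, and multiplication by the conjugate of z produces
  preimages because |z| = 1 almost everywhere.\<close>

lemma unitary_mult_z: "unitary_op mult_z"
proof -
  have 1: "adj mult_z o\<^sub>L mult_z = id_blinfun"
  proof (rule blinfun_eqI, rule cinner_eqI')
    fix x y
    show "cinner y ((adj mult_z o\<^sub>L mult_z) x) = cinner y (id_blinfun x)"
      using adj[OF clinear_mult_z, of y "mult_z x"] by (simp add: mult_z.rep_eq cinner_mult_z)
  qed
  have surj: "\<exists>y. mult_z y = x" for x
  proof -
    obtain f where x: "x = abs_l2_circle f" and f: "square_integrable f" by (rule l2_circle_cases)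
    have g: "square_integrable (\<lambda>z. cnj z * f z)"
      by (rule square_integrable_mult_bounded[where C = 1, OF f])
        (use AE_circle_norm in \<open>auto intro!: borel_measurable_continuous_onI continuous_intros\<close>)
    have "AE z in circle_measure. z * (cnj z * f z) = f z"
      using AE_circle_norm
    proof eventually_elim
      case (elim z)
      then have "z * cnj z = 1" by (simp add: complex_norm_square[symmetric])
      then show ?case by (simp flip: mult.assoc)
    qed
    then have "l2_rel (\<lambda>z. z * (cnj z * f z)) f"
      using f square_integrable_mult_z[OF g] by (simp add: l2_rel_def)
    then have "mult_z (abs_l2_circle (\<lambda>z. cnj z * f z)) = x"
      unfolding mult_z_abs[OF g] x by (simp add: Quotient3_rel_abs[OF Quotient3_l2_circle])
    then show ?thesis by blast
  qed
  have "mult_z o\<^sub>L adj mult_z = id_blinfun"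
  proof (rule blinfun_eqI)
    fix x
    obtain y where y: "mult_z y = x" using surj by blast
    have "adj mult_z x = y"
      using arg_cong[OF 1, of "\<lambda>A. blinfun_apply A y"] by (simp add: y)
    then show "(mult_z o\<^sub>L adj mult_z) x = id_blinfun x" by (simp add: y)
  qed
  then show ?thesis using 1 clinear_mult_z by (simp add: unitary_op_def)
qed

definition circle_one :: l2_circle
  where "circle_one = abs_l2_circle (\<lambda>_. 1)"

lemma oppow_mult_z_one:
  "oppow mult_z n circle_one = abs_l2_circle (\<lambda>z. z ^ n) \<and> square_integrable (\<lambda>z. z ^ n)"
proof (induction n)
  case 0
  show ?case by (simp add: circle_one_def square_integrable_def)
next
  case (Suc n)
  then show ?case using square_integrable_mult_z[of "\<lambda>z. z ^ n"] by (simp add: mult_z_abs)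
qed

text \<open>Pulled back to [0, 1] the integrand is exp (a t) with a = 2 pi \<i> n, and its
  antiderivative exp (a t) / a takes equal values at 0 and 1.\<close>

lemma integral_circle_power:
  assumes "n > 0"
  shows "(LINT z|circle_measure. z ^ n) = 0"
proof -
  define a :: complex where "a = \<i> * complex_of_real (2 * pi * real n)"
  have a: "a \<noteq> 0" using assms by (simp add: a_def)
  have power: "cis (2 * pi * t) ^ n = exp (a * complex_of_real t)" for t
    unfolding Complex.DeMoivre by (simp add: cis_conv_exp a_def mult_ac)
  have "(LINT z|circle_measure. z ^ n) = (LINT t|uniform_measure lborel {0..1::real}. cis (2 * pi * t) ^ n)"
    unfolding circle_measure_def
    by (subst integral_distr) (auto intro!: borel_measurable_continuous_onI continuous_intros)
  also have "\<dots> = (LINT t|density lborel (indicator {0..1::real}). cis (2 * pi * t) ^ n)"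
    by (simp add: uniform_measure_def divide_ennreal_def)
  also have "\<dots> = (LINT t|density lborel (\<lambda>t. ennreal (indicator {0..1::real} t)). exp (a * complex_of_real t))"
    by (simp add: power ennreal_indicator)
  also have "\<dots> = (LINT t|lborel. indicator {0..1::real} t *\<^sub>R exp (a * complex_of_real t))"
    by (rule integral_density) (auto intro!: borel_measurable_continuous_onI continuous_intros)
  also have "\<dots> = exp (a * complex_of_real 1) / a - exp (a * complex_of_real 0) / a"
  proof (rule integral_FTC_Icc)
    fix t :: real
    have "((\<lambda>z. exp (a * z) / a) has_field_derivative exp (a * complex_of_real t)) (at (complex_of_real t))"
      using a by (auto intro!: derivative_eq_intros)
    then show "((\<lambda>t. exp (a * complex_of_real t) / a) has_vector_derivative exp (a * complex_of_real t))
        (at t within {0..1})"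
      using has_vector_derivative_real_field has_vector_derivative_at_within by blast
  qed (auto intro!: continuous_intros)
  also have "exp (a * complex_of_real 1) = 1"
    using exp_integer_2pi[of "of_nat n"] by (simp add: a_def mult_ac)
  finally show ?thesis by simp
qed

lemma cinner_upow_mult_z:
  "cinner (upow mult_z k circle_one) circle_one = (if k = 0 then 1 else 0)"
proof -
  have nat: "cinner (oppow mult_z n circle_one) circle_one = (if n = 0 then 1 else 0)" for n
  proof -
    have "cinner (oppow mult_z n circle_one) circle_one = (LINT z|circle_measure. z ^ n * cnj 1)"
      unfolding conjunct1[OF oppow_mult_z_one] unfolding circle_one_def
      by (rule cinner_l2_circle.abs_eq)
        (use oppow_mult_z_one[of n] oppow_mult_z_one[of 0] in \<open>auto intro!: l2_relI\<close>)
    then show ?thesis using integral_circle_power[of n] circle.prob_space by auto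
  qed
  show ?thesis
  proof (cases "0 \<le> k")
    case True
    then show ?thesis using nat[of "nat k"] by (auto simp: upow_def)
  next
    case False
    have "cinner (upow mult_z k circle_one) circle_one = cinner circle_one (adj (upow mult_z k) circle_one)"
      by (rule adj) (rule clinear_upow[OF clinear_mult_z])
    also have "\<dots> = cnj (cinner (oppow mult_z (nat (- k)) circle_one) circle_one)"
      using False by (subst cinner_commute) (simp add: upow_def adj_oppow clinear_mult_z)
    finally show ?thesis using False by (simp add: nat)
  qed
qed

lemma cinner_upow_mult_z_upow:
  "cinner (upow mult_z j circle_one) (upow mult_z k circle_one) = (if j = k then 1 else 0)"
proof -
  have "cinner (upow mult_z j circle_one) (upow mult_z k circle_one)
      = cinner (adj (upow mult_z k) (upow mult_z j circle_one)) circle_one"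
    by (rule adj'[symmetric]) (rule clinear_upow[OF clinear_mult_z])
  also have "adj (upow mult_z k) (upow mult_z j circle_one) = upow mult_z (j - k) circle_one"
    using upow_add[OF unitary_mult_z, of "- k" j] by (simp add: adj_upow[OF unitary_mult_z])
  finally show ?thesis by (simp add: cinner_upow_mult_z)
qed

text \<open>The vectors z^k are orthonormal, so pairing the image of f tensor 1 with C_j f tensor
  z^j isolates |C_j f|^2. This is where the factor M_z enters.\<close>

lemma norm_coefficient_le:
  fixes C :: "int \<Rightarrow> ('a, complex) ell2 \<Rightarrow>\<^sub>L ('a, complex) ell2"
  assumes F: "finite F" "j \<in> F" and C: "\<And>k. k \<in> F \<Longrightarrow> clinear_op (C k)"
  shows "norm (C j) \<le> norm (\<Sum>k\<in>F. op_tensor (C k) (upow mult_z k))" (is "_ \<le> norm ?T")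
proof (rule norm_blinfun_bound)
  fix f
  let ?g = "C j f"
  let ?e = "\<lambda>k. upow mult_z k circle_one"
  have norm_e: "norm (?e k) = 1" for k
  proof -
    have "complex_of_real ((norm (?e k))\<^sup>2) = complex_of_real 1"
      unfolding cinner_self[symmetric] by (simp add: cinner_upow_mult_z_upow)
    then show ?thesis unfolding of_real_eq_iff using norm_ge_zero[of "?e k"] by (simp add: power2_eq_1_iff)
  qed
  have "?T (tensor_vec f circle_one) = (\<Sum>k\<in>F. tensor_vec (C k f) (?e k))"
    by (simp add: blinfun.sum_left op_tensor_apply C clinear_upow clinear_mult_z)
  then have "cinner (?T (tensor_vec f circle_one)) (tensor_vec ?g (?e j)) = cinner ?g ?g"
    using F by (simp add: cinner_sum_left cinner_tensor_vec cinner_upow_mult_z_upow if_distrib[of "\<lambda>x. _ * x"] cong: if_cong)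
  then have "(norm ?g)\<^sup>2 = cmod (cinner (?T (tensor_vec f circle_one)) (tensor_vec ?g (?e j)))"
    by (simp add: cinner_self norm_power)
  also have "\<dots> \<le> norm (?T (tensor_vec f circle_one)) * norm (tensor_vec ?g (?e j))"
    by (rule norm_cinner_le)
  also have "\<dots> \<le> (norm ?T * norm (tensor_vec f circle_one)) * norm (tensor_vec ?g (?e j))"
    by (intro mult_right_mono norm_blinfun) simp
  also have "\<dots> = (norm ?T * norm f) * norm ?g"
    using norm_e[of 0] by (simp add: norm_tensor_vec norm_e)
  finally have "norm ?g * norm ?g \<le> (norm ?T * norm f) * norm ?g" by (simp add: power2_eq_square)
  then show "norm ?g \<le> norm ?T * norm f"
    using mult_right_le_imp_le[of "norm ?g" "norm ?g" "norm ?T * norm f"] by (cases "norm ?g = 0") auto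
qed simp

section \<open>Compact operators\<close>

lemma compact_ops_clinear: "A \<in> compact_ops \<Longrightarrow> clinear_op A"
  by (simp add: compact_ops_def)

text \<open>A sequence in the closure of the image is approximated within 1 / (n + 1) by images of
  unit-ball vectors, so convergent subsequences for the latter suffice.\<close>

lemma compact_opsI:
  assumes A: "clinear_op A"
    and sub: "\<And>x. (\<And>n. norm (x n) \<le> 1) \<Longrightarrow> \<exists>r. strict_mono (r :: nat \<Rightarrow> nat) \<and> convergent (\<lambda>n. blinfun_apply A (x (r n)))"
  shows "A \<in> compact_ops"
proof -
  let ?S = "blinfun_apply A ` cball 0 1"
  have "seq_compact (closure ?S)"
    unfolding seq_compact_def
  proof (intro allI impI)
    fix y :: "nat \<Rightarrow> _" assume y: "\<forall>n. y n \<in> closure ?S"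
    have "\<exists>x. norm x \<le> 1 \<and> dist (A x) (y n) < 1 / real (Suc n)" for n
    proof -
      have "\<forall>e>0. \<exists>z\<in>?S. dist z (y n) < e" using y[rule_format, of n] by (simp only: closure_approachable)
      then have "\<exists>z\<in>?S. dist z (y n) < 1 / real (Suc n)" by simp
      then show ?thesis by auto
    qed
    then obtain x where x: "\<And>n. norm (x n) \<le> 1" "\<And>n. dist (A (x n)) (y n) < 1 / real (Suc n)" by metis
    obtain r where r: "strict_mono (r :: nat \<Rightarrow> nat)" "convergent (\<lambda>n. A (x (r n)))"
      using sub[of x, OF x(1)] by (elim exE conjE) (rule that)
    then obtain l where l: "(\<lambda>n. A (x (r n))) \<longlonglongrightarrow> l" by (auto simp: convergent_def)
    have d: "(\<lambda>n. dist (A (x n)) (y n)) \<longlonglongrightarrow> 0"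
      by (rule tendsto_sandwich[OF _ _ tendsto_const LIMSEQ_Suc[OF lim_inverse_n']])
        (use x(2) in \<open>auto intro: less_imp_le always_eventually simp del: of_nat_Suc\<close>)
    have "(\<lambda>n. dist (A (x (r n))) (y (r n))) \<longlonglongrightarrow> 0"
      using LIMSEQ_subseq_LIMSEQ[OF d r(1)] by (simp add: o_def)
    then have "(y \<circ> r) \<longlonglongrightarrow> l"
      using Lim_transform[of "\<lambda>n. A (x (r n))" l sequentially "\<lambda>n. y (r n)"] l
      by (simp add: o_def dist_norm tendsto_norm_zero_iff norm_minus_commute)
    moreover have "l \<in> closure ?S"
      by (rule closed_sequentially[OF closed_closure _ \<open>(y \<circ> r) \<longlonglongrightarrow> l\<close>]) (use y in auto)
    ultimately show "\<exists>l\<in>closure ?S. \<exists>r. strict_mono r \<and> (y \<circ> r) \<longlonglongrightarrow> l" using r(1) by blast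
  qed
  then show ?thesis using A by (simp add: compact_ops_def compact_eq_seq_compact_metric)
qed

lemma compact_ops_subseq:
  assumes A: "A \<in> compact_ops" and x: "\<And>n. norm (x n) \<le> C"
  obtains r where "strict_mono (r :: nat \<Rightarrow> nat)" "convergent (\<lambda>n. blinfun_apply A (x (r n)))"
proof -
  define c where "c = \<bar>C\<bar> + 1"
  have c: "c > 0" by (simp add: c_def add_nonneg_pos)
  have "norm ((1 / c) *\<^sub>R x n) \<le> 1" for n
    using x[of n] c by (simp add: c_def)
  then have mem: "\<forall>n. A ((1 / c) *\<^sub>R x n) \<in> closure (blinfun_apply A ` cball 0 1)"
    by (auto intro!: closure_subset[THEN subsetD])
  have sc: "seq_compact (closure (blinfun_apply A ` cball 0 1))"
    using A by (simp add: compact_ops_def compact_eq_seq_compact_metric)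
  obtain l r where r: "strict_mono (r :: nat \<Rightarrow> nat)" "((\<lambda>n. A ((1 / c) *\<^sub>R x n)) \<circ> r) \<longlonglongrightarrow> l"
    using seq_compactE[OF sc mem] by metis
  have "(\<lambda>n. c *\<^sub>R A ((1 / c) *\<^sub>R x (r n))) \<longlonglongrightarrow> c *\<^sub>R l"
    using r(2) by (intro tendsto_scaleR tendsto_const) (simp add: o_def)
  then have "convergent (\<lambda>n. A (x (r n)))"
    using c by (auto simp: blinfun.scaleR_right convergent_def)
  then show ?thesis using r(1) that by blast
qed

lemma compact_ops_zero: "0 \<in> compact_ops"
  by (rule compact_opsI) (auto intro!: exI[of _ id] strict_mono_id convergent_const)

lemma compact_ops_add:
  assumes A: "A \<in> compact_ops" and B: "B \<in> compact_ops"
  shows "A + B \<in> compact_ops"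
proof (rule compact_opsI)
  show "clinear_op (A + B)" using assms by (simp add: clinear_add compact_ops_clinear)
  fix x :: "nat \<Rightarrow> 'a" assume x: "\<And>n. norm (x n) \<le> 1"
  obtain r where r: "strict_mono (r :: nat \<Rightarrow> nat)" "convergent (\<lambda>n. A (x (r n)))"
    using compact_ops_subseq[OF A, of x 1] x by blast
  obtain s where s: "strict_mono (s :: nat \<Rightarrow> nat)" "convergent (\<lambda>n. B (x (r (s n))))"
    using compact_ops_subseq[OF B, of "\<lambda>n. x (r n)" 1] x by blast
  have "convergent (\<lambda>n. A (x (r (s n))))"
    using convergent_subseq_convergent[OF r(2) s(1)] by (simp add: o_def)
  then have "convergent (\<lambda>n. (A + B) (x (r (s n))))"
    using s(2) by (simp add: blinfun.add_left convergent_add)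
  then show "\<exists>r. strict_mono (r :: nat \<Rightarrow> nat) \<and> convergent (\<lambda>n. (A + B) (x (r n)))"
    using strict_mono_o[OF r(1) s(1)] by (intro exI[of _ "r \<circ> s"]) auto
qed

lemma compact_ops_compose_left:
  assumes A: "A \<in> compact_ops" and B: "clinear_op B"
  shows "B o\<^sub>L A \<in> compact_ops"
proof (rule compact_opsI)
  show "clinear_op (B o\<^sub>L A)" using assms by (simp add: clinear_compose compact_ops_clinear)
  fix x :: "nat \<Rightarrow> 'a" assume x: "\<And>n. norm (x n) \<le> 1"
  obtain r where r: "strict_mono (r :: nat \<Rightarrow> nat)" "convergent (\<lambda>n. A (x (r n)))"
    using compact_ops_subseq[OF A, of x 1] x by blast
  then show "\<exists>r. strict_mono (r :: nat \<Rightarrow> nat) \<and> convergent (\<lambda>n. (B o\<^sub>L A) (x (r n)))"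
    by (intro exI[of _ r]) (auto simp: convergent_def dest: blinfun.tendsto[OF tendsto_const])
qed

lemma compact_ops_compose_right:
  assumes A: "A \<in> compact_ops" and B: "clinear_op B"
  shows "A o\<^sub>L B \<in> compact_ops"
proof (rule compact_opsI)
  show "clinear_op (A o\<^sub>L B)" using assms by (simp add: clinear_compose compact_ops_clinear)
  fix x :: "nat \<Rightarrow> 'a" assume x: "\<And>n. norm (x n) \<le> 1"
  have "norm (B (x n)) \<le> norm B" for n
    using norm_blinfun[of B "x n"] mult_left_mono[OF x[of n], of "norm B"] by simp
  then show "\<exists>r. strict_mono (r :: nat \<Rightarrow> nat) \<and> convergent (\<lambda>n. (A o\<^sub>L B) (x (r n)))"
    using compact_ops_subseq[OF A, of "\<lambda>n. B (x n)" "norm B"] by auto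
qed

text \<open>Schauder's argument: |adj A d|^2 = <A (adj A d), d>, so a subsequence on which the
  compact operator A adj A converges is Cauchy for \<open>adj A\<close>. The constant 2 bounds a
  difference of unit-ball vectors.\<close>

lemma compact_ops_adj:
  assumes A: "A \<in> compact_ops"
  shows "adj A \<in> compact_ops"
proof (rule compact_opsI)
  have cA: "clinear_op A" using A by (rule compact_ops_clinear)
  then show "clinear_op (adj A)" by simp
  fix x :: "nat \<Rightarrow> 'a" assume x: "\<And>n. norm (x n) \<le> 1"
  have "A o\<^sub>L adj A \<in> compact_ops" using A cA by (simp add: compact_ops_compose_right)
  then obtain r where r: "strict_mono (r :: nat \<Rightarrow> nat)" "convergent (\<lambda>n. (A o\<^sub>L adj A) (x (r n)))"
    using compact_ops_subseq[of "A o\<^sub>L adj A" x 1] x by blast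
  have est: "(norm (adj A (x i) - adj A (x j)))\<^sup>2 \<le> 2 * norm (A (adj A (x i)) - A (adj A (x j)))" for i j
  proof -
    let ?d = "x i - x j"
    have "(norm (adj A ?d))\<^sup>2 = cmod (cinner (adj A ?d) (adj A ?d))" by (simp add: cinner_self norm_power)
    also have "\<dots> = cmod (cinner (A (adj A ?d)) ?d)" by (simp add: adj cA)
    also have "\<dots> \<le> norm (A (adj A ?d)) * norm ?d" by (rule norm_cinner_le)
    also have "\<dots> \<le> norm (A (adj A ?d)) * 2"
      using norm_triangle_ineq4[of "x i" "x j"] x[of i] x[of j] by (intro mult_left_mono) auto
    finally show ?thesis by (simp add: blinfun.diff_right mult.commute)
  qed
  have "Cauchy (\<lambda>n. adj A (x (r n)))"
  proof (rule CauchyI)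
    fix e :: real assume e: "e > 0"
    obtain M where M: "\<forall>m\<ge>M. \<forall>n\<ge>M. norm ((A o\<^sub>L adj A) (x (r m)) - (A o\<^sub>L adj A) (x (r n))) < e\<^sup>2 / 2"
      using CauchyD[OF convergent_Cauchy[OF r(2)], of "e\<^sup>2 / 2"] e by auto
    have "norm (adj A (x (r m)) - adj A (x (r n))) < e" if "m \<ge> M" "n \<ge> M" for m n
    proof -
      have "norm (A (adj A (x (r m))) - A (adj A (x (r n)))) < e\<^sup>2 / 2" using M that by auto
      then have "(norm (adj A (x (r m)) - adj A (x (r n))))\<^sup>2 < e\<^sup>2"
        using est[of "r m" "r n"] by linarith
      then show ?thesis using e by (simp add: power_less_imp_less_base)
    qed
    then show "\<exists>M. \<forall>m\<ge>M. \<forall>n\<ge>M. norm (adj A (x (r m)) - adj A (x (r n))) < e" by blast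
  qed
  then show "\<exists>r. strict_mono (r :: nat \<Rightarrow> nat) \<and> convergent (\<lambda>n. adj A (x (r n)))"
    using r(1) Cauchy_convergent by blast
qed


section \<open>The Cuntz--Toeplitz algebra\<close>

lemma bounded_linear_cinner_left: "bounded_linear (\<lambda>x. cinner x (g :: 'a::complex_inner))"
  by (rule bounded_linear_intro[where K = "norm g"])
    (auto simp: cinner_add_left norm_cinner_le cinner_scaleC_left scaleR_conv_of_real simp flip: scaleC_of_real)

definition rank_one :: "'k::chilbert_space \<Rightarrow> 'h::chilbert_space \<Rightarrow> ('h \<Rightarrow>\<^sub>L 'k)"
  where "rank_one v g = Blinfun (\<lambda>x. cinner x g *\<^sub>C v)"

lemma rank_one_apply: "rank_one v g x = cinner x g *\<^sub>C v"
  unfolding rank_one_def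
  by (rule fun_cong[OF bounded_linear_Blinfun_apply])
    (rule bounded_linear_compose[OF bounded_linear_scaleC_left bounded_linear_cinner_left])

lemma clinear_rank_one: "clinear_op (rank_one v g)"
  by (simp add: clinear_op_def rank_one_apply cinner_scaleC_left scaleC_scaleC)

lemma adj_rank_one: "adj (rank_one v g) = rank_one g v"
proof (rule adj_eqI)
  show "cinner (rank_one v g x) y = cinner x (rank_one g v y)" for x y
    using cinner_commute[of v y]
    by (simp add: rank_one_apply cinner_scaleC_left cinner_scaleC_right)
qed

lemma compose_rank_one: "clinear_op A \<Longrightarrow> A o\<^sub>L rank_one v g = rank_one (A v) g"
  by (rule blinfun_eqI) (simp add: rank_one_apply clinear_opD)

lemma rank_one_compose: "clinear_op A \<Longrightarrow> rank_one v g o\<^sub>L A = rank_one v (adj A g)"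
  by (rule blinfun_eqI) (simp add: rank_one_apply adj)

lemma norm_rank_one_diff: "norm (rank_one v g - rank_one v h) \<le> norm (g - h) * norm v"
proof (rule norm_blinfun_bound)
  fix x
  have "(rank_one v g - rank_one v h) x = cinner x (g - h) *\<^sub>C v"
    using scaleC_add_left[of "cinner x (g - h)" "cinner x h" v]
    by (simp add: blinfun.diff_left rank_one_apply cinner_diff_right)
  also have "norm \<dots> \<le> (norm x * norm (g - h)) * norm v"
    by (simp add: norm_scaleC mult_right_mono norm_cinner_le)
  finally show "norm ((rank_one v g - rank_one v h) x) \<le> norm (g - h) * norm v * norm x"
    by (simp add: mult_ac)
qed simp

lemma cinner_ell2_basis: "cinner x (ell2_basis w) = ell2_fun x w"
proof -
  have "cinner x (ell2_basis w) = (\<Sum>\<^sub>\<infinity>v. ell2_fun x v * cnj (if v = w then 1 else 0))"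
    by (simp add: cinner_ell2.rep_eq cinner_complex_def ell2_basis.rep_eq)
  also have "\<dots> = (\<Sum>\<^sub>\<infinity>v\<in>{w}. ell2_fun x v)"
    by (rule infsum_cong_neutral) auto
  finally show ?thesis by simp
qed

lemma ell2_eqI: "(\<And>w. ell2_fun x w = ell2_fun y w) \<Longrightarrow> x = y"
  by (simp add: ell2_fun_inject[symmetric] fun_eq_iff)

lemma ell2_fun_sum: "ell2_fun (sum k G) x = (\<Sum>y\<in>G. ell2_fun (k y) x)"
  by (induction G rule: infinite_finite_induct) (auto simp: zero_ell2.rep_eq plus_ell2.rep_eq)

definition coord_proj :: "'a set \<Rightarrow> ('a, complex) ell2 \<Rightarrow>\<^sub>L ('a, complex) ell2"
  where "coord_proj F = (\<Sum>w\<in>F. rank_one (ell2_basis w) (ell2_basis w))"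

lemma ell2_fun_coord_proj:
  assumes "finite F"
  shows "ell2_fun (coord_proj F g) x = (if x \<in> F then ell2_fun g x else 0)"
proof -
  have "ell2_fun (coord_proj F g) x = (\<Sum>w\<in>F. ell2_fun g w * (if x = w then 1 else 0))"
    by (simp add: coord_proj_def blinfun.sum_left ell2_fun_sum rank_one_apply cinner_ell2_basis
        scaleC_ell2.rep_eq scaleC_complex_def ell2_basis.rep_eq)
  then show ?thesis using assms by (simp add: if_distrib[of "\<lambda>x. _ * x"] cong: if_cong)
qed

lemma norm_diff_coord_proj:
  assumes "finite F"
  shows "norm (g - coord_proj F g) \<le> norm g"
proof -
  have "(norm (g - coord_proj F g))\<^sup>2 \<le> (norm g)\<^sup>2"
    unfolding ell2_norm_power2
  proof (rule infsum_mono)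
    show "(\<lambda>x. (norm (ell2_fun (g - coord_proj F g) x))\<^sup>2) summable_on UNIV"
      "(\<lambda>x. (norm (ell2_fun g x))\<^sup>2) summable_on UNIV"
      using ell2_fun by auto
  qed (auto simp: minus_ell2.rep_eq ell2_fun_coord_proj assms)
  then show ?thesis by (rule power2_le_imp_le) simp
qed

text \<open>Stated for all larger G so that one finite set of coordinates can serve finitely many
  vectors at once.\<close>

lemma coord_proj_tendsto:
  assumes "e > 0"
  obtains F where "finite F" "\<And>G. finite G \<Longrightarrow> F \<subseteq> G \<Longrightarrow> norm (g - coord_proj G g) < e"
proof -
  let ?S = "\<lambda>x. (norm (ell2_fun g x))\<^sup>2"
  have s: "?S summable_on UNIV" using ell2_fun[of g] by simp
  then have "(sum ?S \<longlongrightarrow> infsum ?S UNIV) (finite_subsets_at_top UNIV)"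
    using infsum_tendsto by blast
  then have "\<forall>\<^sub>F F in finite_subsets_at_top UNIV. dist (sum ?S F) (infsum ?S UNIV) < e\<^sup>2"
    by (rule tendstoD) (use assms in simp)
  then obtain F where F: "finite F" "\<And>G. finite G \<Longrightarrow> F \<subseteq> G \<Longrightarrow> dist (sum ?S G) (infsum ?S UNIV) < e\<^sup>2"
    by (auto simp: eventually_finite_subsets_at_top)
  have "norm (g - coord_proj G g) < e" if G: "finite G" "F \<subseteq> G" for G
  proof -
    have "(norm (g - coord_proj G g))\<^sup>2 = infsum ?S (UNIV - G)"
      unfolding ell2_norm_power2
      by (rule infsum_cong_neutral) (auto simp: minus_ell2.rep_eq ell2_fun_coord_proj G)
    also have "\<dots> = infsum ?S UNIV - sum ?S G"
      using s G by (subst infsum_Diff) auto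
    also have "\<dots> < e\<^sup>2" using F(2)[OF G] by (simp add: dist_real_def)
    finally show ?thesis using assms by (simp add: power_less_imp_less_base)
  qed
  with F(1) show ?thesis by (rule that)
qed

section \<open>Creation operators, the vacuum projection and the compact operators\<close>

lemma clinear_creation: "clinear_op (creation i)"
  unfolding clinear_op_def creation.rep_eq
  by (intro allI, transfer) (auto simp: fun_eq_iff scaleC_complex_def split: list.split)

lemma ell2_fun_adj_creation: "ell2_fun (adj (creation i) x) v = ell2_fun x (i # v)"
  by (simp add: cinner_ell2_basis[symmetric] adj' clinear_creation creation_basis)

lemma adj_creation_creation: "adj (creation i) o\<^sub>L creation i = id_blinfun"
  by (rule blinfun_eqI, rule ell2_eqI)
    (simp add: ell2_fun_adj_creation creation.rep_eq creation_fun.rep_eq)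

text \<open>Every nonempty word starts with exactly one letter, so the ranges of the L_i fill
  everything except the vacuum. This projection is the compact operator from which the others are
  reached.\<close>

lemma vacuum_projection:
  "id_blinfun - (\<Sum>i\<in>UNIV. creation i o\<^sub>L adj (creation i)) =
    rank_one (ell2_basis []) (ell2_basis ([] :: ('n::finite) list))"
proof (rule blinfun_eqI, rule ell2_eqI)
  fix x :: "'n fock" and w :: "'n list"
  have "ell2_fun ((\<Sum>i\<in>UNIV. creation i o\<^sub>L adj (creation i)) x) w
      = (\<Sum>i\<in>UNIV. case w of [] \<Rightarrow> 0 | j # v \<Rightarrow> if j = i then ell2_fun x (i # v) else 0)"
    by (simp add: blinfun.sum_left ell2_fun_sum creation.rep_eq creation_fun.rep_eq ell2_fun_adj_creation
        cong: list.case_cong if_cong)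
  also have "\<dots> = (if w = [] then 0 else ell2_fun x w)"
    by (cases w) auto
  finally show "ell2_fun ((id_blinfun - (\<Sum>i\<in>UNIV. creation i o\<^sub>L adj (creation i))) x) w =
      ell2_fun (rank_one (ell2_basis []) (ell2_basis []) x) w"
    by (simp add: blinfun.diff_left minus_ell2.rep_eq rank_one_apply cinner_ell2_basis
        scaleC_ell2.rep_eq scaleC_complex_def ell2_basis.rep_eq)
qed

lemma cuntz_toeplitz_ops: "cstar_ops (cuntz_toeplitz :: 'n fock_op set)"
proof -
  have S: "range creation \<subseteq> {A :: 'n fock_op. clinear_op A}" by (auto simp: clinear_creation)
  note g = cstar_generated_closed[OF S, folded cuntz_toeplitz_def]
  have "creation undefined \<in> (cuntz_toeplitz :: 'n fock_op set)" using g(1) by auto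
  then have "id_blinfun \<in> (cuntz_toeplitz :: 'n fock_op set)"
    using g(4)[OF g(6)] by (metis adj_creation_creation)
  with g show ?thesis by (intro cstar_ops.intro) auto
qed

lemma creation_mem: "creation i \<in> cuntz_toeplitz"
proof -
  have "range creation \<subseteq> cstar_generated (range creation)"
    by (rule cstar_generated_closed) (auto simp: clinear_creation)
  then show ?thesis by (auto simp: cuntz_toeplitz_def)
qed

text \<open>Matrix units are obtained from the vacuum projection: creation operators build up the
  left word, the adjoint exchanges the two sides, and creation operators act again.\<close>

lemma rank_one_basis_mem:
  "rank_one (ell2_basis v) (ell2_basis w) \<in> (cuntz_toeplitz :: ('n::finite) fock_op set)"
proof -
  interpret E: cstar_ops "cuntz_toeplitz :: 'n fock_op set" by (rule cuntz_toeplitz_ops)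
  have step: "rank_one (ell2_basis (i # v)) g \<in> (cuntz_toeplitz :: 'n fock_op set)"
    if "rank_one (ell2_basis v) g \<in> (cuntz_toeplitz :: 'n fock_op set)" for i v g
    using E.compose_mem[OF creation_mem that, of i]
    by (simp add: compose_rank_one clinear_creation creation_basis)
  have "rank_one (ell2_basis []) (ell2_basis []) \<in> (cuntz_toeplitz :: 'n fock_op set)"
    unfolding vacuum_projection[symmetric]
    by (intro E.diff_mem E.id_mem E.sum_mem E.compose_mem E.adj_mem creation_mem)
  then have "rank_one (ell2_basis w) (ell2_basis []) \<in> (cuntz_toeplitz :: 'n fock_op set)"
    by (induction w) (auto intro: step)
  then have "adj (rank_one (ell2_basis w) (ell2_basis [])) \<in> (cuntz_toeplitz :: 'n fock_op set)"
    by (rule E.adj_mem)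
  then show ?thesis unfolding adj_rank_one by (induction v) (auto intro: step)
qed

lemma rank_one_mem:
  "rank_one (ell2_basis v) g \<in> (cuntz_toeplitz :: ('n::finite) fock_op set)"
proof -
  interpret E: cstar_ops "cuntz_toeplitz :: 'n fock_op set" by (rule cuntz_toeplitz_ops)
  have "rank_one (ell2_basis v) g \<in> closure (cuntz_toeplitz :: 'n fock_op set)"
    unfolding closure_approachable
  proof (intro allI impI)
    fix e :: real assume "e > 0"
    then obtain F where F: "finite F" "norm (g - coord_proj F g) < e / (norm (ell2_basis v :: 'n fock) + 1)"
      using coord_proj_tendsto[of "e / (norm (ell2_basis v :: 'n fock) + 1)" g]
      by (metis add_nonneg_pos divide_pos_pos norm_ge_zero order_refl zero_less_one)
    have "rank_one (ell2_basis v) (coord_proj F g) = rank_one (ell2_basis v) g o\<^sub>L coord_proj F"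
      by (simp add: rank_one_compose coord_proj_def clinear_sum clinear_rank_one adj_sum adj_rank_one)
    also have "\<dots> = (\<Sum>w\<in>F. scaleC_op (cinner (ell2_basis w) g) (rank_one (ell2_basis v) (ell2_basis w)))"
      by (rule blinfun_eqI) (simp add: coord_proj_def blinfun.sum_left blinfun.sum_right rank_one_apply
          scaleC_op.rep_eq cinner_scaleC_left scaleC_scaleC mult.commute)
    also have "\<dots> \<in> cuntz_toeplitz" by (intro E.sum_mem E.scaleC_mem rank_one_basis_mem)
    finally have mem: "rank_one (ell2_basis v) (coord_proj F g) \<in> cuntz_toeplitz" .
    have "dist (rank_one (ell2_basis v) (coord_proj F g)) (rank_one (ell2_basis v) g)
        \<le> norm (g - coord_proj F g) * norm (ell2_basis v :: 'n fock)"
      using norm_rank_one_diff[of "ell2_basis v" g "coord_proj F g"] by (simp add: dist_norm norm_minus_commute)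
    also have "\<dots> \<le> norm (g - coord_proj F g) * (norm (ell2_basis v :: 'n fock) + 1)"
      by (intro mult_left_mono) auto
    also have "\<dots> < e"
      using F(2) norm_ge_zero[of "ell2_basis v :: 'n fock"]
      by (subst (asm) pos_less_divide_eq) (auto intro: add_nonneg_pos)
    finally show "\<exists>A\<in>cuntz_toeplitz. dist A (rank_one (ell2_basis v) g) < e" using mem by blast
  qed
  then show ?thesis using E.closed_T by simp
qed

lemma norm_blinfun_le_unit_ball:
  assumes "\<And>x. norm x \<le> 1 \<Longrightarrow> norm (blinfun_apply A x) \<le> b" "0 \<le> b"
  shows "norm A \<le> b"
proof (rule norm_blinfun_bound)
  fix x
  show "norm (A x) \<le> b * norm x"
  proof (cases "x = 0")
    case False
    have "norm (A ((1 / norm x) *\<^sub>R x)) \<le> b" using False by (intro assms) auto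
    then show ?thesis using False by (simp add: blinfun.scaleR_right field_simps)
  qed simp
qed fact

text \<open>The image of the unit ball has a finite e/3-net. A coordinate projection that is good on
  the net is good on the whole image, and composed with A it is a finite sum of operators covered by
  \<open>rank_one_mem\<close>.\<close>

lemma compact_ops_subset: "compact_ops \<subseteq> (cuntz_toeplitz :: ('n::finite) fock_op set)"
proof
  interpret E: cstar_ops "cuntz_toeplitz :: 'n fock_op set" by (rule cuntz_toeplitz_ops)
  fix A :: "'n fock_op" assume A: "A \<in> compact_ops"
  then have cA: "clinear_op A" by (rule compact_ops_clinear)
  have "A \<in> closure (cuntz_toeplitz :: 'n fock_op set)"
    unfolding closure_approachable
  proof (intro allI impI)
    fix e :: real assume e: "e > 0"
    have "compact (closure (blinfun_apply A ` cball 0 1))" using A by (simp add: compact_ops_def)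
    then obtain k where k: "finite k" "closure (blinfun_apply A ` cball 0 1) \<subseteq> (\<Union>y\<in>k. ball y (e / 3))"
      unfolding compact_eq_totally_bounded using e by (meson divide_pos_pos zero_less_numeral)
    have "\<exists>F. finite F \<and> (\<forall>G. finite G \<longrightarrow> F \<subseteq> G \<longrightarrow> norm (y - coord_proj G y) < e / 3)" for y :: "'n fock"
      using coord_proj_tendsto[of "e / 3" y] e by (metis divide_pos_pos zero_less_numeral)
    then have "\<exists>F. \<forall>y :: 'n fock. finite (F y) \<and>
        (\<forall>G. finite G \<longrightarrow> F y \<subseteq> G \<longrightarrow> norm (y - coord_proj G y) < e / 3)"
      by (intro choice allI)
    then obtain F where *: "\<forall>y :: 'n fock. finite (F y) \<and>
        (\<forall>G. finite G \<longrightarrow> F y \<subseteq> G \<longrightarrow> norm (y - coord_proj G y) < e / 3)"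
      by (rule exE)
    then have F: "finite (F y)"
      "finite G \<Longrightarrow> F y \<subseteq> G \<Longrightarrow> norm (y - coord_proj G y) < e / 3" for y G by auto
    define G where "G = (\<Union>y\<in>k. F y)"
    have G: "finite G" "\<And>y. y \<in> k \<Longrightarrow> F y \<subseteq> G" using k F by (auto simp: G_def)
    have "norm (A - (coord_proj G o\<^sub>L A)) \<le> 2 * e / 3"
    proof (rule norm_blinfun_le_unit_ball)
      fix x :: "'n fock" assume "norm x \<le> 1"
      then have "A x \<in> closure (blinfun_apply A ` cball 0 1)"
        by (auto intro!: closure_subset[THEN subsetD])
      then obtain y where y: "y \<in> k" "norm (A x - y) < e / 3"
        using k(2) by (auto simp: dist_norm norm_minus_commute)
      \<comment> \<open>The first bracket is small because 1 minus the projection is a contraction,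
        the second by the choice of G.\<close>
      have "(A - (coord_proj G o\<^sub>L A)) x = ((A x - y) - coord_proj G (A x - y)) + (y - coord_proj G y)"
        by (simp add: blinfun.diff_left blinfun.diff_right)
      also have "norm \<dots> \<le> norm (A x - y) + norm (y - coord_proj G y)"
        using norm_diff_coord_proj[OF G(1), of "A x - y"] by (intro order_trans[OF norm_triangle_ineq]) simp
      also have "\<dots> \<le> 2 * e / 3" using y F(2)[OF G(1) G(2)[OF y(1)]] by simp
      finally show "norm ((A - (coord_proj G o\<^sub>L A)) x) \<le> 2 * e / 3" .
    qed (use e in simp)
    moreover have "coord_proj G o\<^sub>L A = (\<Sum>w\<in>G. rank_one (ell2_basis w) (adj A (ell2_basis w)))"
      by (simp add: coord_proj_def compose_sum_left rank_one_compose cA)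
    then have "coord_proj G o\<^sub>L A \<in> cuntz_toeplitz"
      by (simp only: E.sum_mem rank_one_mem)
    ultimately show "\<exists>B\<in>cuntz_toeplitz. dist B A < e"
      using e by (intro bexI[of _ "coord_proj G o\<^sub>L A"]) (auto simp: dist_norm norm_minus_commute)
  qed
  then show "A \<in> cuntz_toeplitz" using E.closed_T by simp
qed

lemma cuntz_ideal: "star_ideal (cuntz_toeplitz :: ('n::finite) fock_op set) compact_ops"
proof -
  interpret E: cstar_ops "cuntz_toeplitz :: 'n fock_op set" by (rule cuntz_toeplitz_ops)
  show ?thesis
    by (intro star_ideal.intro star_ideal_axioms.intro cuntz_toeplitz_ops compact_ops_subset)
      (simp_all add: compact_ops_zero compact_ops_add compact_ops_compose_left compact_ops_compose_right
        compact_ops_adj E.clin)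
qed

lemma cstar_generated_minimal:
  assumes "S \<subseteq> T" "\<And>A. A \<in> T \<Longrightarrow> clinear_op A" "0 \<in> T" "\<And>A B. A \<in> T \<Longrightarrow> B \<in> T \<Longrightarrow> A + B \<in> T"
    "\<And>A B. A \<in> T \<Longrightarrow> B \<in> T \<Longrightarrow> A o\<^sub>L B \<in> T" "\<And>c A. A \<in> T \<Longrightarrow> scaleC_op c A \<in> T"
    "\<And>A. A \<in> T \<Longrightarrow> adj A \<in> T" "closed T"
  shows "cstar_generated S \<subseteq> T"
  unfolding cstar_generated_def
  by (rule Inter_lower, rule CollectI, intro conjI ballI allI assms(1,3-8) subsetI CollectI assms(2)) assumption+

lemma nc_disc_algebra_subset: "nc_disc_algebra \<subseteq> (cuntz_toeplitz :: 'n fock_op set)"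
proof -
  interpret E: cstar_ops "cuntz_toeplitz :: 'n fock_op set" by (rule cuntz_toeplitz_ops)
  show ?thesis
    unfolding nc_disc_algebra_def operator_algebra_generated_def
    by (rule Inter_lower)
      (use E.clin in \<open>auto intro: creation_mem E.mems E.closed_T\<close>)
qed

lemma creation_mem_nc_disc: "creation i \<in> nc_disc_algebra"
  unfolding nc_disc_algebra_def operator_algebra_generated_def by blast

section \<open>Conjugation by a unitary\<close>

lemma conj_by_add: "conj_by V (A + B) = conj_by V A + conj_by V B"
  by (simp add: conj_by_def compose_add_left compose_add_right)

lemma conj_by_diff: "conj_by V (A - B) = conj_by V A - conj_by V B"
  by (simp add: conj_by_def compose_diff_left compose_diff_right)

lemma conj_by_scaleC: "clinear_op V \<Longrightarrow> conj_by V (scaleC_op c A) = scaleC_op c (conj_by V A)"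
  by (simp add: conj_by_def compose_scaleC_left compose_scaleC_right)

lemma conj_by_compose:
  fixes V :: "'n fock_op"
  assumes "unitary_op V"
  shows "conj_by V (A o\<^sub>L B) = conj_by V A o\<^sub>L conj_by V B"
proof -
  have "V o\<^sub>L (adj V o\<^sub>L C) = C" for C :: "'n fock_op"
    using unitaryD(3)[OF assms] by (simp flip: blinfun_compose_assoc)
  then show ?thesis by (simp add: conj_by_def blinfun_compose_assoc)
qed

lemma adj_conj_by: "clinear_op V \<Longrightarrow> clinear_op A \<Longrightarrow> adj (conj_by V A) = conj_by V (adj A)"
  by (simp add: conj_by_def adj_compose clinear_compose blinfun_compose_assoc)

lemma conj_by_compact: "clinear_op V \<Longrightarrow> A \<in> compact_ops \<Longrightarrow> conj_by V A \<in> compact_ops"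
  by (simp add: conj_by_def compact_ops_compose_left compact_ops_compose_right)

text \<open>The operators of the Cuntz--Toeplitz algebra whose conjugates stay in it form a
  C*-algebra, so it suffices to look at the generators.\<close>

lemma conj_by_mem:
  assumes V: "unitary_op V" and gen: "\<And>i. conj_by V (creation i) \<in> cuntz_toeplitz"
    and A: "A \<in> cuntz_toeplitz"
  shows "conj_by V A \<in> (cuntz_toeplitz :: 'n fock_op set)"
proof -
  interpret E: cstar_ops "cuntz_toeplitz :: 'n fock_op set" by (rule cuntz_toeplitz_ops)
  have cV: "clinear_op V" using V by (rule unitaryD)
  let ?T = "{A \<in> cuntz_toeplitz. conj_by V A \<in> cuntz_toeplitz}"
  have "cstar_generated (range creation) \<subseteq> ?T"
  proof (rule cstar_generated_minimal)
    show "closed ?T"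
      unfolding closed_sequential_limits
    proof (intro allI impI)
      fix X l assume *: "(\<forall>n. X n \<in> ?T) \<and> X \<longlonglongrightarrow> l"
      then have "(\<lambda>n. conj_by V (X n)) \<longlonglongrightarrow> conj_by V l"
        unfolding conj_by_def by (intro tendsto_compose_op tendsto_const) simp
      then have "conj_by V l \<in> cuntz_toeplitz"
        using closed_sequentially[OF E.closed_T, of "\<lambda>n. conj_by V (X n)"] * by simp
      moreover have "l \<in> cuntz_toeplitz"
        using closed_sequentially[OF E.closed_T, of X] * by simp
      ultimately show "l \<in> ?T" by simp
    qed
    show "0 \<in> ?T" by (simp add: conj_by_def E.zero_mem compose_zero_left compose_zero_right)
    show "adj B \<in> ?T" if "B \<in> ?T" for B
      using that cV E.adj_mem[of "conj_by V B"] by (simp add: adj_conj_by E.clin E.adj_mem)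
  qed (auto simp: gen creation_mem E.clin conj_by_add conj_by_compose V conj_by_scaleC cV intro: E.mems)
  then show ?thesis using A by (auto simp: cuntz_toeplitz_def)
qed

text \<open>Forward, each L_i goes to \<phi>(L_i) in the disc algebra. Backward, surjectivity of
  \<phi> gives L_i = \<phi>(B), and conjugation by \<open>adj U\<close> returns B. Both directions
  are needed for integer powers.\<close>

lemma implements_conj_by_mem:
  assumes \<phi>: "\<phi> \<in> aut_nc_disc" and U: "implements U \<phi>" and A: "A \<in> cuntz_toeplitz"
  shows "conj_by U A \<in> cuntz_toeplitz" and "conj_by (adj U) A \<in> cuntz_toeplitz"
proof -
  have uU: "unitary_op U" and eq: "\<And>B. B \<in> nc_disc_algebra \<Longrightarrow> conj_by U B = \<phi> B"
    using U by (auto simp: implements_def)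
  have bij: "bij_betw \<phi> nc_disc_algebra nc_disc_algebra"
    using \<phi> by (auto simp: aut_nc_disc_def ring_iso_def op_algebra_def)
  show "conj_by U A \<in> cuntz_toeplitz"
  proof (rule conj_by_mem[OF uU _ A])
    show "conj_by U (creation i) \<in> cuntz_toeplitz" for i
      using bij_betw_apply[OF bij creation_mem_nc_disc] eq[OF creation_mem_nc_disc] nc_disc_algebra_subset
      by auto
  qed
  show "conj_by (adj U) A \<in> cuntz_toeplitz"
  proof (rule conj_by_mem[OF adj_unitary[OF uU] _ A])
    fix i
    obtain B where B: "B \<in> nc_disc_algebra" "creation i = \<phi> B"
      using bij creation_mem_nc_disc[of i] by (auto simp: bij_betw_def)
    have "conj_by (adj U) (conj_by U B) = (U o\<^sub>L adj U) o\<^sub>L (B o\<^sub>L (U o\<^sub>L adj U))"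
      using unitaryD(1)[OF uU] by (simp add: conj_by_def blinfun_compose_assoc)
    then have "conj_by (adj U) (creation i) = B"
      using unitaryD[OF uU] B eq[OF B(1)] by simp
    then show "conj_by (adj U) (creation i) \<in> cuntz_toeplitz" using B nc_disc_algebra_subset by auto
  qed
qed

section \<open>Generated closed ideals\<close>

context cstar_ops
begin

text \<open>The definition expresses closedness through \<open>anorm\<close> within the carrier.
  Since T is closed, no limit points lie outside it, and the condition is topological
  closedness.\<close>

lemma closed_ideal_iff:
  "ideal I (op_algebra T) \<and> S \<subseteq> I \<and>
    (\<forall>a\<in>carrier (op_algebra T). (\<forall>e>0. \<exists>b\<in>I. anorm (op_algebra T) (a \<ominus>\<^bsub>op_algebra T\<^esub> b) < e) \<longrightarrow> a \<in> I)
  \<longleftrightarrow> ideal I (op_algebra T) \<and> S \<subseteq> I \<and> closed I"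
proof -
  have "(\<forall>a\<in>carrier (op_algebra T). (\<forall>e>0. \<exists>b\<in>I. anorm (op_algebra T) (a \<ominus>\<^bsub>op_algebra T\<^esub> b) < e) \<longrightarrow> a \<in> I)
    \<longleftrightarrow> closed I" if "ideal I (op_algebra T)"
  proof -
    have I: "I \<subseteq> T" using that by (simp add: ideal_op_algebra_iff)
    have eq: "anorm (op_algebra T) (a \<ominus>\<^bsub>op_algebra T\<^esub> b) = norm (b - a)" if "a \<in> T" "b \<in> I" for a b
      using op_algebra_minus(2)[of a b] that I by (auto simp: norm_minus_commute) (auto simp: op_algebra_def)
    have car: "carrier (op_algebra T) = T" by (simp add: op_algebra_def)
    have "(\<forall>a\<in>carrier (op_algebra T). (\<forall>e>0. \<exists>b\<in>I. anorm (op_algebra T) (a \<ominus>\<^bsub>op_algebra T\<^esub> b) < e) \<longrightarrow> a \<in> I)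
      \<longleftrightarrow> (\<forall>a\<in>T. a \<in> closure I \<longrightarrow> a \<in> I)"
    proof -
      have "(\<exists>b\<in>I. anorm (op_algebra T) (a \<ominus>\<^bsub>op_algebra T\<^esub> b) < e) \<longleftrightarrow> (\<exists>b\<in>I. norm (b - a) < e)" if "a \<in> T" for a e
        by (rule bex_cong[OF refl]) (simp only: eq[OF that])
      then show ?thesis unfolding car closure_approachable dist_norm by (intro ball_cong refl) simp
    qed
    also have "\<dots> \<longleftrightarrow> closed I"
    proof
      assume *: "\<forall>a\<in>T. a \<in> closure I \<longrightarrow> a \<in> I"
      have "closure I \<subseteq> T" by (rule closure_minimal[OF I closed_T])
      then have "closure I \<subseteq> I" using * by blast
      then show "closed I" by (simp add: closure_subset_eq)
    qed (simp add: closure_closed)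
    finally show ?thesis .
  qed
  then show ?thesis by (intro conj_cong refl)
qed

lemma closed_ideal_generated_eq:
  "closed_ideal_generated (op_algebra T) S = \<Inter>{I. ideal I (op_algebra T) \<and> S \<subseteq> I \<and> closed I}"
  unfolding closed_ideal_generated_def closed_ideal_iff ..

lemma closed_ideal_generated_least:
  "ideal I (op_algebra T) \<Longrightarrow> S \<subseteq> I \<Longrightarrow> closed I \<Longrightarrow> closed_ideal_generated (op_algebra T) S \<subseteq> I"
  unfolding closed_ideal_generated_eq by blast

lemma closed_ideal_generated_superset: "S \<subseteq> closed_ideal_generated (op_algebra T) S"
  unfolding closed_ideal_generated_eq by blast

text \<open>For every candidate ideal I, the elements whose adjoint lies in I form another candidate
  because S is self-adjoint; hence the intersection of all candidates is closed under
  adjoints.\<close>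

lemma closed_star_ideal_generated:
  assumes S: "S \<subseteq> T" "\<And>A. A \<in> S \<Longrightarrow> adj A \<in> S"
  shows "closed_star_ideal T (closed_ideal_generated (op_algebra T) S)"
proof -
  let ?J = "closed_ideal_generated (op_algebra T) S"
  have T: "ideal T (op_algebra T)" by (simp add: ideal_op_algebra_iff mems)
  have J: "A \<in> ?J \<longleftrightarrow> (\<forall>I. ideal I (op_algebra T) \<longrightarrow> S \<subseteq> I \<longrightarrow> closed I \<longrightarrow> A \<in> I)" for A
    unfolding closed_ideal_generated_eq by blast
  have sub: "?J \<subseteq> T" using S(1) by (intro closed_ideal_generated_least T closed_T)
  have star: "adj A \<in> ?J" if "A \<in> ?J" for A
    unfolding J
  proof (intro allI impI)
    fix I assume I: "ideal I (op_algebra T)" "S \<subseteq> I" "closed I"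
    note II = I(1)[unfolded ideal_op_algebra_iff]
    let ?I = "{A \<in> T. adj A \<in> I}"
    have "ideal ?I (op_algebra T)"
      unfolding ideal_op_algebra_iff using II by (auto simp: adj_add adj_compose clin mems)
    moreover have "S \<subseteq> ?I" using S I by auto
    moreover have "closed ?I"
      unfolding closed_sequential_limits
    proof (intro allI impI)
      fix X l assume X: "(\<forall>n. X n \<in> ?I) \<and> X \<longlonglongrightarrow> l"
      then have "l \<in> T" using closed_sequentially[OF closed_T, of X] by simp
      moreover have "(\<lambda>n. adj (X n)) \<longlonglongrightarrow> adj l" using X clin by (intro tendsto_adj) auto
      then have "adj l \<in> I" using closed_sequentially[OF I(3), of "\<lambda>n. adj (X n)"] X by simp
      ultimately show "l \<in> ?I" by simp
    qed
    ultimately have "A \<in> ?I" using that unfolding J by blast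
    then show "adj A \<in> I" by simp
  qed
  have "closed ?J" unfolding closed_ideal_generated_eq by (rule closed_Inter) blast
  moreover have "0 \<in> ?J" "A \<in> ?J \<Longrightarrow> B \<in> ?J \<Longrightarrow> A + B \<in> ?J"
    "A \<in> ?J \<Longrightarrow> B \<in> T \<Longrightarrow> B o\<^sub>L A \<in> ?J" "A \<in> ?J \<Longrightarrow> B \<in> T \<Longrightarrow> A o\<^sub>L B \<in> ?J" for A B
    unfolding J by (simp_all add: ideal_op_algebra_iff)
  ultimately show ?thesis
    using sub star cstar_ops_axioms
    by (intro closed_star_ideal.intro closed_star_ideal_axioms.intro star_ideal.intro star_ideal_axioms.intro)
qed

end


section \<open>The covariant representation\<close>

lemma clinear_ampliation: "clinear_op A \<Longrightarrow> clinear_op (ampliation A)"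
  by (simp add: ampliation_def clinear_op_tensor)

lemma adj_ampliation: "clinear_op A \<Longrightarrow> adj (ampliation A) = ampliation (adj A)"
  by (simp add: ampliation_def adj_op_tensor)

lemma ampliation_compose: "clinear_op A \<Longrightarrow> clinear_op B \<Longrightarrow> ampliation (A o\<^sub>L B) = ampliation A o\<^sub>L ampliation B"
  by (simp add: ampliation_def op_tensor_compose)

lemma ampliation_add: "clinear_op A \<Longrightarrow> clinear_op B \<Longrightarrow> ampliation (A + B) = ampliation A + ampliation B"
  by (simp add: ampliation_def op_tensor_add_left)

lemma ampliation_scaleC: "clinear_op A \<Longrightarrow> ampliation (scaleC_op c A) = scaleC_op c (ampliation A)"
  by (simp add: ampliation_def op_tensor_scaleC_left)

lemma ampliation_zero [simp]: "ampliation 0 = 0"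
  by (simp add: ampliation_def op_tensor_zero_left)

lemma ampliation_id [simp]: "ampliation id_blinfun = id_blinfun"
  by (simp add: ampliation_def op_tensor_id)

lemma ampliation_sum: "(\<And>i. i \<in> F \<Longrightarrow> clinear_op (A i)) \<Longrightarrow> ampliation (\<Sum>i\<in>F. A i) = (\<Sum>i\<in>F. ampliation (A i))"
  by (simp add: ampliation_def op_tensor_sum_left)

lemma norm_unitary_le:
  assumes "unitary_op U"
  shows "norm U \<le> 1"
proof -
  have "(norm U)\<^sup>2 = norm (adj U o\<^sub>L U)" using unitaryD(1)[OF assms] by (simp add: norm_adj_compose_self)
  also have "\<dots> \<le> 1\<^sup>2" using unitaryD(2)[OF assms] norm_blinfun_id_le by simp
  finally show ?thesis by (rule power2_le_imp_le) simp
qed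

lemma unitary_upow: "unitary_op U \<Longrightarrow> unitary_op (upow U k)"
  by (simp add: unitary_op_def[of "upow U k"] adj_upow upow_inverse clinear_upow unitaryD(1))

text \<open>All that is used of the automorphism: conjugation by U and by its adjoint preserves the
  Cuntz--Toeplitz algebra.\<close>

locale dilation =
  fixes U :: "('n::finite) fock_op"
  assumes U: "unitary_op U"
    and conj_mem: "A \<in> cuntz_toeplitz \<Longrightarrow> conj_by U A \<in> cuntz_toeplitz"
    and conj_adj_mem: "A \<in> cuntz_toeplitz \<Longrightarrow> conj_by (adj U) A \<in> cuntz_toeplitz"
begin

abbreviation "ET \<equiv> (cuntz_toeplitz :: 'n fock_op set)"
abbreviation "W \<equiv> op_tensor U mult_z"
abbreviation "DA \<equiv> dilation_algebra U"
abbreviation "DJ \<equiv> dilation_ideal U"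

sublocale E: star_ideal "cuntz_toeplitz :: 'n fock_op set" compact_ops
  by (rule cuntz_ideal)

lemma cU: "clinear_op U"
  by (rule unitaryD[OF U])

lemma unitary_W: "unitary_op W"
  by (rule unitary_op_tensor[OF U unitary_mult_z])

lemma gens_clinear: "ampliation ` ET \<union> {W} \<subseteq> {A. clinear_op A}"
  using unitaryD(1)[OF unitary_W] by (auto simp: clinear_ampliation E.clin)

lemmas dil_gen = cstar_generated_closed[OF gens_clinear, folded dilation_algebra_def]

lemma ampliation_mem: "A \<in> ET \<Longrightarrow> ampliation A \<in> dilation_algebra U"
  using dil_gen(1) by auto

lemma W_mem: "W \<in> dilation_algebra U"
  using dil_gen(1) by auto

sublocale D: cstar_ops "dilation_algebra U"
  using dil_gen(2-7) ampliation_mem[OF E.id_mem] by (intro cstar_ops.intro) simp_all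

sublocale B: closed_star_ideal "DA" "DJ"
  unfolding dilation_ideal_def
proof (rule D.closed_star_ideal_generated)
  show "ampliation ` compact_ops \<subseteq> DA" using ampliation_mem E.J_T by auto
  show "adj A \<in> ampliation ` compact_ops" if "A \<in> ampliation ` (compact_ops :: 'n fock_op set)" for A
    using that E.J_adj by (auto simp: adj_ampliation E.clin E.J_T)
qed

text \<open>The k-th power of the automorphism before dividing out the compact operators.\<close>

definition twist :: "int \<Rightarrow> 'n fock_op \<Rightarrow> 'n fock_op"
  where "twist k A = upow U (- k) o\<^sub>L (A o\<^sub>L upow U k)"

lemma twist_add: "twist k (twist j A) = twist (j + k) A"
proof -
  have "upow U (- (j + k)) = upow U (- k) o\<^sub>L upow U (- j)"
  proof -
    have "- (j + k) = - k + - j" by simp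
    then show ?thesis by (simp only: upow_add[OF U])
  qed
  then show ?thesis by (simp add: twist_def upow_add[OF U] blinfun_compose_assoc)
qed

lemma twist_0 [simp]: "twist 0 A = A"
  by (simp add: twist_def)

lemma twist_1: "twist 1 A = conj_by U A"
proof -
  have "upow U (-1) = adj U" using adj_upow[OF U, of 1] by simp
  then show ?thesis by (simp add: twist_def conj_by_def blinfun_compose_assoc)
qed

lemma twist_minus1: "twist (-1) A = conj_by (adj U) A"
proof -
  have "upow U (-1) = adj U" using adj_upow[OF U, of 1] by simp
  then show ?thesis using cU by (simp add: twist_def conj_by_def blinfun_compose_assoc)
qed

lemma twist_zero [simp]: "twist k 0 = 0"
  by (simp add: twist_def compose_zero_left compose_zero_right)

lemma clinear_twist: "clinear_op A \<Longrightarrow> clinear_op (twist k A)"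
  by (simp add: twist_def clinear_compose clinear_upow cU)

lemma twist_mem: "A \<in> ET \<Longrightarrow> twist k A \<in> ET"
proof (induction k rule: int_induct[where k = 0])
  case (step1 i)
  then show ?case using conj_mem[of "twist i A"] twist_add[of 1 i A] by (simp add: twist_1)
next
  case (step2 i)
  then show ?case using conj_adj_mem[of "twist i A"] twist_add[of "-1" i A] by (simp add: twist_minus1)
qed simp

text \<open>The covariance relation a u^k = u^k \<alpha>^k(a), realised by W in the role of u; M_z
  commutes with the ampliation, so only U contributes to the twist.\<close>

lemma ampliation_W:
  assumes "clinear_op A"
  shows "ampliation A o\<^sub>L upow W k = upow W k o\<^sub>L ampliation (twist k A)"
  using assms
  by (simp add: ampliation_def upow_op_tensor cU clinear_mult_z op_tensor_compose clinear_upow clinear_twist)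
    (simp add: twist_def upow_cancel[OF U])

text \<open>Finitely supported families over the Cuntz--Toeplitz algebra: the algebraic crossed product before
  dividing out the compact operators.\<close>

definition fsupp :: "(int \<Rightarrow> 'n fock_op) set"
  where "fsupp = {a. (\<forall>k. a k \<in> ET) \<and> finite {k. a k \<noteq> 0}}"

definition conv :: "(int \<Rightarrow> 'n fock_op) \<Rightarrow> (int \<Rightarrow> 'n fock_op) \<Rightarrow> int \<Rightarrow> 'n fock_op"
  where "conv a b m = (\<Sum>k | b k \<noteq> 0. twist k (a (m - k)) o\<^sub>L b k)"

definition invol :: "(int \<Rightarrow> 'n fock_op) \<Rightarrow> int \<Rightarrow> 'n fock_op"
  where "invol a k = twist k (adj (a (- k)))"

definition covrep :: "(int \<Rightarrow> 'n fock_op) \<Rightarrow> ('n list, l2_circle) ell2 \<Rightarrow>\<^sub>L ('n list, l2_circle) ell2"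
  where "covrep a = (\<Sum>k | a k \<noteq> 0. upow W k o\<^sub>L ampliation (a k))"

definition delta :: "int \<Rightarrow> 'n fock_op \<Rightarrow> int \<Rightarrow> 'n fock_op"
  where "delta k A = (\<lambda>j. if j = k then A else 0)"

lemma fsuppI: "(\<And>k. a k \<in> ET) \<Longrightarrow> finite F \<Longrightarrow> (\<And>k. k \<notin> F \<Longrightarrow> a k = 0) \<Longrightarrow> a \<in> fsupp"
  using finite_subset[of "{k. a k \<noteq> 0}" F] by (auto simp: fsupp_def)

lemma fsuppD: "a \<in> fsupp \<Longrightarrow> a k \<in> ET" "a \<in> fsupp \<Longrightarrow> finite {k. a k \<noteq> 0}"
  "a \<in> fsupp \<Longrightarrow> clinear_op (a k)"
  by (auto simp: fsupp_def E.clin)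

lemma conv_eq:
  assumes "finite F" "\<And>k. k \<notin> F \<Longrightarrow> b k = 0"
  shows "conv a b m = (\<Sum>k\<in>F. twist k (a (m - k)) o\<^sub>L b k)"
  unfolding conv_def using assms
  by (intro sum.mono_neutral_left) (auto simp: compose_zero_right)

lemma covrep_eq:
  assumes "finite F" "\<And>k. k \<notin> F \<Longrightarrow> a k = 0"
  shows "covrep a = (\<Sum>k\<in>F. upow W k o\<^sub>L ampliation (a k))"
  unfolding covrep_def using assms
  by (intro sum.mono_neutral_left) (auto simp: compose_zero_right)

lemma delta_fsupp: "A \<in> ET \<Longrightarrow> delta k A \<in> fsupp"
  by (rule fsuppI[of _ "{k}"]) (auto simp: delta_def E.zero_mem)

lemma add_fsupp:
  assumes "a \<in> fsupp" "b \<in> fsupp"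
  shows "(\<lambda>k. a k + b k) \<in> fsupp"
  using assms
  by (intro fsuppI[of _ "{k. a k \<noteq> 0} \<union> {k. b k \<noteq> 0}"]) (auto dest: fsuppD(1) intro: fsuppD(2) E.add_mem)

lemma scale_fsupp:
  assumes "a \<in> fsupp"
  shows "(\<lambda>k. scaleC_op c (a k)) \<in> fsupp"
proof (rule fsuppI)
  show "finite {k. a k \<noteq> 0}" using assms by (rule fsuppD)
  show "scaleC_op c (a k) = 0" if "k \<notin> {k. a k \<noteq> 0}" for k
    using that norm_scaleC_op[of c 0] by simp
qed (use fsuppD(1)[OF assms] E.scaleC_mem in blast)

lemma diff_fsupp:
  assumes "a \<in> fsupp" "b \<in> fsupp"
  shows "(\<lambda>k. a k - b k) \<in> fsupp"
  using assms
  by (intro fsuppI[of _ "{k. a k \<noteq> 0} \<union> {k. b k \<noteq> 0}"]) (auto dest: fsuppD(1) intro: fsuppD(2) E.diff_mem)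

text \<open>Besides finiteness of supports this supplies their linear growth in the comparison of
  seminorms.\<close>

lemma conv_support:
  assumes "\<And>k. k \<notin> F \<Longrightarrow> a k = 0" "\<And>k. k \<notin> G \<Longrightarrow> b k = 0" "m \<notin> (\<lambda>(j, k). j + k) ` (F \<times> G)"
  shows "conv a b m = 0"
  unfolding conv_def
proof (intro sum.neutral ballI)
  fix k assume "k \<in> {k. b k \<noteq> 0}"
  then have "k \<in> G" using assms(2) by auto
  then have "m - k \<notin> F" using assms(3) by force
  then show "twist k (a (m - k)) o\<^sub>L b k = 0" by (simp add: assms(1) compose_zero_left)
qed

lemma conv_fsupp:
  assumes "a \<in> fsupp" "b \<in> fsupp"
  shows "conv a b \<in> fsupp"
proof (rule fsuppI)
  show "conv a b k \<in> ET" for k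
    unfolding conv_def using assms by (intro E.sum_mem E.compose_mem twist_mem) (auto dest: fsuppD)
  show "finite ((\<lambda>(j, k). j + k) ` ({k. a k \<noteq> 0} \<times> {k. b k \<noteq> 0}))"
    using assms by (auto dest: fsuppD(2))
qed (rule conv_support, auto)

lemma invol_fsupp:
  assumes "a \<in> fsupp"
  shows "invol a \<in> fsupp"
proof (rule fsuppI)
  show "invol a k \<in> ET" for k
    unfolding invol_def using assms by (intro twist_mem E.adj_mem fsuppD)
  show "finite (uminus ` {k. a k \<noteq> 0})" using assms by (intro finite_imageI fsuppD)
  show "invol a k = 0" if "k \<notin> uminus ` {k. a k \<noteq> 0}" for k
  proof -
    have "a (- k) = 0" using that by force
    then show ?thesis by (simp add: invol_def)
  qed
qed

lemma covrep_mem: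
  assumes "a \<in> fsupp"
  shows "covrep a \<in> DA"
proof -
  have "upow W k \<in> DA" for k
    unfolding upow_def by (auto intro!: D.oppow_mem W_mem D.adj_mem)
  then show ?thesis
    unfolding covrep_def using assms
    by (intro D.sum_mem D.compose_mem ampliation_mem) (auto dest: fsuppD)
qed

lemma covrep_delta: "covrep (delta k A) = upow W k o\<^sub>L ampliation A"
  by (subst covrep_eq[of "{k}"]) (auto simp: delta_def)

lemma covrep_add:
  assumes "a \<in> fsupp" "b \<in> fsupp"
  shows "covrep (\<lambda>k. a k + b k) = covrep a + covrep b"
proof -
  define F where "F = {k. a k \<noteq> 0} \<union> {k. b k \<noteq> 0}"
  have F: "finite F" "\<And>k. k \<notin> F \<Longrightarrow> a k = 0" "\<And>k. k \<notin> F \<Longrightarrow> b k = 0"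
    using assms by (auto simp: F_def dest: fsuppD)
  then show ?thesis
    using covrep_eq[of F a] covrep_eq[of F b] covrep_eq[of F "\<lambda>k. a k + b k"] fsuppD(3) assms
    by (simp add: ampliation_add compose_add_right sum.distrib)
qed

lemma covrep_scaleC:
  assumes "a \<in> fsupp"
  shows "covrep (\<lambda>k. scaleC_op c (a k)) = scaleC_op c (covrep a)"
proof -
  define F where "F = {k. a k \<noteq> 0}"
  have F: "finite F" "\<And>k. k \<notin> F \<Longrightarrow> a k = 0"
    using assms by (auto simp: F_def dest: fsuppD)
  have sum: "scaleC_op c (\<Sum>k\<in>F. X k) = (\<Sum>k\<in>F. scaleC_op c (X k))" for X :: "int \<Rightarrow> ('n list, l2_circle) ell2 \<Rightarrow>\<^sub>L ('n list, l2_circle) ell2"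
    using F(1) by (induction F rule: finite_induct) (auto simp: scaleC_op_add norm_scaleC_op simp flip: norm_eq_zero)
  have "scaleC_op c (a k) = 0" if "k \<notin> F" for k
    using F(2)[OF that] norm_scaleC_op[of c "0 :: 'n fock_op"] by simp
  then show ?thesis
    using covrep_eq[of F a] covrep_eq[of F "\<lambda>k. scaleC_op c (a k)"] F fsuppD(3)[OF assms]
    by (simp add: ampliation_scaleC compose_scaleC_right clinear_upow unitaryD(1)[OF unitary_W] sum)
qed

lemma covrep_diff:
  assumes "a \<in> fsupp" "b \<in> fsupp"
  shows "covrep (\<lambda>k. a k - b k) = covrep a - covrep b"
  using covrep_add[OF diff_fsupp[OF assms] assms(2)] by (simp add: algebra_simps)

lemma covrep_conv:
  assumes a: "a \<in> fsupp" and b: "b \<in> fsupp"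
  shows "covrep (conv a b) = covrep a o\<^sub>L covrep b"
proof -
  define F where "F = {k. a k \<noteq> 0}"
  define G where "G = {k. b k \<noteq> 0}"
  define M where "M = (\<lambda>(j, k). j + k) ` (F \<times> G)"
  have F: "finite F" "\<And>k. k \<notin> F \<Longrightarrow> a k = 0" and G: "finite G" "\<And>k. k \<notin> G \<Longrightarrow> b k = 0"
    using assms by (auto simp: F_def G_def dest: fsuppD)
  have M: "finite M" using F G by (auto simp: M_def)
  let ?t = "\<lambda>k A. upow W k o\<^sub>L ampliation A"
  have cl: "clinear_op (twist k (a j) o\<^sub>L b k)" for j k
    using a b by (intro clinear_compose clinear_twist fsuppD)
  \<comment> \<open>Covariance moves the coefficient a_j past W^k, which is exactly the twist in
    \<open>conv\<close>.\<close>
  have prod: "?t j (a j) o\<^sub>L ?t k (b k) = ?t (j + k) (twist k (a j) o\<^sub>L b k)" for j k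
  proof -
    have "?t j (a j) o\<^sub>L ?t k (b k) = upow W j o\<^sub>L ((ampliation (a j) o\<^sub>L upow W k) o\<^sub>L ampliation (b k))"
      by (simp add: blinfun_compose_assoc)
    also have "\<dots> = ?t (j + k) (twist k (a j) o\<^sub>L b k)"
      using a b fsuppD(3)
      by (simp add: ampliation_W ampliation_compose clinear_twist upow_add[OF unitary_W] blinfun_compose_assoc)
    finally show ?thesis .
  qed
  have "covrep (conv a b) = (\<Sum>m\<in>M. ?t m (\<Sum>k\<in>G. twist k (a (m - k)) o\<^sub>L b k))"
    using conv_support[of F a G b] F G M
    by (subst covrep_eq[of M]) (auto simp: M_def conv_eq[of G b a])
  also have "\<dots> = (\<Sum>m\<in>M. \<Sum>k\<in>G. ?t m (twist k (a (m - k)) o\<^sub>L b k))"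
    by (simp add: ampliation_sum cl compose_sum_right)
  also have "\<dots> = (\<Sum>k\<in>G. \<Sum>m\<in>M. ?t m (twist k (a (m - k)) o\<^sub>L b k))"
    by (rule sum.swap)
  \<comment> \<open>Substitution m = j + k; for fixed k the indices m with m - k outside F
    contribute nothing.\<close>
  also have "\<dots> = (\<Sum>k\<in>G. \<Sum>j\<in>F. ?t (j + k) (twist k (a j) o\<^sub>L b k))"
  proof (rule sum.cong[OF refl])
    fix k assume k: "k \<in> G"
    have "(\<Sum>m\<in>M. ?t m (twist k (a (m - k)) o\<^sub>L b k)) = (\<Sum>m\<in>(\<lambda>j. j + k) ` F. ?t m (twist k (a (m - k)) o\<^sub>L b k))"
    proof (rule sum.mono_neutral_right[OF M])
      show "(\<lambda>j. j + k) ` F \<subseteq> M" using k by (auto simp: M_def)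
      show "\<forall>m\<in>M - (\<lambda>j. j + k) ` F. ?t m (twist k (a (m - k)) o\<^sub>L b k) = 0"
      proof
        fix m assume "m \<in> M - (\<lambda>j. j + k) ` F"
        then have "m - k \<notin> F" by force
        then show "?t m (twist k (a (m - k)) o\<^sub>L b k) = 0"
          by (simp add: F(2) compose_zero_left compose_zero_right)
      qed
    qed
    also have "\<dots> = (\<Sum>j\<in>F. ?t (j + k) (twist k (a j) o\<^sub>L b k))"
      by (subst sum.reindex) (auto simp: inj_on_def)
    finally show "(\<Sum>m\<in>M. ?t m (twist k (a (m - k)) o\<^sub>L b k)) = (\<Sum>j\<in>F. ?t (j + k) (twist k (a j) o\<^sub>L b k))" .
  qed
  also have "\<dots> = (\<Sum>k\<in>G. \<Sum>j\<in>F. ?t j (a j) o\<^sub>L ?t k (b k))"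
    by (simp only: prod)
  also have "\<dots> = covrep a o\<^sub>L covrep b"
    using covrep_eq[of F a] covrep_eq[of G b] F G by (simp add: compose_sum_left compose_sum_right)
  finally show ?thesis .
qed

lemma covrep_invol:
  assumes a: "a \<in> fsupp"
  shows "covrep (invol a) = adj (covrep a)"
proof -
  define F where "F = {k. a k \<noteq> 0}"
  have F: "finite F" "\<And>k. k \<notin> F \<Longrightarrow> a k = 0" using assms by (auto simp: F_def dest: fsuppD)
  have "invol a k = 0" if "k \<notin> uminus ` F" for k
  proof -
    have "- k \<notin> F" using that by force
    then show ?thesis by (simp add: invol_def F(2))
  qed
  then have "covrep (invol a) = (\<Sum>k\<in>uminus ` F. upow W k o\<^sub>L ampliation (twist k (adj (a (- k)))))"
    using F(1) by (subst covrep_eq[of "uminus ` F"]) (auto simp: invol_def)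
  also have "\<dots> = (\<Sum>k\<in>F. upow W (- k) o\<^sub>L ampliation (twist (- k) (adj (a k))))"
    by (subst sum.reindex) auto
  also have "\<dots> = (\<Sum>k\<in>F. ampliation (adj (a k)) o\<^sub>L upow W (- k))"
    using fsuppD(3)[OF a] by (simp add: ampliation_W)
  also have "\<dots> = (\<Sum>k\<in>F. adj (upow W k o\<^sub>L ampliation (a k)))"
    using fsuppD(3)[OF a] unitaryD(1)[OF unitary_W]
    by (simp add: adj_compose clinear_upow clinear_ampliation adj_upow[OF unitary_W] adj_ampliation)
  also have "\<dots> = adj (covrep a)"
    using fsuppD(3)[OF a] unitaryD(1)[OF unitary_W] covrep_eq[of F a] F
    by (simp add: adj_sum clinear_compose clinear_upow clinear_ampliation)
  finally show ?thesis .
qed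

text \<open>The k-th term of \<open>covrep a\<close> is U^k a(k) tensor M_z^k, and the unitary
  factor U^k does not affect the norm of the coefficient.\<close>

lemma norm_coefficient_le_covrep:
  assumes a: "a \<in> fsupp"
  shows "norm (a k) \<le> norm (covrep a)"
proof (cases "a k = 0")
  case False
  have "covrep a = (\<Sum>j | a j \<noteq> 0. op_tensor (upow U j o\<^sub>L a j) (upow mult_z j))"
    unfolding covrep_def using fsuppD(3)[OF a]
    by (intro sum.cong)
      (simp_all add: ampliation_def upow_op_tensor cU clinear_mult_z op_tensor_compose clinear_upow)
  then have *: "norm (upow U k o\<^sub>L a k) \<le> norm (covrep a)"
    using norm_coefficient_le[of "{j. a j \<noteq> 0}" k "\<lambda>j. upow U j o\<^sub>L a j"] False fsuppD(2,3)[OF a]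
    by (simp add: clinear_compose clinear_upow cU)
  have "a k = upow U (- k) o\<^sub>L (upow U k o\<^sub>L a k)" by (simp add: upow_cancel[OF U])
  then have "norm (a k) \<le> norm (upow U (- k)) * norm (upow U k o\<^sub>L a k)"
    using norm_blinfun_compose[of "upow U (- k)" "upow U k o\<^sub>L a k"] by simp
  also have "\<dots> \<le> 1 * norm (upow U k o\<^sub>L a k)"
    by (intro mult_right_mono norm_unitary_le unitary_upow U) simp
  finally show ?thesis using * by simp
qed simp

text \<open>The closure of the range is a C*-algebra; it contains the generators as images of
  families supported at 0 and at 1.\<close>

lemma covrep_dense:
  assumes b: "b \<in> DA"
  obtains a where "\<And>i. a i \<in> fsupp" "(\<lambda>i. covrep (a i)) \<longlonglongrightarrow> b"
proof -
  let ?R = "covrep ` fsupp"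
  have sub: "?R \<subseteq> DA" using covrep_mem by auto
  have mem: "B \<in> closure ?R \<Longrightarrow> clinear_op B" for B
    using closure_minimal[OF sub D.closed_T] D.clin by blast
  \<comment> \<open>A continuous binary operation that preserves the range also preserves its
    closure; scalar multiplication fits with a dummy second argument.\<close>
  have op2: "f A B \<in> closure ?R" if AB: "A \<in> closure ?R" "B \<in> closure ?R"
    and f: "\<And>x y. x \<in> ?R \<Longrightarrow> y \<in> ?R \<Longrightarrow> f x y \<in> ?R"
      "\<And>X Y A B. X \<longlonglongrightarrow> A \<Longrightarrow> Y \<longlonglongrightarrow> B \<Longrightarrow> (\<lambda>n. f (X n) (Y n)) \<longlonglongrightarrow> f A B" for f A B
  proof -
    obtain X Y where XY: "\<And>n. X n \<in> ?R" "X \<longlonglongrightarrow> A" "\<And>n. Y n \<in> ?R" "Y \<longlonglongrightarrow> B"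
      using AB unfolding closure_sequential by blast
    then show ?thesis
      unfolding closure_sequential by (intro exI[of _ "\<lambda>n. f (X n) (Y n)"]) (auto intro!: f)
  qed
  have "DA \<subseteq> closure ?R"
    unfolding dilation_algebra_def
  proof (rule cstar_generated_minimal)
    have "ampliation A \<in> ?R" if "A \<in> ET" for A
      using covrep_delta[of 0 A] delta_fsupp[OF that, of 0] by (auto intro!: image_eqI[of _ _ "delta 0 A"])
    moreover have "W \<in> ?R"
      using covrep_delta[of 1 id_blinfun] delta_fsupp[OF E.id_mem, of 1]
      by (auto intro!: image_eqI[of _ _ "delta 1 id_blinfun"])
    ultimately show "ampliation ` ET \<union> {W} \<subseteq> closure ?R"
      by (auto intro!: closure_subset[THEN subsetD])
    have "0 \<in> ?R"
      using delta_fsupp[OF E.zero_mem, of 0] covrep_delta[of 0 0]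
      by (auto intro!: image_eqI[of _ _ "delta 0 0"] simp: compose_zero_right)
    then show "0 \<in> closure ?R" by (rule closure_subset[THEN subsetD])
    show "A + B \<in> closure ?R" if "A \<in> closure ?R" "B \<in> closure ?R" for A B
      using that by (rule op2[where f = "(+)"]) (auto intro!: tendsto_add covrep_add[symmetric] image_eqI[OF _ add_fsupp])
    show "A o\<^sub>L B \<in> closure ?R" if "A \<in> closure ?R" "B \<in> closure ?R" for A B
      using that by (rule op2[where f = "(o\<^sub>L)"])
        (auto intro!: tendsto_compose_op covrep_conv[symmetric] image_eqI[OF _ conv_fsupp])
    show "scaleC_op c A \<in> closure ?R" if "A \<in> closure ?R" for c A
      using that that by (rule op2[where f = "\<lambda>x _. scaleC_op c x"])
        (auto intro!: tendsto_scaleC_op covrep_scaleC[symmetric] image_eqI[OF _ scale_fsupp])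
    show "adj A \<in> closure ?R" if "A \<in> closure ?R" for A
    proof -
      obtain X where X: "\<And>n. X n \<in> ?R" "X \<longlonglongrightarrow> A" using \<open>A \<in> closure ?R\<close> unfolding closure_sequential by blast
      have "adj (X n) \<in> ?R" for n
        using X(1)[of n] by (auto simp: covrep_invol[symmetric] intro: invol_fsupp)
      moreover have "(\<lambda>n. adj (X n)) \<longlonglongrightarrow> adj A"
        using X sub D.clin by (intro tendsto_adj) auto
      ultimately show ?thesis unfolding closure_sequential by (intro exI[of _ "\<lambda>n. adj (X n)"]) auto
    qed
  qed (use mem in auto)
  then have "b \<in> closure ?R" using b by auto
  then obtain X where X: "\<And>i. X i \<in> ?R" "X \<longlonglongrightarrow> b" unfolding closure_sequential by blast
  then have "\<exists>a. a \<in> fsupp \<and> X i = covrep a" for i by force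
  then obtain a where a: "\<And>i. a i \<in> fsupp" "\<And>i. X i = covrep (a i)" by metis
  then have "X = (\<lambda>i. covrep (a i))" by auto
  with a(1) X(2) show ?thesis by (intro that) simp_all
qed

end

section \<open>C*-seminorms on the algebraic crossed product\<close>

text \<open>If y < x, dividing by x^n with n = 2^m bounds 1 by (a n + b) z^n for z = y / x < 1,
  which tends to 0.\<close>

lemma le_if_powers_le_linear:
  fixes x y a b :: real
  assumes "0 \<le> x" "0 \<le> y" and le: "\<And>m. x ^ (2 ^ m) \<le> (a * 2 ^ m + b) * y ^ (2 ^ m)"
  shows "x \<le> y"
proof (rule ccontr)
  assume "\<not> x \<le> y"
  then have xy: "y < x" by simp
  show False
  proof (cases "y = 0")
    case True
    then show False using le[of 0] xy by simp
  next
    case False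
    then have y: "y > 0" using assms by simp
    define z where "z = y / x"
    have z: "0 < z" "z < 1" using xy y by (auto simp: z_def)
    have "(\<lambda>n. real n * z ^ n) \<longlonglongrightarrow> 0" using z by (intro powser_times_n_limit_0) auto
    moreover have "(\<lambda>n. z ^ n) \<longlonglongrightarrow> 0" using z by (intro LIMSEQ_power_zero) simp
    ultimately have *: "(\<lambda>n. a * (real n * z ^ n) + b * z ^ n) \<longlonglongrightarrow> a * 0 + b * 0"
      by (intro tendsto_add tendsto_mult tendsto_const)
    have "((\<lambda>n. a * (real n * z ^ n) + b * z ^ n) \<circ> (\<lambda>m. 2 ^ m)) \<longlonglongrightarrow> a * 0 + b * 0"
      by (rule LIMSEQ_subseq_LIMSEQ[OF *]) (simp add: strict_mono_def)
    moreover have "1 \<le> ((\<lambda>n. a * (real n * z ^ n) + b * z ^ n) \<circ> (\<lambda>m. 2 ^ m)) m" for m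
    proof -
      have "1 \<le> (a * 2 ^ m + b) * y ^ (2 ^ m) / x ^ (2 ^ m)"
        using le[of m] xy y by (simp add: field_simps)
      then show ?thesis by (simp add: z_def power_divide algebra_simps add_divide_distrib)
    qed
    ultimately have "1 \<le> a * 0 + b * 0" by (intro LIMSEQ_le_const[OF _]) auto
    then show False by simp
  qed
qed

context dilation
begin

text \<open>The conditions of \<open>cstar_seminorm\<close> transported to families over the
  Cuntz--Toeplitz algebra, to which seminorms on the crossed product pull back.\<close>

definition cp_seminorm :: "((int \<Rightarrow> 'n fock_op) \<Rightarrow> real) \<Rightarrow> bool"
  where "cp_seminorm p \<longleftrightarrow>
    (\<forall>a\<in>fsupp. 0 \<le> p a \<and> p (conv (invol a) a) = (p a)\<^sup>2 \<and> (\<forall>c. p (\<lambda>k. scaleC_op c (a k)) = cmod c * p a)) \<and>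
    (\<forall>a\<in>fsupp. \<forall>b\<in>fsupp. p (\<lambda>k. a k + b k) \<le> p a + p b \<and> p (conv a b) \<le> p a * p b)"

lemma cp_seminormD:
  assumes "cp_seminorm p" "a \<in> fsupp"
  shows "0 \<le> p a" "p (conv (invol a) a) = (p a)\<^sup>2" "p (\<lambda>k. scaleC_op c (a k)) = cmod c * p a"
    "b \<in> fsupp \<Longrightarrow> p (\<lambda>k. a k + b k) \<le> p a + p b" "b \<in> fsupp \<Longrightarrow> p (conv a b) \<le> p a * p b"
  using assms unfolding cp_seminorm_def by blast+

text \<open>This is the seminorm that will attain the supremum in
  \<open>universal_norm\<close>.\<close>

lemma cp_seminorm_qnorm: "cp_seminorm (\<lambda>a. B.qnorm (covrep a))"
  unfolding cp_seminorm_def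
  by (auto simp: covrep_conv covrep_invol covrep_scaleC covrep_add invol_fsupp covrep_mem
      B.qnorm_nonneg B.qnorm_adj_compose_self B.qnorm_scaleC B.qnorm_triangle B.qnorm_compose)

lemma conv_delta: "conv a (delta k A) m = twist k (a (m - k)) o\<^sub>L A"
  by (subst conv_eq[of "{k}"]) (auto simp: delta_def)

lemma conv_invol_delta:
  "conv (invol (delta k A)) (delta k A) = delta 0 (adj A o\<^sub>L A)"
proof
  fix m
  show "conv (invol (delta k A)) (delta k A) m = delta 0 (adj A o\<^sub>L A) m"
    unfolding conv_delta invol_def twist_add by (auto simp: delta_def compose_zero_left)
qed

lemma delta_add: "(\<lambda>j. delta k A j + delta k B j) = delta k (A + B)"
  by (auto simp: delta_def)

lemma delta_scaleC: "(\<lambda>j. scaleC_op c (delta k A j)) = delta k (scaleC_op c A)"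
proof
  have "scaleC_op c 0 = (0 :: 'n fock_op)" using norm_scaleC_op[of c "0 :: 'n fock_op"] by simp
  then show "scaleC_op c (delta k A j) = delta k (scaleC_op c A) j" for j by (simp add: delta_def)
qed

text \<open>At k = 0 the seminorm restricts to a C*-seminorm on the coefficient algebra; for other
  k, the product of the adjoint of \<open>delta k A\<close> with \<open>delta k A\<close> is
  supported at 0.\<close>

lemma cp_seminorm_delta_le:
  assumes p: "cp_seminorm p" and A: "A \<in> ET"
  shows "p (delta k A) \<le> norm A"
proof -
  have 0: "p (delta 0 B) \<le> norm B" if "B \<in> ET" for B
  proof (rule E.cstar_seminorm_le_norm[of "\<lambda>B. p (delta 0 B)", OF _ _ _ _ that])
    fix A B :: "'n fock_op" and c assume A: "A \<in> ET"
    note a = delta_fsupp[OF A, of 0]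
    show "0 \<le> p (delta 0 A)" by (rule cp_seminormD[OF p a])
    show "p (delta 0 (adj A o\<^sub>L A)) = (p (delta 0 A))\<^sup>2"
      using cp_seminormD(2)[OF p a] by (simp add: conv_invol_delta)
    show "p (delta 0 (scaleC_op c A)) = cmod c * p (delta 0 A)"
      using cp_seminormD(3)[OF p a] by (simp add: delta_scaleC)
    assume B: "B \<in> ET"
    show "p (delta 0 (A + B)) \<le> p (delta 0 A) + p (delta 0 B)"
      using cp_seminormD(4)[OF p a delta_fsupp[OF B, of 0]] by (simp add: delta_add)
  qed
  note a = delta_fsupp[OF A, of k]
  have "(p (delta k A))\<^sup>2 = p (delta 0 (adj A o\<^sub>L A))"
    using cp_seminormD(2)[OF p a] by (simp add: conv_invol_delta)
  also have "\<dots> \<le> norm (adj A o\<^sub>L A)" using A by (intro 0 E.compose_mem E.adj_mem)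
  also have "\<dots> = (norm A)\<^sup>2" by (rule norm_adj_compose_self[OF E.clin[OF A]])
  finally show ?thesis by (rule power2_le_imp_le) simp
qed

lemma cp_seminorm_zero:
  assumes p: "cp_seminorm p"
  shows "p (\<lambda>_. 0) = 0"
  using cp_seminormD(3)[OF p delta_fsupp[OF E.zero_mem, of 0], of 0] by simp

lemma cp_seminorm_le_sum:
  assumes p: "cp_seminorm p" and a: "a \<in> fsupp" and F: "finite F" "\<And>k. k \<notin> F \<Longrightarrow> a k = 0"
  shows "p a \<le> (\<Sum>k\<in>F. norm (a k))"
proof -
  have "p (\<lambda>k. if k \<in> G then a k else 0) \<le> (\<Sum>k\<in>G. norm (a k)) \<and> (\<lambda>k. if k \<in> G then a k else 0) \<in> fsupp"
    if "finite G" for G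
    using that
  proof (induction G rule: finite_induct)
    case empty
    then show ?case using cp_seminorm_zero[OF p] fsuppI[of "\<lambda>_. 0" "{}"] by (simp add: E.zero_mem)
  next
    case (insert j G)
    have eq: "(\<lambda>k. if k \<in> insert j G then a k else 0) = (\<lambda>k. delta j (a j) k + (if k \<in> G then a k else 0))"
      using insert by (auto simp: delta_def)
    have aj: "a j \<in> ET" using a by (rule fsuppD)
    have "p (\<lambda>k. delta j (a j) k + (if k \<in> G then a k else 0)) \<le> p (delta j (a j)) + p (\<lambda>k. if k \<in> G then a k else 0)"
      using insert by (intro cp_seminormD[OF p] delta_fsupp aj) auto
    then show ?case
      unfolding eq using insert cp_seminorm_delta_le[OF p aj, of j] add_fsupp[OF delta_fsupp[OF aj, of j]]
      by auto
  qed
  note * = this[OF F(1)]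
  have "(\<lambda>k. if k \<in> F then a k else 0) = a" using F(2) by auto
  then show ?thesis using * by simp
qed

text \<open>Amenability of \<open>\<int>\<close>, in the form of polynomial growth: for \<open>x = a\<^sup>*a\<close> the elements \<open>x\<^sup>n\<close> have
  support of size linear in \<open>n\<close>, so that the crude bound of \<open>p\<close> by the sum of the coefficient norms
  improves to the operator norm on taking \<open>n\<close>-th roots.\<close>

lemma cp_seminorm_le_norm_covrep:
  assumes p: "cp_seminorm p" and a: "a \<in> fsupp"
  shows "p a \<le> norm (covrep a)"
proof -
  \<comment> \<open>A radius of the support; inserting 0 keeps the maximum defined for a =
    0.\<close>
  define D where "D = Max (insert 0 (abs ` {k. a k \<noteq> 0}))"
  have fin: "finite (insert 0 (abs ` {k. a k \<noteq> 0}))" using fsuppD(2)[OF a] by simp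
  have D: "a k = 0" if "\<bar>k\<bar> > D" for k
  proof (rule ccontr)
    assume "a k \<noteq> 0"
    then have "\<bar>k\<bar> \<le> D" unfolding D_def using fin by (intro Max_ge) auto
    then show False using that by simp
  qed
  have D0: "D \<ge> 0" unfolding D_def using fin by (intro Max_ge) auto
  \<comment> \<open>From x 1 on the elements are self-adjoint, so this is repeated squaring of adj a
    a. The seminorm is squared exactly at each step, while the support radius only doubles.\<close>
  define x where "x m = ((\<lambda>y. conv (invol y) y) ^^ m) a" for m
  have x: "x m \<in> fsupp \<and> p (x m) = p a ^ (2 ^ m) \<and> norm (covrep (x m)) \<le> norm (covrep a) ^ (2 ^ m) \<and>
      (\<forall>k. \<bar>k\<bar> > D * 2 ^ m \<longrightarrow> x m k = 0)" for m
  proof (induction m)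
    case 0
    then show ?case using a D by (simp add: x_def)
  next
    case (Suc m)
    let ?y = "x m"
    have S: "x (Suc m) = conv (invol ?y) ?y" by (simp add: x_def)
    have y: "?y \<in> fsupp" and y0: "\<And>k. \<bar>k\<bar> > D * 2 ^ m \<Longrightarrow> ?y k = 0" using Suc by auto
    have "x (Suc m) \<in> fsupp" unfolding S by (intro conv_fsupp invol_fsupp y)
    moreover have "p (x (Suc m)) = p a ^ (2 ^ Suc m)"
      unfolding S using cp_seminormD(2)[OF p y] Suc by (simp flip: power_mult add: mult.commute)
    moreover have "norm (covrep (x (Suc m))) \<le> norm (covrep a) ^ (2 ^ Suc m)"
    proof -
      have "norm (covrep (x (Suc m))) \<le> norm (adj (covrep ?y)) * norm (covrep ?y)"
        unfolding S using y by (simp add: covrep_conv invol_fsupp covrep_invol norm_blinfun_compose)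
      also have "\<dots> = (norm (covrep ?y))\<^sup>2"
        using D.clin[OF covrep_mem[OF y]] by (simp add: norm_adj_compose_self power2_eq_square)
      also have "\<dots> \<le> (norm (covrep a) ^ (2 ^ m))\<^sup>2" using Suc by (intro power_mono) auto
      finally show ?thesis by (simp flip: power_mult add: mult.commute)
    qed
    moreover have "x (Suc m) k = 0" if k: "\<bar>k\<bar> > D * 2 ^ Suc m" for k
      unfolding S
    proof (rule conv_support)
      let ?F = "{- (D * 2 ^ m)..D * 2 ^ m}"
      show "?y j = 0" if "j \<notin> ?F" for j using that by (intro y0) auto
      show "invol ?y j = 0" if "j \<notin> ?F" for j
      proof -
        have "?y (- j) = 0" using that by (intro y0) auto
        then show ?thesis by (simp add: invol_def)
      qed
      show "k \<notin> (\<lambda>(j, k). j + k) ` (?F \<times> ?F)" using k by auto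
    qed
    ultimately show ?case by blast
  qed
  show ?thesis
  proof (rule le_if_powers_le_linear)
    show "0 \<le> p a" by (rule cp_seminormD[OF p a])
    show "p a ^ 2 ^ m \<le> (2 * real_of_int D * 2 ^ m + 1) * norm (covrep a) ^ 2 ^ m" for m
    proof -
      let ?F = "{- (D * 2 ^ m)..D * 2 ^ m}"
      have xm: "x m \<in> fsupp" using x by blast
      have "p a ^ 2 ^ m = p (x m)" using x by simp
      also have "\<dots> \<le> (\<Sum>k\<in>?F. norm (x m k))"
        using x[of m] by (intro cp_seminorm_le_sum p xm) auto
      also have "\<dots> \<le> (\<Sum>k\<in>?F. norm (covrep a) ^ 2 ^ m)"
        using x[of m] by (intro sum_mono order_trans[OF norm_coefficient_le_covrep[OF xm]]) auto
      also have "\<dots> = real (card ?F) * norm (covrep a) ^ 2 ^ m" by simp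
      also have "real (card ?F) = 2 * real_of_int D * 2 ^ m + 1"
      proof -
        have "0 \<le> D * 2 ^ m + D * 2 ^ m + 1" using D0 by (intro add_nonneg_nonneg) auto
        then show ?thesis by (simp add: nat_add_distrib D0)
      qed
      finally show ?thesis .
    qed
  qed simp
qed

text \<open>Continuity of p with respect to the operator norm of the represented family, which is
  what an extension to the closure amounts to.\<close>

lemma cp_seminorm_diff_le:
  assumes p: "cp_seminorm p" and a: "a \<in> fsupp" and b: "b \<in> fsupp"
  shows "p a \<le> norm (covrep a - covrep b) + p b"
proof -
  have "p (\<lambda>k. (a k - b k) + b k) \<le> p (\<lambda>k. a k - b k) + p b"
    by (rule cp_seminormD(4)[OF p diff_fsupp[OF a b] b])
  then show ?thesis
    using cp_seminorm_le_norm_covrep[OF p diff_fsupp[OF a b]] by (simp add: covrep_diff a b)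
qed

lemma cp_seminorm_le_qnorm:
  assumes p: "cp_seminorm p" and null: "\<And>A. A \<in> compact_ops \<Longrightarrow> p (delta 0 A) = 0" and a: "a \<in> fsupp"
  shows "p a \<le> B.qnorm (covrep a)"
proof -
  \<comment> \<open>The kernel of the continuous extension of p, described through approximants:
    limits of represented families whose seminorms tend to 0.\<close>
  define I where "I = {b \<in> DA. \<forall>e>0. \<exists>a\<in>fsupp. norm (b - covrep a) < e \<and> p a < e}"
  have I: "\<exists>a\<in>fsupp. norm (b - covrep a) < e \<and> p a < e" if "b \<in> I" "e > 0" for b e
    using that by (auto simp: I_def)
  have closed: "closed I"
    unfolding closed_sequential_limits
  proof (intro allI impI)
    fix X l assume X: "(\<forall>n. X n \<in> I) \<and> X \<longlonglongrightarrow> l"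
    show "l \<in> I"
      unfolding I_def
    proof (intro CollectI conjI allI impI)
      show "l \<in> DA"
        using closed_sequentially[OF D.closed_T, of X l] X by (auto simp: I_def)
      fix e :: real assume e: "e > 0"
      then obtain n where n: "norm (X n - l) < e / 2" using X LIMSEQ_D[of X l "e / 2"] by auto
      obtain x where x: "x \<in> fsupp" "norm (X n - covrep x) < e / 2" "p x < e / 2"
        using I[of "X n" "e / 2"] X e by auto
      have "l - covrep x = (X n - covrep x) - (X n - l)" by simp
      then have "norm (l - covrep x) \<le> norm (X n - covrep x) + norm (X n - l)"
        by (simp only: norm_triangle_ineq4)
      then show "\<exists>a\<in>fsupp. norm (l - covrep a) < e \<and> p a < e"
        using x n e by (intro bexI[of _ x]) auto
    qed
  qed
  \<comment> \<open>The ideal property is proved for multipliers in the dense range, where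
    approximants can be convolved, and then carried over by closedness of I.\<close>
  have covrep_mult: "b o\<^sub>L covrep y \<in> I \<and> covrep y o\<^sub>L b \<in> I" if b: "b \<in> I" and y: "y \<in> fsupp" for b y
  proof -
    define K where "K = norm (covrep y) + 1"
    have K: "K > 0" unfolding K_def by (intro add_nonneg_pos) auto
    have py: "0 \<le> p y" "p y \<le> K"
      using cp_seminormD(1)[OF p y] cp_seminorm_le_norm_covrep[OF p y] by (simp_all add: K_def)
    have "\<exists>x\<in>fsupp. norm (b - covrep x) * norm (covrep y) < e \<and> p x * p y < e" if "e > 0" for e
    proof -
      obtain x where x: "x \<in> fsupp" "norm (b - covrep x) < e / K" "p x < e / K"
        using I[OF b, of "e / K"] \<open>e > 0\<close> K by auto
      have "u * v < e" if "0 \<le> u" "u < e / K" "0 \<le> v" "v \<le> K" for u v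
      proof -
        have "u * v \<le> u * K" using that by (intro mult_left_mono) auto
        also have "\<dots> < e" using that K by (simp add: field_simps)
        finally show ?thesis .
      qed
      then show ?thesis using x py cp_seminormD(1)[OF p x(1)] by (intro bexI[of _ x]) (auto simp: K_def)
    qed
    note key = this
    have bB: "b \<in> DA" using b by (simp add: I_def)
    have "\<exists>a\<in>fsupp. norm ((b o\<^sub>L covrep y) - covrep a) < e \<and> p a < e"
      "\<exists>a\<in>fsupp. norm ((covrep y o\<^sub>L b) - covrep a) < e \<and> p a < e" if e: "e > 0" for e
    proof -
      obtain x where x: "x \<in> fsupp" "norm (b - covrep x) * norm (covrep y) < e" "p x * p y < e"
        using key[OF e] by blast
      have "norm ((b o\<^sub>L covrep y) - covrep (conv x y)) < e" "norm ((covrep y o\<^sub>L b) - covrep (conv y x)) < e"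
        using le_less_trans[OF norm_blinfun_compose[of "b - covrep x" "covrep y"] x(2)] x y
          le_less_trans[OF norm_blinfun_compose[of "covrep y" "b - covrep x"]]
        by (simp_all add: covrep_conv compose_diff_left compose_diff_right mult.commute)
      moreover have "p (conv x y) < e" "p (conv y x) < e"
        using cp_seminormD(5)[OF p x(1) y] cp_seminormD(5)[OF p y x(1)] x(3) by (simp_all add: mult.commute)
      ultimately show "\<exists>a\<in>fsupp. norm ((b o\<^sub>L covrep y) - covrep a) < e \<and> p a < e"
        "\<exists>a\<in>fsupp. norm ((covrep y o\<^sub>L b) - covrep a) < e \<and> p a < e"
        using conv_fsupp x(1) y by blast+
    qed
    then show ?thesis
      using bB covrep_mem[OF y] by (simp add: I_def D.compose_mem)
  qed
  have mult: "b o\<^sub>L c \<in> I \<and> c o\<^sub>L b \<in> I" if b: "b \<in> I" and c: "c \<in> DA" for b c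
  proof -
    obtain y where y: "\<And>n. y n \<in> fsupp" and lim: "(\<lambda>n. covrep (y n)) \<longlonglongrightarrow> c"
      using covrep_dense[OF c] by blast
    have "(\<lambda>n. b o\<^sub>L covrep (y n)) \<longlonglongrightarrow> (b o\<^sub>L c)" "(\<lambda>n. covrep (y n) o\<^sub>L b) \<longlonglongrightarrow> (c o\<^sub>L b)"
      by (intro tendsto_compose_op lim tendsto_const)+
    then show ?thesis
      using closed_sequentially[OF closed, of "\<lambda>n. b o\<^sub>L covrep (y n)"]
        closed_sequentially[OF closed, of "\<lambda>n. covrep (y n) o\<^sub>L b"] covrep_mult[OF b y] by blast
  qed
  have delta_I: "ampliation A \<in> I" if "A \<in> compact_ops" for A
    unfolding I_def using that null[OF that] E.J_T[OF that]
    by (auto simp: ampliation_mem covrep_delta intro!: bexI[of _ "delta 0 A"] delta_fsupp)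
  have "ideal I (op_algebra DA)"
    unfolding D.ideal_op_algebra_iff
  proof (intro conjI ballI)
    show "I \<subseteq> DA" by (auto simp: I_def)
    show "0 \<in> I" using delta_I[OF compact_ops_zero] by simp
    show "b + c \<in> I" if b: "b \<in> I" and c: "c \<in> I" for b c
      unfolding I_def
    proof (intro CollectI conjI allI impI)
      show "b + c \<in> DA" using that by (auto simp: I_def intro: D.add_mem)
      fix e :: real assume "e > 0"
      then obtain x y where xy: "x \<in> fsupp" "norm (b - covrep x) < e / 2" "p x < e / 2"
        "y \<in> fsupp" "norm (c - covrep y) < e / 2" "p y < e / 2"
        using I[OF b, of "e / 2"] I[OF c, of "e / 2"] half_gt_zero by blast
      have "b + c - covrep (\<lambda>k. x k + y k) = (b - covrep x) + (c - covrep y)"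
        using xy by (simp add: covrep_add)
      then have "norm (b + c - covrep (\<lambda>k. x k + y k)) \<le> norm (b - covrep x) + norm (c - covrep y)"
        by (simp only: norm_triangle_ineq)
      then show "\<exists>a\<in>fsupp. norm (b + c - covrep a) < e \<and> p a < e"
        using xy cp_seminormD(4)[OF p xy(1,4)] by (intro bexI[of _ "\<lambda>k. x k + y k"] add_fsupp) auto
    qed
  qed (use mult in auto)
  moreover have "ampliation ` compact_ops \<subseteq> I" using delta_I by auto
  ultimately have JI: "DJ \<subseteq> I"
    unfolding dilation_ideal_def by (intro D.closed_ideal_generated_least closed)
  show ?thesis
  proof (rule field_le_epsilon)
    fix e :: real assume e: "e > 0"
    obtain j where j: "j \<in> DJ" "norm (covrep a - j) < B.qnorm (covrep a) + e / 3"
      using B.qnorm_approx[of "e / 3"] e by auto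
    obtain x where x: "x \<in> fsupp" "norm (j - covrep x) < e / 3" "p x < e / 3"
      using I[of j "e / 3"] j JI e by auto
    \<comment> \<open>j nearly attains the distance, and x approximates j with small
      seminorm.\<close>
    have "p a \<le> norm (covrep a - covrep x) + p x" by (rule cp_seminorm_diff_le[OF p a x(1)])
    also have "norm (covrep a - covrep x) \<le> norm (covrep a - j) + norm (j - covrep x)"
      using norm_triangle_ineq[of "covrep a - j" "j - covrep x"] by simp
    finally show "p a \<le> B.qnorm (covrep a) + e" using j x by simp
  qed
qed

end

section \<open>The crossed product\<close>

context dilation
begin

abbreviation "AP \<equiv> algebraic_crossed_product cuntz_algebra (induced_aut U)"

lemmas cuntz_simps = E.quot_simps[folded cuntz_algebra_def]

lemma conj_by_inverse: "conj_by U (conj_by (adj U) A) = A" "conj_by (adj U) (conj_by U A) = A"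
  by (simp_all add: twist_add flip: twist_1 twist_minus1)

lemma conj_by_compact_iff: "conj_by U A \<in> compact_ops \<longleftrightarrow> A \<in> compact_ops"
  using conj_by_compact[of U A] conj_by_compact[of "adj U" "conj_by U A"] cU
  by (auto simp: conj_by_inverse)

text \<open>The image of a coset is a full coset because conjugation by U maps the compact operators
  onto themselves.\<close>

lemma induced_aut_cl: "induced_aut U (E.cl A) = E.cl (conj_by U A)"
proof -
  have "induced_aut U (E.cl A) = {C. conj_by (adj U) C - A \<in> compact_ops}"
    unfolding induced_aut_def E.cl_def
    by (auto simp: conj_by_inverse intro!: image_eqI[of _ _ "conj_by (adj U) _"])
  also have "\<dots> = E.cl (conj_by U A)"
    unfolding E.cl_def
    by (subst conj_by_compact_iff[symmetric]) (simp add: conj_by_diff conj_by_inverse)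
  finally show ?thesis .
qed

lemma induced_aut_pow_cl: "(induced_aut U ^^ n) (E.cl A) = E.cl (twist (int n) A)"
proof (induction n)
  case (Suc n)
  have "twist 1 (twist (int n) A) = twist (int (Suc n)) A" by (simp add: twist_add add.commute)
  then show ?case using Suc by (simp add: induced_aut_cl flip: twist_1)
qed simp

text \<open>Negative powers in \<open>int_iterate\<close> are formed with \<open>inv_into\<close> on
  the carrier, so injectivity on cosets is what identifies them.\<close>

lemma inv_induced_aut_cl:
  assumes "A \<in> ET"
  shows "inv_into (carrier cuntz_algebra) (induced_aut U) (E.cl A) = E.cl (conj_by (adj U) A)"
proof (rule inv_into_f_eq)
  show "inj_on (induced_aut U) (carrier cuntz_algebra)"
  proof (rule inj_onI)
    fix X Y assume "X \<in> carrier cuntz_algebra" "Y \<in> carrier cuntz_algebra" "induced_aut U X = induced_aut U Y"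
    then obtain A B where "X = E.cl A" "Y = E.cl B" "E.cl (conj_by U A) = E.cl (conj_by U B)"
      by (auto simp: cuntz_simps induced_aut_cl)
    then show "X = Y" by (simp add: E.cl_eq_iff conj_by_compact_iff flip: conj_by_diff)
  qed
  show "E.cl (conj_by (adj U) A) \<in> carrier cuntz_algebra"
    using assms by (simp add: cuntz_simps conj_adj_mem)
qed (simp add: induced_aut_cl conj_by_inverse)

lemma inv_induced_aut_pow_cl:
  assumes "A \<in> ET"
  shows "(inv_into (carrier cuntz_algebra) (induced_aut U) ^^ n) (E.cl A) = E.cl (twist (- int n) A)"
proof (induction n)
  case (Suc n)
  have "- int n + - 1 = - int (Suc n)" by simp
  then have "twist (-1) (twist (- int n) A) = twist (- int (Suc n)) A" by (simp only: twist_add)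
  then show ?case using Suc by (simp add: inv_induced_aut_cl twist_mem assms flip: twist_minus1)
qed simp

lemma int_iterate_cl:
  assumes "A \<in> ET"
  shows "int_iterate cuntz_algebra (induced_aut U) k (E.cl A) = E.cl (twist k A)"
  using induced_aut_pow_cl[of "nat k" A] inv_induced_aut_pow_cl[OF assms, of "nat (- k)"]
  by (simp add: int_iterate_def)

section \<open>The algebraic crossed product as a quotient of families\<close>

definition clf :: "(int \<Rightarrow> 'n fock_op) \<Rightarrow> int \<Rightarrow> 'n fock_op set"
  where "clf a = (\<lambda>k. E.cl (a k))"

lemma clf_eq_iff: "clf a = clf b \<longleftrightarrow> (\<forall>k. a k - b k \<in> compact_ops)"
  by (auto simp: clf_def fun_eq_iff E.cl_eq_iff)

lemma carrier_AP: "carrier AP = clf ` fsupp"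
proof (intro equalityI subsetI)
  fix f assume "f \<in> carrier AP"
  then have f: "\<And>k. f k \<in> E.cl ` ET" "finite {k. f k \<noteq> E.cl 0}"
    by (auto simp: algebraic_crossed_product_def cuntz_simps)
  \<comment> \<open>The zero coset is lifted to 0 itself; otherwise the lift could have infinite
    support.\<close>
  have "\<exists>A. A \<in> ET \<and> f k = E.cl A \<and> (f k = E.cl 0 \<longrightarrow> A = 0)" for k
    using f(1)[of k] E.zero_mem by (cases "f k = E.cl 0") auto
  then obtain a where a: "\<And>k. a k \<in> ET \<and> f k = E.cl (a k) \<and> (f k = E.cl 0 \<longrightarrow> a k = 0)" by metis
  then have "a \<in> fsupp" using f(2) by (intro fsuppI[of a "{k. f k \<noteq> E.cl 0}"]) auto
  moreover have "f = clf a" using a by (auto simp: clf_def)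
  ultimately show "f \<in> clf ` fsupp" by blast
next
  fix f assume "f \<in> clf ` fsupp"
  then obtain a where a: "a \<in> fsupp" "f = clf a" by auto
  have "{k. E.cl (a k) \<noteq> E.cl 0} \<subseteq> {k. a k \<noteq> 0}" by auto
  then have "finite {k. E.cl (a k) \<noteq> E.cl 0}" using fsuppD(2)[OF a(1)] finite_subset by blast
  then show "f \<in> carrier AP"
    using a fsuppD(1)[OF a(1)] by (simp add: algebraic_crossed_product_def cuntz_simps clf_def)
qed

lemma add_AP: "a \<in> fsupp \<Longrightarrow> b \<in> fsupp \<Longrightarrow> clf a \<oplus>\<^bsub>AP\<^esub> clf b = clf (\<lambda>k. a k + b k)"
  by (simp add: algebraic_crossed_product_def clf_def cuntz_simps fsuppD(1))

lemma zero_AP: "\<zero>\<^bsub>AP\<^esub> = clf (\<lambda>_. 0)"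
  by (simp add: algebraic_crossed_product_def clf_def cuntz_simps)

lemma one_AP: "\<one>\<^bsub>AP\<^esub> = clf (delta 0 id_blinfun)"
  by (rule ext) (simp add: algebraic_crossed_product_def clf_def cuntz_simps delta_def)

lemma scal_AP: "a \<in> fsupp \<Longrightarrow> scal AP c (clf a) = clf (\<lambda>k. scaleC_op c (a k))"
  by (simp add: algebraic_crossed_product_def clf_def cuntz_simps fsuppD(1))

lemma star_AP: "a \<in> fsupp \<Longrightarrow> star AP (clf a) = clf (invol a)"
  by (simp add: algebraic_crossed_product_def clf_def cuntz_simps fsuppD(1) int_iterate_cl E.adj_mem invol_def)

text \<open>The product in \<open>AP\<close> sums over nonzero cosets b(k), \<open>conv\<close> over
  nonzero operators b(k); the additional terms have compact b(k) and vanish modulo the compact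
  operators.\<close>

lemma mult_AP:
  assumes a: "a \<in> fsupp" and b: "b \<in> fsupp"
  shows "clf a \<otimes>\<^bsub>AP\<^esub> clf b = clf (conv a b)"
proof
  fix m
  let ?S = "{k. E.cl (b k) \<noteq> E.cl 0}"
  have sub: "?S \<subseteq> {k. b k \<noteq> 0}" by auto
  then have fin: "finite ?S" using fsuppD(2)[OF b] finite_subset by blast
  have mem: "twist k (a (m - k)) o\<^sub>L b k \<in> ET" for k
    using a b by (intro E.compose_mem twist_mem fsuppD)
  have "(clf a \<otimes>\<^bsub>AP\<^esub> clf b) m = (\<Oplus>\<^bsub>cuntz_algebra\<^esub>k\<in>?S. E.cl (twist k (a (m - k)) o\<^sub>L b k))"
    using fsuppD(1)[OF a] fsuppD(1)[OF b]
    by (simp add: algebraic_crossed_product_def clf_def cuntz_simps int_iterate_cl twist_mem)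
  also have "\<dots> = E.cl (\<Sum>k\<in>?S. twist k (a (m - k)) o\<^sub>L b k)"
    unfolding cuntz_algebra_def by (rule E.finsum_quot[OF fin mem])
  also have "\<dots> = E.cl (conv a b m)"
  proof -
    have "conv a b m = (\<Sum>k\<in>{k. b k \<noteq> 0} - ?S. twist k (a (m - k)) o\<^sub>L b k) + (\<Sum>k\<in>?S. twist k (a (m - k)) o\<^sub>L b k)"
      unfolding conv_def by (rule sum.subset_diff[OF sub fsuppD(2)[OF b]])
    then have "conv a b m - (\<Sum>k\<in>?S. twist k (a (m - k)) o\<^sub>L b k)
        = (\<Sum>k\<in>{k. b k \<noteq> 0} - ?S. twist k (a (m - k)) o\<^sub>L b k)" by simp
    also have "\<dots> \<in> compact_ops"
    proof (rule E.J_sum)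
      fix k assume "k \<in> {k. b k \<noteq> 0} - ?S"
      then have "b k \<in> compact_ops" using E.cl_eq_iff[of "b k" 0] by simp
      then show "twist k (a (m - k)) o\<^sub>L b k \<in> compact_ops"
        using a by (intro E.J_left twist_mem fsuppD)
    qed
    finally show ?thesis by (simp add: E.cl_eq_iff[of "conv a b m", THEN iffD2])
  qed
  finally show "(clf a \<otimes>\<^bsub>AP\<^esub> clf b) m = clf (conv a b) m" by (simp add: clf_def)
qed

text \<open>Subtraction in \<open>cauchy_algebra\<close> is defined through the group inverse, so
  \<open>AP\<close> is first shown to be an abelian group.\<close>

lemma minus_AP:
  assumes a: "a \<in> fsupp" and b: "b \<in> fsupp"
  shows "clf a \<ominus>\<^bsub>AP\<^esub> clf b = clf (\<lambda>k. a k - b k)"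
proof -
  have z: "(\<lambda>_. 0) \<in> fsupp" using delta_fsupp[OF E.zero_mem, of 0] by (simp add: delta_def)
  have "abelian_group AP"
  proof (rule abelian_groupI)
    fix f assume "f \<in> carrier AP"
    then obtain a where a: "a \<in> fsupp" "f = clf a" by (auto simp: carrier_AP)
    then show "\<exists>g\<in>carrier AP. g \<oplus>\<^bsub>AP\<^esub> f = \<zero>\<^bsub>AP\<^esub>"
      using diff_fsupp[OF z a(1)] by (intro bexI[of _ "clf (\<lambda>k. 0 - a k)"]) (auto simp: add_AP zero_AP carrier_AP)
  qed (auto simp: carrier_AP add_AP zero_AP add_fsupp z add_ac)
  then interpret AP: abelian_group AP .
  have "\<ominus>\<^bsub>AP\<^esub> clf b = clf (\<lambda>k. 0 - b k)"
    using b diff_fsupp[OF z b] by (intro AP.minus_equality) (auto simp: add_AP zero_AP carrier_AP)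
  then show ?thesis
    using a diff_fsupp[OF z b] by (simp add: a_minus_def add_AP)
qed

lemma covrep_compact:
  assumes "\<And>k. a k \<in> compact_ops" "a \<in> fsupp"
  shows "covrep a \<in> DJ"
proof -
  have "upow W k \<in> DA" for k
    using covrep_mem[OF delta_fsupp[OF E.id_mem, of k]] by (simp add: covrep_delta)
  moreover have "ampliation (a k) \<in> DJ" for k
    using assms(1) D.closed_ideal_generated_superset unfolding dilation_ideal_def by blast
  ultimately show ?thesis unfolding covrep_def by (intro B.J_sum B.J_left)
qed

lemma covrep_diff_mem:
  assumes "a \<in> fsupp" "b \<in> fsupp" "clf a = clf b"
  shows "covrep a - covrep b \<in> DJ"
  using covrep_compact[OF _ diff_fsupp[OF assms(1,2)]] assms by (simp add: clf_eq_iff covrep_diff)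

lemma cp_seminorm_clf:
  assumes p: "cstar_seminorm AP p"
  shows "cp_seminorm (\<lambda>a. p (clf a))"
proof -
  have p1: "0 \<le> p (clf a)" "p (star AP (clf a) \<otimes>\<^bsub>AP\<^esub> clf a) = (p (clf a))\<^sup>2"
    "p (scal AP c (clf a)) = cmod c * p (clf a)" if "a \<in> fsupp" for a c
    using p that unfolding cstar_seminorm_def carrier_AP by blast+
  have p2: "p (clf a \<oplus>\<^bsub>AP\<^esub> clf b) \<le> p (clf a) + p (clf b)" "p (clf a \<otimes>\<^bsub>AP\<^esub> clf b) \<le> p (clf a) * p (clf b)"
    if "a \<in> fsupp" "b \<in> fsupp" for a b
    using p that unfolding cstar_seminorm_def carrier_AP by blast+
  show ?thesis
    unfolding cp_seminorm_def
    using p1 p2 by (simp add: add_AP mult_AP scal_AP star_AP invol_fsupp)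
qed

text \<open>The supremum is a maximum. The quotient norm is one of the seminorms, and any other
  pulls back to one that vanishes on compact coefficients, where \<open>cp_seminorm_le_qnorm\<close>
  applies.\<close>

lemma universal_norm_clf:
  assumes a: "a \<in> fsupp"
  shows "universal_norm AP (clf a) = B.qnorm (covrep a)"
  unfolding universal_norm_def
proof (rule cSup_eq_maximum)
  \<comment> \<open>An arbitrary lift is chosen; by \<open>covrep_diff_mem\<close> two lifts differ
    by an element of \<open>DJ\<close> after representation, so the value does not depend on
    it.\<close>
  define p where "p f = B.qnorm (covrep (inv_into fsupp clf f))" for f
  have p: "p (clf b) = B.qnorm (covrep b)" if b: "b \<in> fsupp" for b
  proof -
    let ?c = "inv_into fsupp clf (clf b)"
    have "?c \<in> fsupp" "clf ?c = clf b"
      by (rule inv_into_into[OF imageI[OF b]], rule f_inv_into_f[OF imageI[OF b]])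
    then show ?thesis unfolding p_def using b by (intro B.qnorm_cong covrep_diff_mem)
  qed
  have "cstar_seminorm AP p"
    unfolding cstar_seminorm_def carrier_AP
    using cp_seminorm_qnorm
    by (simp add: cp_seminorm_def p add_AP mult_AP scal_AP star_AP add_fsupp conv_fsupp scale_fsupp invol_fsupp)
  then show "B.qnorm (covrep a) \<in> (\<lambda>p. p (clf a)) ` {p. cstar_seminorm AP p}"
    using p[OF a] by (intro image_eqI[of _ _ p]) auto
next
  fix y assume "y \<in> (\<lambda>p. p (clf a)) ` {p. cstar_seminorm AP p}"
  then obtain p where y: "y = p (clf a)" and p: "cstar_seminorm AP p" by auto
  note cp = cp_seminorm_clf[OF p]
  have "p (clf (delta 0 A)) = 0" if "A \<in> compact_ops" for A
  proof -
    have "clf (delta 0 A) = clf (\<lambda>_. 0)" using that compact_ops_zero by (auto simp: clf_eq_iff delta_def)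
    then show ?thesis using cp_seminorm_zero[OF cp] by simp
  qed
  then show "y \<le> B.qnorm (covrep a)" unfolding y by (rule cp_seminorm_le_qnorm[OF cp _ a])
qed

section \<open>Completion by Cauchy sequences\<close>

abbreviation "CA \<equiv> cauchy_algebra AP (universal_norm AP)"

text \<open>A Cauchy sequence \<open>x\<close> in the algebraic crossed product converges to the class of \<open>b\<close> modulo
  \<open>dilation_ideal U\<close>.\<close>

definition conv_to :: "(nat \<Rightarrow> int \<Rightarrow> 'n fock_op set) \<Rightarrow> (('n list, l2_circle) ell2 \<Rightarrow>\<^sub>L ('n list, l2_circle) ell2) \<Rightarrow> bool"
  where "conv_to x b \<longleftrightarrow> b \<in> DA \<and> (\<exists>a. (\<forall>i. a i \<in> fsupp \<and> x i = clf (a i)) \<and>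
    (\<lambda>i. B.qnorm (covrep (a i) - b)) \<longlonglongrightarrow> 0)"

lemma conv_toE:
  assumes "conv_to x b"
  obtains a where "b \<in> DA" "\<And>i. a i \<in> fsupp" "x = (\<lambda>i. clf (a i))"
    "(\<lambda>i. B.qnorm (covrep (a i) - b)) \<longlonglongrightarrow> 0"
  using assms unfolding conv_to_def by (metis ext)

lemma conv_toI:
  assumes "b \<in> DA" "\<And>i. a i \<in> fsupp" "(\<lambda>i. B.qnorm (covrep (a i) - b)) \<longlonglongrightarrow> 0"
  shows "conv_to (\<lambda>i. clf (a i)) b"
  using assms unfolding conv_to_def by (intro conjI exI[of _ a]) auto

lemma null_sandwich:
  fixes f g :: "nat \<Rightarrow> real"
  assumes "\<And>i. 0 \<le> f i" "\<And>i. f i \<le> g i" "g \<longlonglongrightarrow> 0"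
  shows "f \<longlonglongrightarrow> 0"
  by (rule tendsto_sandwich[OF _ _ tendsto_const assms(3)]) (use assms(1,2) in auto)

lemma qnorm_diff_triangle: "B.qnorm (x - z) \<le> B.qnorm (x - y) + B.qnorm (y - z)"
  using B.qnorm_triangle[of "x - y" "y - z"] by simp

text \<open>Two lifts of the same sequence differ by elements of \<open>DJ\<close>, which the
  quotient norm ignores.\<close>

lemma conv_to_unique:
  assumes "conv_to x b" "conv_to x c"
  shows "b - c \<in> DJ"
proof -
  obtain a where a: "\<And>i. a i \<in> fsupp" "x = (\<lambda>i. clf (a i))" "(\<lambda>i. B.qnorm (covrep (a i) - b)) \<longlonglongrightarrow> 0"
    using assms(1) by (rule conv_toE) (rule that)
  obtain a' where a': "\<And>i. a' i \<in> fsupp" "x = (\<lambda>i. clf (a' i))" "(\<lambda>i. B.qnorm (covrep (a' i) - c)) \<longlonglongrightarrow> 0"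
    using assms(2) by (rule conv_toE) (rule that)
  have "clf (a i) = clf (a' i)" for i using a(2) a'(2) by metis
  then have J: "covrep (a i) - covrep (a' i) \<in> DJ" for i
    using a a' by (intro covrep_diff_mem)
  have "(\<lambda>_. B.qnorm (b - c)) \<longlonglongrightarrow> 0"
  proof (rule null_sandwich)
    show "B.qnorm (b - c) \<le> B.qnorm (covrep (a i) - b) + B.qnorm (covrep (a' i) - c)" for i
    proof -
      have "B.qnorm (covrep (a i) - c) = B.qnorm (covrep (a' i) - c)"
        using J[of i] by (intro B.qnorm_cong) simp
      then show ?thesis
        using qnorm_diff_triangle[of b c "covrep (a i)"] B.qnorm_minus_commute[of b "covrep (a i)"] by simp
    qed
    show "(\<lambda>i. B.qnorm (covrep (a i) - b) + B.qnorm (covrep (a' i) - c)) \<longlonglongrightarrow> 0"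
      using tendsto_add[OF a(3) a'(3)] by simp
  qed (rule B.qnorm_nonneg)
  then have "B.qnorm (b - c) = 0" using LIMSEQ_unique tendsto_const by blast
  then show ?thesis by (simp add: B.qnorm_eq_0_iff)
qed

lemma conv_to_cong:
  assumes "conv_to x b" "b - c \<in> DJ" "c \<in> DA"
  shows "conv_to x c"
proof -
  obtain a where a: "\<And>i. a i \<in> fsupp" "x = (\<lambda>i. clf (a i))" "(\<lambda>i. B.qnorm (covrep (a i) - b)) \<longlonglongrightarrow> 0"
    using assms(1) by (rule conv_toE) (rule that)
  have "B.qnorm (covrep (a i) - b) = B.qnorm (covrep (a i) - c)" for i
    using B.J_diff_commute[OF assms(2)] by (intro B.qnorm_cong) simp
  then show ?thesis using a assms(3) by (auto intro!: conv_toI)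
qed

lemma conv_to_exists:
  assumes "b \<in> DA"
  obtains x where "conv_to x b"
proof -
  obtain a where a: "\<And>i. a i \<in> fsupp" "(\<lambda>i. covrep (a i)) \<longlonglongrightarrow> b"
    using covrep_dense[OF assms] by blast
  have "(\<lambda>i. norm (covrep (a i) - b)) \<longlonglongrightarrow> 0"
    using a(2) by (simp add: LIM_zero_iff tendsto_norm_zero)
  then have "(\<lambda>i. B.qnorm (covrep (a i) - b)) \<longlonglongrightarrow> 0"
    by (rule null_sandwich[OF B.qnorm_nonneg B.qnorm_le_norm])
  then have "conv_to (\<lambda>i. clf (a i)) b" by (intro conv_toI assms a(1))
  then show ?thesis by (rule that)
qed

text \<open>The universal norm is the quotient norm of the represented lifts, so Cauchy sequences
  have limits by completeness of \<open>DA\<close> modulo \<open>DJ\<close>.\<close>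

lemma carrier_CA: "x \<in> carrier CA \<longleftrightarrow> (\<exists>b. conv_to x b)"
proof
  assume x: "x \<in> carrier CA"
  then have "\<forall>i. \<exists>a. a \<in> fsupp \<and> x i = clf a" by (auto simp: cauchy_algebra_def carrier_AP)
  then obtain a where a: "\<And>i. a i \<in> fsupp" "\<And>i. x i = clf (a i)" by metis
  have eq: "universal_norm AP (x i \<ominus>\<^bsub>AP\<^esub> x j) = B.qnorm (covrep (a i) - covrep (a j))" for i j
    using a by (simp add: minus_AP universal_norm_clf diff_fsupp covrep_diff)
  obtain c where c: "c \<in> DA" "(\<lambda>i. B.qnorm (covrep (a i) - c)) \<longlonglongrightarrow> 0"
  proof (rule B.quotient_complete[of "\<lambda>i. covrep (a i)"])
    show "covrep (a i) \<in> DA" for i using a by (simp add: covrep_mem)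
    show "\<exists>N. \<forall>i\<ge>N. \<forall>j\<ge>N. B.qnorm (covrep (a i) - covrep (a j)) < e" if "e > 0" for e
      using x that by (simp add: cauchy_algebra_def flip: eq)
  qed
  have "x = (\<lambda>i. clf (a i))" using a by auto
  moreover have "conv_to (\<lambda>i. clf (a i)) c" by (intro conv_toI c a(1))
  ultimately show "\<exists>b. conv_to x b" by auto
next
  assume "\<exists>b. conv_to x b"
  then obtain b a where a: "\<And>i. a i \<in> fsupp" "x = (\<lambda>i. clf (a i))" "(\<lambda>i. B.qnorm (covrep (a i) - b)) \<longlonglongrightarrow> 0"
    by (elim exE conv_toE) (rule that)
  have "\<exists>N. \<forall>i\<ge>N. \<forall>j\<ge>N. universal_norm AP (x i \<ominus>\<^bsub>AP\<^esub> x j) < e" if e: "e > 0" for e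
  proof -
    obtain N where N: "\<And>i. i \<ge> N \<Longrightarrow> B.qnorm (covrep (a i) - b) < e / 2"
      using LIMSEQ_D[OF a(3), of "e / 2"] e B.qnorm_nonneg by auto
    have "universal_norm AP (x i \<ominus>\<^bsub>AP\<^esub> x j) < e" if "i \<ge> N" "j \<ge> N" for i j
    proof -
      have "universal_norm AP (x i \<ominus>\<^bsub>AP\<^esub> x j) = B.qnorm (covrep (a i) - covrep (a j))"
        using a by (simp add: minus_AP universal_norm_clf diff_fsupp covrep_diff)
      also have "\<dots> \<le> B.qnorm (covrep (a i) - b) + B.qnorm (covrep (a j) - b)"
        using qnorm_diff_triangle[of "covrep (a i)" "covrep (a j)" b] B.qnorm_minus_commute[of b "covrep (a j)"] by simp
      also have "\<dots> < e" using N[OF that(1)] N[OF that(2)] by simp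
      finally show ?thesis .
    qed
    then show ?thesis by blast
  qed
  moreover have "x i \<in> carrier AP" for i using a by (simp add: carrier_AP)
  ultimately show "x \<in> carrier CA" by (simp add: cauchy_algebra_def)
qed

lemma conv_to_add:
  assumes "conv_to x b" "conv_to y c"
  shows "conv_to (x \<oplus>\<^bsub>CA\<^esub> y) (b + c)"
proof -
  obtain u where u: "b \<in> DA" "\<And>i. u i \<in> fsupp" "x = (\<lambda>i. clf (u i))"
    "(\<lambda>i. B.qnorm (covrep (u i) - b)) \<longlonglongrightarrow> 0" using assms(1) by (rule conv_toE) (rule that)
  obtain v where v: "c \<in> DA" "\<And>i. v i \<in> fsupp" "y = (\<lambda>i. clf (v i))"
    "(\<lambda>i. B.qnorm (covrep (v i) - c)) \<longlonglongrightarrow> 0" using assms(2) by (rule conv_toE) (rule that)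
  have "(\<lambda>i. B.qnorm (covrep (\<lambda>k. u i k + v i k) - (b + c))) \<longlonglongrightarrow> 0"
  proof (rule null_sandwich[OF B.qnorm_nonneg])
    show "B.qnorm (covrep (\<lambda>k. u i k + v i k) - (b + c)) \<le> B.qnorm (covrep (u i) - b) + B.qnorm (covrep (v i) - c)" for i
      using B.qnorm_triangle[of "covrep (u i) - b" "covrep (v i) - c"] u v
      by (simp add: covrep_add algebra_simps)
    show "(\<lambda>i. B.qnorm (covrep (u i) - b) + B.qnorm (covrep (v i) - c)) \<longlonglongrightarrow> 0"
      using tendsto_add[OF u(4) v(4)] by simp
  qed
  then have "conv_to (\<lambda>i. clf (\<lambda>k. u i k + v i k)) (b + c)"
    using u v by (intro conv_toI D.add_mem add_fsupp)
  then show ?thesis using u v by (simp add: cauchy_algebra_def add_AP)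
qed

lemma conv_to_scal:
  assumes "conv_to x b"
  shows "conv_to (scal CA c x) (scaleC_op c b)"
proof -
  obtain u where u: "b \<in> DA" "\<And>i. u i \<in> fsupp" "x = (\<lambda>i. clf (u i))"
    "(\<lambda>i. B.qnorm (covrep (u i) - b)) \<longlonglongrightarrow> 0" using assms by (rule conv_toE) (rule that)
  have "scaleC_op c (covrep (u i)) - scaleC_op c b = scaleC_op c (covrep (u i) - b)" for i
    using scaleC_op_add[of c "covrep (u i) - b" b] by simp
  then have "(\<lambda>i. B.qnorm (covrep (\<lambda>k. scaleC_op c (u i k)) - scaleC_op c b)) \<longlonglongrightarrow> 0"
    using u tendsto_mult_right_zero[OF u(4), of "cmod c"] by (simp add: covrep_scaleC B.qnorm_scaleC)
  then have "conv_to (\<lambda>i. clf (\<lambda>k. scaleC_op c (u i k))) (scaleC_op c b)"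
    using u by (intro conv_toI D.scaleC_mem scale_fsupp)
  then show ?thesis using u by (simp add: cauchy_algebra_def scal_AP)
qed

lemma conv_to_star:
  assumes "conv_to x b"
  shows "conv_to (star CA x) (adj b)"
proof -
  obtain u where u: "b \<in> DA" "\<And>i. u i \<in> fsupp" "x = (\<lambda>i. clf (u i))"
    "(\<lambda>i. B.qnorm (covrep (u i) - b)) \<longlonglongrightarrow> 0" using assms by (rule conv_toE) (rule that)
  have "B.qnorm (covrep (invol (u i)) - adj b) = B.qnorm (covrep (u i) - b)" for i
    using u B.qnorm_adj[of "covrep (u i) - b"] covrep_mem[OF u(2)]
    by (simp add: covrep_invol adj_diff D.clin D.diff_mem)
  then have "conv_to (\<lambda>i. clf (invol (u i))) (adj b)"
    using u by (intro conv_toI D.adj_mem invol_fsupp) auto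
  then show ?thesis using u by (simp add: cauchy_algebra_def star_AP)
qed

lemma conv_to_mult:
  assumes "conv_to x b" "conv_to y c"
  shows "conv_to (x \<otimes>\<^bsub>CA\<^esub> y) (b o\<^sub>L c)"
proof -
  obtain u where u: "b \<in> DA" "\<And>i. u i \<in> fsupp" "x = (\<lambda>i. clf (u i))"
    "(\<lambda>i. B.qnorm (covrep (u i) - b)) \<longlonglongrightarrow> 0" using assms(1) by (rule conv_toE) (rule that)
  obtain v where v: "c \<in> DA" "\<And>i. v i \<in> fsupp" "y = (\<lambda>i. clf (v i))"
    "(\<lambda>i. B.qnorm (covrep (v i) - c)) \<longlonglongrightarrow> 0" using assms(2) by (rule conv_toE) (rule that)
  let ?d = "\<lambda>i. B.qnorm (covrep (u i) - b)" and ?e = "\<lambda>i. B.qnorm (covrep (v i) - c)"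
  have "(\<lambda>i. B.qnorm (covrep (conv (u i) (v i)) - (b o\<^sub>L c))) \<longlonglongrightarrow> 0"
  proof (rule null_sandwich[OF B.qnorm_nonneg])
    fix i
    \<comment> \<open>Expansion around the limits: every term tends to 0 without a uniform bound on
      the lifts.\<close>
    have eq: "covrep (conv (u i) (v i)) - (b o\<^sub>L c)
        = ((covrep (u i) - b) o\<^sub>L (covrep (v i) - c)) + (((covrep (u i) - b) o\<^sub>L c) + (b o\<^sub>L (covrep (v i) - c)))"
      using u v by (simp add: covrep_conv compose_diff_left compose_diff_right)
    have m: "covrep (u i) - b \<in> DA" "covrep (v i) - c \<in> DA"
      using u v by (auto intro: D.diff_mem covrep_mem)
    show "B.qnorm (covrep (conv (u i) (v i)) - (b o\<^sub>L c)) \<le> ?d i * ?e i + (?d i * B.qnorm c + B.qnorm b * ?e i)"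
      unfolding eq using u(1) v(1) m
      by (intro order_trans[OF B.qnorm_triangle] add_mono B.qnorm_compose) auto
  next
    have "(\<lambda>i. ?d i * ?e i + (?d i * B.qnorm c + B.qnorm b * ?e i)) \<longlonglongrightarrow> 0 * 0 + (0 * B.qnorm c + B.qnorm b * 0)"
      by (intro tendsto_add tendsto_mult u(4) v(4) tendsto_const)
    then show "(\<lambda>i. ?d i * ?e i + (?d i * B.qnorm c + B.qnorm b * ?e i)) \<longlonglongrightarrow> 0" by simp
  qed
  then have "conv_to (\<lambda>i. clf (conv (u i) (v i))) (b o\<^sub>L c)"
    using u v by (intro conv_toI D.compose_mem conv_fsupp)
  then show ?thesis using u v by (simp add: cauchy_algebra_def mult_AP)
qed

lemma conv_to_one: "conv_to \<one>\<^bsub>CA\<^esub> id_blinfun"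
proof -
  have "conv_to (\<lambda>_. clf (delta 0 id_blinfun)) id_blinfun"
    by (intro conv_toI D.id_mem delta_fsupp E.id_mem) (simp add: covrep_delta B.qnorm_eq_0_iff[THEN iffD2, OF B.J_zero])
  then show ?thesis by (simp add: cauchy_algebra_def one_AP)
qed

text \<open>Subtracting lifts termwise gives the missing summand. Both orders are recorded: cosets
  of null sequences add x on the right, sums of cosets take x on the left.\<close>

lemma conv_to_split:
  assumes "conv_to z (b + c)" "conv_to x b" "c \<in> DA"
  obtains y where "conv_to y c" "z = x \<oplus>\<^bsub>CA\<^esub> y" "z = y \<oplus>\<^bsub>CA\<^esub> x"
proof -
  obtain u where u: "\<And>i. u i \<in> fsupp" "z = (\<lambda>i. clf (u i))"
    "(\<lambda>i. B.qnorm (covrep (u i) - (b + c))) \<longlonglongrightarrow> 0" using assms(1) by (rule conv_toE) (rule that)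
  obtain v where v: "\<And>i. v i \<in> fsupp" "x = (\<lambda>i. clf (v i))"
    "(\<lambda>i. B.qnorm (covrep (v i) - b)) \<longlonglongrightarrow> 0" using assms(2) by (rule conv_toE) (rule that)
  have "(\<lambda>i. B.qnorm (covrep (\<lambda>k. u i k - v i k) - c)) \<longlonglongrightarrow> 0"
  proof (rule null_sandwich[OF B.qnorm_nonneg])
    show "B.qnorm (covrep (\<lambda>k. u i k - v i k) - c) \<le> B.qnorm (covrep (u i) - (b + c)) + B.qnorm (covrep (v i) - b)" for i
      using B.qnorm_triangle[of "covrep (u i) - (b + c)" "b - covrep (v i)"] u v
        B.qnorm_minus_commute[of b "covrep (v i)"]
      by (simp add: covrep_diff algebra_simps)
    show "(\<lambda>i. B.qnorm (covrep (u i) - (b + c)) + B.qnorm (covrep (v i) - b)) \<longlonglongrightarrow> 0"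
      using tendsto_add[OF u(3) v(3)] by simp
  qed
  then have "conv_to (\<lambda>i. clf (\<lambda>k. u i k - v i k)) c"
    using u v assms(3) by (intro conv_toI diff_fsupp)
  moreover have "z = x \<oplus>\<^bsub>CA\<^esub> (\<lambda>i. clf (\<lambda>k. u i k - v i k))" "z = (\<lambda>i. clf (\<lambda>k. u i k - v i k)) \<oplus>\<^bsub>CA\<^esub> x"
    using u v by (simp_all add: cauchy_algebra_def add_AP diff_fsupp)
  ultimately show ?thesis by (rule that)
qed

text \<open>The coset in the completion that corresponds to b: all Cauchy sequences with limit b
  modulo \<open>DJ\<close>.\<close>

definition fib :: "(('n list, l2_circle) ell2 \<Rightarrow>\<^sub>L ('n list, l2_circle) ell2) \<Rightarrow> (nat \<Rightarrow> int \<Rightarrow> 'n fock_op set) set"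
  where "fib b = {x. conv_to x b}"

abbreviation "NA \<equiv> {x \<in> carrier CA. (\<lambda>i. universal_norm AP (x i)) \<longlonglongrightarrow> 0}"

lemma null_sequences: "NA = fib 0"
proof -
  have "(\<lambda>i. universal_norm AP (x i)) \<longlonglongrightarrow> 0 \<longleftrightarrow> conv_to x 0" if x: "conv_to x b" for x b
  proof -
    obtain a where a: "\<And>i. a i \<in> fsupp" "x = (\<lambda>i. clf (a i))" using x by (rule conv_toE) (rule that)
    have eq: "universal_norm AP (x i) = B.qnorm (covrep (a i) - 0)" for i
      using a by (simp add: universal_norm_clf)
    show ?thesis
    proof
      assume "(\<lambda>i. universal_norm AP (x i)) \<longlonglongrightarrow> 0"
      then show "conv_to x 0" unfolding eq unfolding a(2) by (intro conv_toI D.zero_mem a(1))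
    next
      assume "conv_to x 0"
      then obtain a' where a': "\<And>i. a' i \<in> fsupp" "x = (\<lambda>i. clf (a' i))"
        "(\<lambda>i. B.qnorm (covrep (a' i) - 0)) \<longlonglongrightarrow> 0" by (rule conv_toE) (rule that)
      then show "(\<lambda>i. universal_norm AP (x i)) \<longlonglongrightarrow> 0" by (simp add: universal_norm_clf)
    qed
  qed
  then show ?thesis by (auto simp: fib_def carrier_CA)
qed

lemma coset_CA:
  assumes x: "conv_to x b"
  shows "NA +>\<^bsub>CA\<^esub> x = fib b"
proof -
  have b: "b \<in> DA" using x by (rule conv_toE)
  have "NA +>\<^bsub>CA\<^esub> x = (\<Union>n\<in>fib 0. {n \<oplus>\<^bsub>CA\<^esub> x})"
    by (simp add: null_sequences a_r_coset_def r_coset_def)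
  also have "\<dots> = fib b"
  proof (intro equalityI subsetI)
    fix y assume "y \<in> (\<Union>n\<in>fib 0. {n \<oplus>\<^bsub>CA\<^esub> x})"
    then show "y \<in> fib b" using conv_to_add[OF _ x, of _ 0] by (auto simp: fib_def)
  next
    fix y assume "y \<in> fib b"
    then have "conv_to y (b + 0)" by (simp add: fib_def)
    then obtain n where "conv_to n 0" "y = n \<oplus>\<^bsub>CA\<^esub> x"
      using conv_to_split[OF _ x D.zero_mem] by blast
    then show "y \<in> (\<Union>n\<in>fib 0. {n \<oplus>\<^bsub>CA\<^esub> x})" by (auto simp: fib_def)
  qed
  finally show ?thesis .
qed

text \<open>Equality is tested on a single sequence converging to b, which exists by density of
  \<open>covrep\<close>.\<close>

lemma fib_eq_iff:
  assumes "b \<in> DA" "c \<in> DA"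
  shows "fib b = fib c \<longleftrightarrow> b - c \<in> DJ"
proof
  assume *: "fib b = fib c"
  obtain x where "conv_to x b" using conv_to_exists[OF assms(1)] .
  moreover have "conv_to x c" using * \<open>conv_to x b\<close> by (auto simp: fib_def)
  ultimately show "b - c \<in> DJ" by (rule conv_to_unique)
next
  assume "b - c \<in> DJ"
  then show "fib b = fib c"
    using assms B.J_diff_commute[of b c] by (auto simp: fib_def intro: conv_to_cong)
qed

section \<open>The crossed product as a quotient of the dilation algebra\<close>

abbreviation "CP \<equiv> crossed_product cuntz_algebra (induced_aut U)"

lemma CP_eq: "CP = cstar_quot CA NA"
  by (simp add: crossed_product_def cstar_completion_def)

lemma carrier_CP: "carrier CP = fib ` DA"
proof -
  have "carrier CP = (\<Union>x\<in>carrier CA. {NA +>\<^bsub>CA\<^esub> x})"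
    by (simp add: CP_eq cstar_quot_def FactRing_def A_RCOSETS_def RCOSETS_def a_r_coset_def)
  also have "\<dots> = fib ` DA"
  proof (intro equalityI subsetI)
    fix X assume "X \<in> (\<Union>x\<in>carrier CA. {NA +>\<^bsub>CA\<^esub> x})"
    then obtain x b where x: "conv_to x b" "X = NA +>\<^bsub>CA\<^esub> x" by (auto simp: carrier_CA)
    have "b \<in> DA" using x(1) by (rule conv_toE)
    then show "X \<in> fib ` DA" using coset_CA[OF x(1)] x(2) by simp
  next
    fix X assume "X \<in> fib ` DA"
    then obtain b where b: "b \<in> DA" "X = fib b" by auto
    obtain x where "conv_to x b" using conv_to_exists[OF b(1)] .
    then show "X \<in> (\<Union>x\<in>carrier CA. {NA +>\<^bsub>CA\<^esub> x})"
      using coset_CA[of x b] b by (intro UN_I[of x]) (auto simp: carrier_CA)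
  qed
  finally show ?thesis .
qed

lemma fib_nonempty: "b \<in> DA \<Longrightarrow> fib b \<noteq> {}"
  using conv_to_exists[of b] by (auto simp: fib_def)

lemma add_CP:
  assumes "b \<in> DA" "c \<in> DA"
  shows "fib b \<oplus>\<^bsub>CP\<^esub> fib c = fib (b + c)"
proof -
  have "fib b \<oplus>\<^bsub>CP\<^esub> fib c = (\<Union>x\<in>fib b. \<Union>y\<in>fib c. {x \<oplus>\<^bsub>CA\<^esub> y})"
    by (simp add: CP_eq cstar_quot_def FactRing_def set_add_def set_mult_def)
  also have "\<dots> = fib (b + c)"
  proof (intro equalityI subsetI)
    fix z assume "z \<in> (\<Union>x\<in>fib b. \<Union>y\<in>fib c. {x \<oplus>\<^bsub>CA\<^esub> y})"
    then show "z \<in> fib (b + c)" by (auto simp: fib_def intro: conv_to_add)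
  next
    fix z assume z: "z \<in> fib (b + c)"
    obtain x where x: "conv_to x b" using conv_to_exists[OF assms(1)] .
    obtain y where "conv_to y c" "z = x \<oplus>\<^bsub>CA\<^esub> y"
      using conv_to_split[OF _ x assms(2), of z] z by (auto simp: fib_def)
    then show "z \<in> (\<Union>x\<in>fib b. \<Union>y\<in>fib c. {x \<oplus>\<^bsub>CA\<^esub> y})" using x by (auto simp: fib_def)
  qed
  finally show ?thesis .
qed

lemma mult_CP:
  assumes "b \<in> DA" "c \<in> DA"
  shows "fib b \<otimes>\<^bsub>CP\<^esub> fib c = fib (b o\<^sub>L c)"
proof -
  have "fib b \<otimes>\<^bsub>CP\<^esub> fib c = (\<Union>x\<in>fib b. \<Union>y\<in>fib c. NA +>\<^bsub>CA\<^esub> (x \<otimes>\<^bsub>CA\<^esub> y))"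
    by (simp add: CP_eq cstar_quot_def FactRing_def rcoset_mult_def)
  also have "\<dots> = (\<Union>x\<in>fib b. \<Union>y\<in>fib c. fib (b o\<^sub>L c))"
    by (intro SUP_cong refl coset_CA conv_to_mult) (auto simp: fib_def)
  also have "\<dots> = fib (b o\<^sub>L c)" using fib_nonempty assms by simp
  finally show ?thesis .
qed

lemma one_CP: "\<one>\<^bsub>CP\<^esub> = fib id_blinfun"
  using coset_CA[OF conv_to_one] by (simp add: CP_eq cstar_quot_def FactRing_def)

lemma scal_CP:
  assumes "b \<in> DA"
  shows "scal CP c (fib b) = fib (scaleC_op c b)"
proof -
  have "scal CP c (fib b) = (\<Union>x\<in>fib b. NA +>\<^bsub>CA\<^esub> scal CA c x)"
    by (simp add: CP_eq cstar_quot_def)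
  also have "\<dots> = (\<Union>x\<in>fib b. fib (scaleC_op c b))"
    by (intro SUP_cong refl coset_CA conv_to_scal) (auto simp: fib_def)
  also have "\<dots> = fib (scaleC_op c b)" using fib_nonempty assms by simp
  finally show ?thesis .
qed

lemma star_CP:
  assumes "b \<in> DA"
  shows "star CP (fib b) = fib (adj b)"
proof -
  have "star CP (fib b) = (\<Union>x\<in>fib b. NA +>\<^bsub>CA\<^esub> star CA x)"
    by (simp add: CP_eq cstar_quot_def)
  also have "\<dots> = (\<Union>x\<in>fib b. fib (adj b))"
    by (intro SUP_cong refl coset_CA conv_to_star) (auto simp: fib_def)
  also have "\<dots> = fib (adj b)" using fib_nonempty assms by simp
  finally show ?thesis .
qed

text \<open>\<open>fib\<close> and \<open>B.cl\<close> are surjections from \<open>DA\<close> onto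
  the two carriers that identify the same pairs, namely those differing by an element of
  \<open>DJ\<close>; \<theta> matches their values.\<close>

lemma crossed_product_isomorphic:
  "cstar_isomorphic CP (cstar_quot (op_algebra DA) DJ)"
proof -
  define \<theta> where "\<theta> X = B.cl (inv_into DA fib X)" for X
  have \<theta>: "\<theta> (fib b) = B.cl b" if b: "b \<in> DA" for b
  proof -
    let ?c = "inv_into DA fib (fib b)"
    have "?c \<in> DA" "fib ?c = fib b"
      by (rule inv_into_into[OF imageI[OF b]], rule f_inv_into_f[OF imageI[OF b]])
    then show ?thesis unfolding \<theta>_def using b by (simp add: B.cl_eq_iff fib_eq_iff)
  qed
  have "\<theta> \<in> ring_hom CP B.Quo"
    by (rule ring_hom_memI)
      (auto simp: carrier_CP \<theta> add_CP mult_CP one_CP B.quot_simps D.add_mem D.compose_mem D.id_mem)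
  moreover have "bij_betw \<theta> (carrier CP) (carrier B.Quo)"
    unfolding bij_betw_def inj_on_def carrier_CP B.carrier_quot
    by (auto simp: \<theta> B.cl_eq_iff fib_eq_iff image_image)
  ultimately have "\<theta> \<in> ring_iso CP B.Quo" by (simp add: ring_iso_def)
  moreover have "\<forall>a\<in>carrier CP. (\<forall>c. \<theta> (scal CP c a) = scal B.Quo c (\<theta> a)) \<and> \<theta> (star CP a) = star B.Quo (\<theta> a)"
    by (auto simp: carrier_CP \<theta> scal_CP star_CP B.quot_simps D.scaleC_mem D.adj_mem)
  ultimately show ?thesis unfolding cstar_isomorphic_def by blast
qed

end

theorem proposition5p5:
  fixes \<phi> :: "('n::finite) fock_op \<Rightarrow> 'n fock_op" and U :: "'n fock_op"
  assumes "CARD('n) \<ge> 2"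
    and "\<phi> \<in> aut_nc_disc"
    and "implements U \<phi>"
  shows "cstar_isomorphic
    (crossed_product cuntz_algebra (induced_aut U))
    (cstar_quot (op_algebra (dilation_algebra U)) (dilation_ideal U))"
proof -
  interpret dilation U
    using implements_conj_by_mem[OF assms(2,3)] assms(3) by unfold_locales (auto simp: implements_def)
  show ?thesis by (rule crossed_product_isomorphic)
qed

end
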